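(* For any constant $\delta>0$, there exists a (randomized) MPC algorithm that, given a signed graph $G=(V,E^+)$, where $E^+$ denotes the set of edges with weight $+1$, computes in $O(1)$ rounds an $O(1)$-approximate correlation clustering of $G$. Letting $n=|V|$, this algorithm succeeds with probability at least $1-1/n$ and requires $O(n^{\delta})$ memory per machine. Moreover, the algorithm uses a total memory of $O(|E^+|\cdot\log n)$. (The constants hidden in the $O(\cdot)$ notation do not depend on $G$; they may depend on the constant $\delta$.)
   Context: Correlation clustering (min-disagree, complete graph case). The instance is a complete graph on a finite vertex set $V$ whose edges are labeled $+1$ or $-1$; $E^+$ and $E^-$ are the sets of edges labeled $+1$ and $-1$. The instance is specified by $(V,E^+)$, with $E^-=\binom V2\setminus E^+$. A clustering is a partition $C_1,\dots,C_t$ of $V$, and its cost is $$f(C_1,\dots,C_t)=\bigl|\{\{u,v\}\in E^+: u\in C_i,\ v\in C_j,\ i\ne j\}\bigr|+\bigl|\{\{u,v\}\in E^-: u,v\in C_i \text{ for some } i\}\bigr|.$$ A clustering is $\alpha$-approximate if its cost is at most $\alpha$ times the minimum cost over all partitions of $V$ (the number of clusters is not prescribed). By convention every vertex has a "+" self-loop (this does not affect the cost of any clustering). MPC (massively parallel computation) model. Computation proceeds in synchronous parallel rounds over multiple machines, each having memory $S$ (measured in words of $O(\log n)$ bits). At the beginning the input (here, the edges of $E^+$) is arbitrarily partitioned across the machines. During each round, machines process their data locally; at the end of a round machines exchange messages, with the restriction that each machine sends and receives messages of total size at most $S$. The total memory is the sum of the memories used by all machines. The algorithm succeeds if its output is a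 clustering with the claimed approximation guarantee. *)

theory Defs
  imports
    "HOL-Probability.Probability"
    "HOL-Library.Disjoint_Sets"
begin

section \<open>Correlation clustering on complete signed graphs\<close>

text \<open>
  Edges are unordered pairs \<open>{u, v}\<close>. Following the convention that every vertex carries a
  positive self-loop, the set of positive edges contains all singletons \<open>{v}\<close>; they count
  towards the number of positive edges.
\<close>

definition signed_graph :: "'a set \<Rightarrow> 'a set set \<Rightarrow> bool" where
  "signed_graph V Ep \<longleftrightarrow> finite V \<and>
     Ep \<subseteq> {{u, v} | u v. u \<in> V \<and> v \<in> V} \<and> (\<forall>v\<in>V. {v} \<in> Ep)"

definition negative_edges :: "'a set \<Rightarrow> 'a set set \<Rightarrow> 'a set set" where
  "negative_edges V Ep = {{u, v} | u v. u \<in> V \<and> v \<in> V \<and> u \<noteq> v} - Ep"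

definition clustering_cost :: "'a set \<Rightarrow> 'a set set \<Rightarrow> 'a set set \<Rightarrow> nat" where
  "clustering_cost V Ep P =
     card {{u, v} | u v. {u, v} \<in> Ep \<and> (\<exists>C\<in>P. \<exists>D\<in>P. C \<noteq> D \<and> u \<in> C \<and> v \<in> D)} +
     card {{u, v} | u v. {u, v} \<in> negative_edges V Ep \<and> (\<exists>C\<in>P. u \<in> C \<and> v \<in> C)}"

definition optimal_cost :: "'a set \<Rightarrow> 'a set set \<Rightarrow> nat" where
  "optimal_cost V Ep = Min (clustering_cost V Ep ` {P. partition_on V P})"

definition approximate_clustering :: "real \<Rightarrow> 'a set \<Rightarrow> 'a set set \<Rightarrow> 'a set set \<Rightarrow> bool" where
  "approximate_clustering \<alpha> V Ep P \<longleftrightarrow>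
     partition_on V P \<and> real (clustering_cost V Ep P) \<le> \<alpha> * real (optimal_cost V Ep)"


section \<open>Massively parallel computation\<close>

text \<open>
  Memory words are natural numbers; that they have \<open>O(log n)\<close> bits is imposed below by bounding
  them by a fixed power of \<open>n + 1\<close>. A message consists of the number of its destination and a
  payload. The header of a message is charged one word, so that empty payloads are not free.
\<close>

type_synonym message = "nat \<times> nat list"

definition payloads_size :: "nat list list \<Rightarrow> nat" where
  "payloads_size ps = (\<Sum>p\<leftarrow>ps. 1 + length p)"

text \<open>
  An algorithm fixes, for every input size \<open>n\<close>, the number of machines, the memory \<open>S\<close> of each
  machine in words, the number of rounds, and the local computation. The latter depends on
  \<open>n\<close>, the round, the number of the machine, the words stored by the machine and the payloads
  it has received at the end of the previous round, and yields a joint distribution of the words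
  kept and the messages sent. As is usual in this model, local computation is an arbitrary
  (randomized) map: only the data held before and after it, and the communication, are charged.
\<close>

record mpc_algorithm =
  machines :: "nat \<Rightarrow> nat"
  machine_memory :: "nat \<Rightarrow> nat"
  rounds :: "nat \<Rightarrow> nat"
  local_step :: "nat \<Rightarrow> nat \<Rightarrow> nat \<Rightarrow> nat list \<Rightarrow> nat list list \<Rightarrow> (nat list \<times> message list) pmf"

text \<open>
  A profile gives, for each machine, the words kept and the messages sent by a local computation.
\<close>

type_synonym profile = "nat \<Rightarrow> nat list \<times> message list"

definition inbox :: "nat \<Rightarrow> profile \<Rightarrow> nat \<Rightarrow> nat list list" where
  "inbox M a j = concat (map (\<lambda>i. map snd (filter (\<lambda>m. fst m = j) (snd (a i)))) [0..<M])"

definition round_step :: "mpc_algorithm \<Rightarrow> nat \<Rightarrow> nat \<Rightarrow> profile \<Rightarrow> profile pmf" where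
  "round_step A n r a =
     Pi_pmf {..<machines A n} ([], [])
       (\<lambda>i. local_step A n r i (fst (a i)) (inbox (machines A n) a i))"

definition encode_pairs :: "(nat \<times> nat) list \<Rightarrow> nat list" where
  "encode_pairs xs = concat (map (\<lambda>(x, y). [x, y]) xs)"

definition initial_profile :: "(nat \<Rightarrow> (nat \<times> nat) list) \<Rightarrow> profile" where
  "initial_profile inp = (\<lambda>i. (encode_pairs (inp i), []))"

text \<open>
  The possible histories of the first \<open>r\<close> rounds: the initial profile, followed by one profile
  for each round. All machines use fresh independent randomness in each round.
\<close>

primrec history :: "mpc_algorithm \<Rightarrow> nat \<Rightarrow> (nat \<Rightarrow> (nat \<times> nat) list) \<Rightarrow> nat \<Rightarrow> profile list pmf" where
  "history A n inp 0 = return_pmf [initial_profile inp]"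
| "history A n inp (Suc r) =
     bind_pmf (history A n inp r) (\<lambda>h. map_pmf (\<lambda>a. h @ [a]) (round_step A n r (last h)))"

definition execution :: "mpc_algorithm \<Rightarrow> nat \<Rightarrow> (nat \<Rightarrow> (nat \<times> nat) list) \<Rightarrow> profile list pmf" where
  "execution A n inp = history A n inp (rounds A n)"

text \<open>
  A machine holds the words it keeps together with its outgoing messages right after a local
  computation, and together with its incoming messages after the exchange. Bounding both by \<open>S\<close>
  bounds its memory as well as the total size of the messages it sends and of those it receives.
\<close>

definition memory_usage :: "nat \<Rightarrow> profile \<Rightarrow> nat \<Rightarrow> nat" where
  "memory_usage M a i =
     length (fst (a i)) +
     max (payloads_size (map snd (snd (a i)))) (payloads_size (inbox M a i))"

definition total_memory :: "nat \<Rightarrow> profile list \<Rightarrow> nat" where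
  "total_memory M h = (\<Sum>i<M. Max ((\<lambda>a. memory_usage M a i) ` set h))"

definition words_below :: "nat \<Rightarrow> nat \<Rightarrow> profile \<Rightarrow> bool" where
  "words_below W M a \<longleftrightarrow>
     (\<forall>i<M. set (fst (a i)) \<subseteq> {..<W} \<and>
        (\<forall>(d, p)\<in>set (snd (a i)). d < M \<and> set p \<subseteq> {..<W}))"

text \<open>
  The parameter \<open>c\<close> bounds the word length by \<open>c * log 2 (n + 1)\<close> bits; machine numbers are words
  as well.
\<close>

definition respects_mpc_model :: "nat \<Rightarrow> mpc_algorithm \<Rightarrow> nat \<Rightarrow> profile list \<Rightarrow> bool" where
  "respects_mpc_model c A n h \<longleftrightarrow>
     machines A n \<le> (n + 1) ^ c \<and>
     (\<forall>a\<in>set h. words_below ((n + 1) ^ c) (machines A n) a \<and>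
        (\<forall>i<machines A n. memory_usage (machines A n) a i \<le> machine_memory A n))"


section \<open>Input and output of clustering algorithms\<close>

text \<open>
  The vertices are \<open>0, \<dots>, n - 1\<close>. The input is distributed if every positive edge is stored, in one
  of its two orientations, exactly once on exactly one machine, using two words, and no machine
  receives more input than fits into its memory.
\<close>

definition input_distribution ::
    "mpc_algorithm \<Rightarrow> nat \<Rightarrow> nat set set \<Rightarrow> (nat \<Rightarrow> (nat \<times> nat) list) \<Rightarrow> bool" where
  "input_distribution A n Ep inp \<longleftrightarrow>
     (let es = map (\<lambda>(u, v). {u, v}) (concat (map inp [0..<machines A n]))
      in distinct es \<and> set es = Ep) \<and>
     (\<forall>i<machines A n. length (encode_pairs (inp i)) \<le> machine_memory A n)"

text \<open>
  At the end, the machines jointly hold pairs of a vertex and the label of its cluster.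
\<close>

definition outputs_clustering :: "nat \<Rightarrow> profile \<Rightarrow> nat set set \<Rightarrow> bool" where
  "outputs_clustering M a P \<longleftrightarrow>
     (\<exists>out. (\<forall>i<M. fst (a i) = encode_pairs (out i)) \<and>
        (let lab = (\<Union>i<M. set (out i))
         in P = (\<lambda>l. {v. (v, l) \<in> lab}) ` snd ` lab))"

definition succeeds :: "real \<Rightarrow> mpc_algorithm \<Rightarrow> nat \<Rightarrow> nat set set \<Rightarrow> profile list \<Rightarrow> bool" where
  "succeeds \<alpha> A n Ep h \<longleftrightarrow>
     (\<exists>P. outputs_clustering (machines A n) (last h) P \<and> approximate_clustering \<alpha> {..<n} Ep P)"

end

theory Submission
  imports Defs
begin

text \<open>
  Two vertices agree if their closed neighbourhoods differ in few vertices relative to their size,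
  and a vertex is heavy if it agrees with nine tenths of its neighbourhood. Heavy vertices are
  grouped if they agree with a common vertex, all other vertices become singletons. If \<open>u\<close> and \<open>v\<close>
  lie in one cluster of an optimal clustering, the symmetric difference of their neighbourhoods is
  at most the number of its mistakes at \<open>u\<close> and at \<open>v\<close>; this lets one charge every mistake of
  the grouping to mistakes of the optimum.

  Agreement is estimated by min-wise sketches: every vertex draws \<open>O(log n)\<close> random words, and the
  sketch of \<open>u\<close> is their coordinatewise minimum over the neighbourhood of \<open>u\<close>. A coordinate
  distinguishes \<open>u\<close> and \<open>v\<close> with probability close to the Jaccard distance of the neighbourhoods, so
  by Hoeffding's inequality and a union bound no pair is misjudged with probability \<open>1 - 1 / n\<close>.

  In the model, every vertex \<open>u\<close> owns a tree of machines of degree \<open>n powr (\<delta> / 2)\<close> and constant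
  depth, whose leaves are indexed by the neighbours of \<open>u\<close>. A value known at the root is broadcast to
  the leaves, swapped between the leaves \<open>(u, v)\<close> and \<open>(v, u)\<close>, and aggregated on the way back to
  the root. Five such cycles compute the random words, the sketches, the heavy vertices, the least
  heavy vertex agreeing with each vertex, and finally the labels.
\<close>

section \<open>Approximation guarantee of the agreement clustering\<close>

text \<open>Agreement can only be estimated. The approximation argument therefore works for every
  reflexive symmetric relation that rejects pairs at relative distance above 1/10 and accepts pairs
  below 1/50; in between it may answer anything.

  Such a relation is not transitive. The classes are well defined because, among heavy vertices,
  sharing an agreeing vertex is transitive: the agreement sets of heavy vertices are too large to be
  disjoint. Hence any two members of a class are joined by two agreement steps, and its least member
  is found by two exchanges between neighbours. A search for connected components, whose number of
  rounds could grow with the diameter, is avoided.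

  A neighbourhood may be far too large for one machine, but a sketch of \<open>O(log n)\<close>
  words fits. This is why neighbourhoods are spread over trees, and storing one sketch per leaf
  costs \<open>|E| log n\<close> words in total.

  Coins are tossed in a single round, so an execution is the image of one product distribution. All
  resource bounds hold for every outcome; only the approximation guarantee depends on the
  coins.\<close>

lemma card_symmetric_pairs:
  assumes "finite R" "sym R" "irrefl R"
  shows "card R = 2 * card {{u, v} | u v. (u, v) \<in> R}"
proof -
  let ?f = "\<lambda>(u, v). {u, v}"
  have img: "{{u, v} | u v. (u, v) \<in> R} = ?f ` R" by auto
  have fib: "card {p \<in> R. ?f p = e} = 2" if e: "e \<in> ?f ` R" for e
  proof -
    from e obtain u v where uv: "(u, v) \<in> R" "e = {u, v}" by auto
    then have ne: "u \<noteq> v" using assms(3) by (auto simp: irrefl_def)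
    have "{p \<in> R. ?f p = e} = {(u, v), (v, u)}"
      using uv assms(2) by (auto simp: doubleton_eq_iff dest: symD)
    then show ?thesis using ne by simp
  qed
  have "card R = (\<Sum>p\<in>R. 1)" by simp
  also have "\<dots> = (\<Sum>e\<in>?f ` R. \<Sum>p\<in>{p \<in> R. ?f p = e}. 1)"
    by (rule sum.image_gen[OF assms(1)])
  also have "\<dots> = (\<Sum>e\<in>?f ` R. 2)" using fib by (intro sum.cong) auto
  finally show ?thesis unfolding img by simp
qed

section \<open>Mistakes of a clustering, counted at each vertex\<close>

definition nbrs :: "'a set set \<Rightarrow> 'a \<Rightarrow> 'a set" where
  "nbrs E u = {v. {u, v} \<in> E}"

definition together :: "'a set set \<Rightarrow> 'a \<Rightarrow> 'a \<Rightarrow> bool" where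
  "together P u v \<longleftrightarrow> (\<exists>C\<in>P. u \<in> C \<and> v \<in> C)"

definition mistakes :: "'a set \<Rightarrow> 'a set set \<Rightarrow> 'a set set \<Rightarrow> 'a \<Rightarrow> 'a set" where
  "mistakes V E P u = {v \<in> V. (v \<in> nbrs E u) \<noteq> together P u v}"

lemma signed_graph_edgeD:
  assumes "signed_graph V E" "{u, v} \<in> E" shows "u \<in> V \<and> v \<in> V"
proof -
  from assms have "{u, v} \<in> {{u, v} | u v. u \<in> V \<and> v \<in> V}" unfolding signed_graph_def by blast
  then show ?thesis by (auto simp: doubleton_eq_iff)
qed

lemma nbrs_sym: "v \<in> nbrs E u \<longleftrightarrow> u \<in> nbrs E v"
  by (simp add: nbrs_def insert_commute)

lemma together_sym: "together P u v \<longleftrightarrow> together P v u"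
  by (auto simp: together_def)

lemma together_trans:
  assumes "partition_on V P" "together P u v" "together P v w" shows "together P u w"
  using assms partition_onD2[OF assms(1)] unfolding together_def disjoint_def by blast

lemma together_refl:
  assumes "partition_on V P" "u \<in> V" shows "together P u u"
  using assms partition_onD1[OF assms(1)] unfolding together_def by blast

text \<open>Every misplaced pair is counted at both of its endpoints, hence the factor 2. The
  diagonal contributes nothing: by the self-loop a vertex is its own neighbour, and it is together
  with itself. This is the irreflexivity of \<open>R2\<close> and \<open>R1\<close>.\<close>

lemma sum_mistakes:
  assumes G: "signed_graph V E" and P: "partition_on V P"
  shows "(\<Sum>u\<in>V. card (mistakes V E P u)) = 2 * clustering_cost V E P"
proof -
  have fin: "finite V" using G by (simp add: signed_graph_def)
  define R1 where "R1 = {(u, v) \<in> V \<times> V. v \<in> nbrs E u \<and> \<not> together P u v}"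
  define R2 where "R2 = {(u, v) \<in> V \<times> V. v \<notin> nbrs E u \<and> together P u v}"
  have loop: "{u} \<in> E" if "u \<in> V" for u using G that by (simp add: signed_graph_def)
  have f: "finite R1" "finite R2" unfolding R1_def R2_def using fin
    by (auto intro: finite_subset[of _ "V \<times> V"])
  have s: "sym R1" "sym R2" by (auto simp: R1_def R2_def sym_def nbrs_sym together_sym)
  have i: "irrefl R1" "irrefl R2" unfolding R1_def R2_def irrefl_def
    using together_refl[OF P] loop by (auto simp: nbrs_def)
  have PV: "C \<in> P \<Longrightarrow> u \<in> C \<Longrightarrow> u \<in> V" for C u using partition_onD1[OF P] by blast
  have disj: "C = D" if "C \<in> P" "D \<in> P" "u \<in> C" "u \<in> D" for C D u
    using partition_onD2[OF P] that unfolding disjoint_def by blast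
  have e1: "{{u, v} | u v. {u, v} \<in> E \<and> (\<exists>C\<in>P. \<exists>D\<in>P. C \<noteq> D \<and> u \<in> C \<and> v \<in> D)}
      = {{u, v} | u v. (u, v) \<in> R1}"
  proof -
    have "({u, v} \<in> E \<and> (\<exists>C\<in>P. \<exists>D\<in>P. C \<noteq> D \<and> u \<in> C \<and> v \<in> D)) \<longleftrightarrow> (u, v) \<in> R1" for u v
    proof
      assume a: "{u, v} \<in> E \<and> (\<exists>C\<in>P. \<exists>D\<in>P. C \<noteq> D \<and> u \<in> C \<and> v \<in> D)"
      then obtain C D where CD: "C \<in> P" "D \<in> P" "C \<noteq> D" "u \<in> C" "v \<in> D" by blast
      have "\<not> together P u v"
        unfolding together_def using disj CD by metis
      then show "(u, v) \<in> R1" using a CD PV by (auto simp: R1_def nbrs_def)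
    next
      assume a: "(u, v) \<in> R1"
      then have "u \<in> \<Union>P" "v \<in> \<Union>P" using partition_onD1[OF P] by (auto simp: R1_def)
      then obtain C D where "C \<in> P" "D \<in> P" "u \<in> C" "v \<in> D" by blast
      moreover then have "C \<noteq> D" using a by (auto simp: R1_def together_def)
      ultimately show "{u, v} \<in> E \<and> (\<exists>C\<in>P. \<exists>D\<in>P. C \<noteq> D \<and> u \<in> C \<and> v \<in> D)"
        using a by (auto simp: R1_def nbrs_def)
    qed
    then show ?thesis by simp
  qed
  have e2: "{{u, v} | u v. {u, v} \<in> negative_edges V E \<and> (\<exists>C\<in>P. u \<in> C \<and> v \<in> C)}
      = {{u, v} | u v. (u, v) \<in> R2}"
  proof -
    have "({u, v} \<in> negative_edges V E \<and> (\<exists>C\<in>P. u \<in> C \<and> v \<in> C)) \<longleftrightarrow> (u, v) \<in> R2" for u v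
    proof
      assume "{u, v} \<in> negative_edges V E \<and> (\<exists>C\<in>P. u \<in> C \<and> v \<in> C)"
      then show "(u, v) \<in> R2"
        by (auto simp: R2_def negative_edges_def nbrs_def together_def PV)
    next
      assume a: "(u, v) \<in> R2"
      then have "u \<in> V" "v \<in> V" "{u, v} \<notin> E" "together P u v"
        by (auto simp: R2_def nbrs_def)
      moreover from this have "u \<noteq> v" using loop by auto
      ultimately show "{u, v} \<in> negative_edges V E \<and> (\<exists>C\<in>P. u \<in> C \<and> v \<in> C)"
        unfolding negative_edges_def together_def by blast
    qed
    then show ?thesis by simp
  qed
  have "(\<Sum>u\<in>V. card (mistakes V E P u)) = card (SIGMA u:V. mistakes V E P u)"
    using fin by (subst card_SigmaI) (auto simp: mistakes_def)
  also have "(SIGMA u:V. mistakes V E P u) = R1 \<union> R2"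
    by (auto simp: R1_def R2_def mistakes_def)
  also have "card (R1 \<union> R2) = card R1 + card R2"
    using f by (intro card_Un_disjoint) (auto simp: R1_def R2_def)
  also have "\<dots> = 2 * clustering_cost V E P"
    unfolding clustering_cost_def e1 e2
    using card_symmetric_pairs[OF f(1) s(1) i(1)] card_symmetric_pairs[OF f(2) s(2) i(2)] by simp
  finally show ?thesis .
qed

lemma card_sym_diff_triangle:
  assumes "finite A" "finite B" "finite C"
  shows "card (sym_diff A C) \<le> card (sym_diff A B) + card (sym_diff B C)"
proof -
  have "card (sym_diff A C) \<le> card (sym_diff A B \<union> sym_diff B C)"
    using assms by (intro card_mono) auto
  also have "\<dots> \<le> card (sym_diff A B) + card (sym_diff B C)" by (rule card_Un_le)
  finally show ?thesis .
qed

lemma card_le_sym_diff: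
  assumes "finite A" "finite B"
  shows "card A \<le> card B + card (sym_diff A B)"
proof -
  have "card A \<le> card (B \<union> sym_diff A B)" using assms by (intro card_mono) auto
  also have "\<dots> \<le> card B + card (sym_diff A B)" by (rule card_Un_le)
  finally show ?thesis .
qed

section \<open>Agreement, heavy vertices and the charging argument\<close>

definition agreeing :: "'a set set \<Rightarrow> ('a \<Rightarrow> 'a \<Rightarrow> bool) \<Rightarrow> 'a \<Rightarrow> 'a set" where
  "agreeing E Ag u = {v \<in> nbrs E u. Ag u v}"

definition heavy_vertex :: "'a set set \<Rightarrow> ('a \<Rightarrow> 'a \<Rightarrow> bool) \<Rightarrow> 'a \<Rightarrow> bool" where
  "heavy_vertex E Ag u \<longleftrightarrow> 9 * card (nbrs E u) \<le> 10 * card (agreeing E Ag u)"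

text \<open>The constants 10 and 50 leave a gap in which \<open>Ag\<close> is arbitrary, which is
  all that a randomized test can promise. Distances are compared with the degree of \<open>u\<close>
  only; symmetry supplies the bound by the degree of \<open>v\<close>.\<close>

locale agreement =
  fixes V :: "'a set" and E :: "'a set set" and Ag :: "'a \<Rightarrow> 'a \<Rightarrow> bool"
  assumes graph: "signed_graph V E"
    and Ag_refl: "\<And>u. Ag u u"
    and Ag_sym: "\<And>u v. Ag u v \<Longrightarrow> Ag v u"
    and Ag_close: "\<And>u v. u \<in> V \<Longrightarrow> v \<in> V \<Longrightarrow> Ag u v \<Longrightarrow>
      10 * card (sym_diff (nbrs E u) (nbrs E v)) \<le> card (nbrs E u)"
    and Ag_far: "\<And>u v. u \<in> V \<Longrightarrow> v \<in> V \<Longrightarrow> \<not> Ag u v \<Longrightarrow>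
      card (nbrs E u) \<le> 50 * card (sym_diff (nbrs E u) (nbrs E v))"
begin

abbreviation N where "N \<equiv> nbrs E"
abbreviation d where "d u \<equiv> card (N u)"

abbreviation agree where "agree \<equiv> agreeing E Ag"
abbreviation heavy where "heavy \<equiv> heavy_vertex E Ag"
definition near where "near u v \<longleftrightarrow> agree u \<inter> agree v \<noteq> {}"

lemma finV: "finite V" using graph by (simp add: signed_graph_def)

lemma N_subset: "N u \<subseteq> V" and N_subset': "v \<in> N u \<Longrightarrow> u \<in> V"
  using signed_graph_edgeD[OF graph] by (auto simp: nbrs_def)

lemma finN[simp]: "finite (N u)" using N_subset finV finite_subset by blast

lemma self_N: "u \<in> V \<Longrightarrow> u \<in> N u"
  using graph by (simp add: nbrs_def signed_graph_def)

lemma d_pos: "u \<in> V \<Longrightarrow> 0 < d u" using self_N[of u] by (auto simp: card_gt_0_iff)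

lemma fin_agree[simp]: "finite (agree u)" by (simp add: agreeing_def)

lemma agree_sub: "agree u \<subseteq> N u" by (auto simp: agreeing_def)

lemma agree_sym: "v \<in> agree u \<longleftrightarrow> u \<in> agree v"
  using nbrs_sym Ag_sym by (fastforce simp: agreeing_def)

lemma self_agree: "u \<in> V \<Longrightarrow> u \<in> agree u" by (simp add: agreeing_def self_N Ag_refl)

lemma near_sym: "near u v \<Longrightarrow> near v u" by (auto simp: near_def)

lemma agree_dist:
  assumes "v \<in> agree u"
  shows "10 * card (sym_diff (N u) (N v)) \<le> d u" "10 * card (sym_diff (N u) (N v)) \<le> d v"
proof -
  have uv: "u \<in> V" "v \<in> V" "Ag u v" using assms N_subset N_subset' by (auto simp: agreeing_def)
  have "sym_diff (N u) (N v) = sym_diff (N v) (N u)" by auto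
  then show "10 * card (sym_diff (N u) (N v)) \<le> d u" "10 * card (sym_diff (N u) (N v)) \<le> d v"
    using Ag_close[OF uv] Ag_close[OF uv(2,1) Ag_sym[OF uv(3)]] by auto
qed

text \<open>Triangle inequality through the common vertex \<open>y\<close>. The two halves are
  measured by the degrees of \<open>u\<close> and \<open>v\<close>, so the degree of
  \<open>y\<close> does not appear.\<close>

lemma near_dist:
  assumes "near u v"
  shows "10 * card (sym_diff (N u) (N v)) \<le> d u + d v"
proof -
  from assms obtain y where y: "y \<in> agree u" "y \<in> agree v" by (auto simp: near_def)
  have "sym_diff (N y) (N v) = sym_diff (N v) (N y)" by auto
  then show ?thesis
    using agree_dist[OF y(1)] agree_dist[OF y(2)]
      card_sym_diff_triangle[of "N u" "N y" "N v"] by simp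
qed

lemma near_degree:
  assumes "near u v" shows "9 * d u \<le> 11 * d v" "9 * d v \<le> 11 * d u"
proof -
  have c: "sym_diff (N u) (N v) = sym_diff (N v) (N u)" by auto
  show "9 * d u \<le> 11 * d v" "9 * d v \<le> 11 * d u"
    using near_dist[OF assms] card_le_sym_diff[of "N u" "N v"] card_le_sym_diff[of "N v" "N u"] c
    by auto
qed

text \<open>If the agreement sets of \<open>u\<close> and \<open>w\<close> were disjoint, they would
  place nine tenths of \<open>d u + d w\<close> elements in \<open>N u \<union> N w\<close>, whose
  size exceeds \<open>d u\<close> only by the small distance between the neighbourhoods.\<close>

lemma near_trans:
  assumes uvw: "u \<in> V" "v \<in> V" "w \<in> V" and h: "heavy u" "heavy w"
    and n: "near u v" "near v w"
  shows "near u w"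
proof (rule ccontr)
  assume "\<not> near u w"
  then have "agree u \<inter> agree w = {}" by (simp add: near_def)
  then have "card (agree u) + card (agree w) = card (agree u \<union> agree w)"
    by (simp add: card_Un_disjoint)
  also have "\<dots> \<le> card (N u \<union> N w)" by (rule card_mono) (auto simp: agreeing_def)
  finally have 1: "card (agree u) + card (agree w) \<le> card (N u \<union> N w)" .
  have "card (N u \<union> N w) \<le> card (N u \<union> sym_diff (N u) (N w))" by (rule card_mono) auto
  also have "\<dots> \<le> d u + card (sym_diff (N u) (N w))" by (rule card_Un_le)
  finally have 2: "card (N u \<union> N w) \<le> d u + card (sym_diff (N u) (N w))" .
  have 3: "card (sym_diff (N u) (N w)) \<le> card (sym_diff (N u) (N v)) + card (sym_diff (N v) (N w))"
    by (rule card_sym_diff_triangle) auto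
  \<comment> \<open>This amounts to \<open>8 * d w \<le> 2 * d u + 2 * d v\<close>. By the degree
    comparisons \<open>d v\<close> is at most 11/9 and \<open>d u\<close> at most 121/81 times
    \<open>d w\<close>, so the right side stays below \<open>6 * d w\<close>.\<close>
  have "9 * d u + 9 * d w \<le> 10 * d u + (d u + d v) + (d v + d w)"
    using 1 2 3 near_dist[OF n(1)] near_dist[OF n(2)] h unfolding heavy_vertex_def by linarith
  moreover have "9 * d v \<le> 11 * d w" "9 * d v \<le> 11 * d u" "9 * d u \<le> 11 * d v"
    using near_degree n by auto
  ultimately show False using d_pos[OF uvw(1)] d_pos[OF uvw(2)] d_pos[OF uvw(3)] by linarith
qed

text \<open>
  Double counting of the pairs of \<open>v\<close> in the class and \<open>w\<close> in the neighbourhood of \<open>u\<close> that agree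
  with \<open>v\<close>: each \<open>v\<close> contributes a constant fraction of \<open>d u\<close>, each \<open>w\<close> at most \<open>O(d u)\<close>.
\<close>

lemma near_class_card:
  assumes u: "u \<in> V" and C: "C = {v \<in> V. heavy v \<and> near u v}"
  shows "card C \<le> 4 * d u"
proof -
  have finC: "finite C" using finV by (simp add: C)
  let ?R = "SIGMA v:C. agree v \<inter> N u"
  \<comment> \<open>At least \<open>9/10 * d v - (d u + d v) / 10\<close> vertices of
    \<open>agree v\<close> lie in \<open>N u\<close>, and \<open>d v\<close> is at least
    \<open>9/11 * d u\<close>.\<close>
  have lower: "4 * d u \<le> 9 * card (agree v \<inter> N u)" if v: "v \<in> C" for v
  proof -
    have nv: "near u v" "heavy v" using v C by auto
    have "card (agree v) \<le> card ((agree v \<inter> N u) \<union> sym_diff (N u) (N v))"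
      by (rule card_mono) (auto simp: agreeing_def)
    also have "\<dots> \<le> card (agree v \<inter> N u) + card (sym_diff (N u) (N v))" by (rule card_Un_le)
    finally show ?thesis
      using nv near_dist[OF nv(1)] near_degree[OF nv(1)] unfolding heavy_vertex_def by linarith
  qed
  have upper: "9 * card {v \<in> C. w \<in> agree v} \<le> 14 * d u" if w: "w \<in> N u" for w
  proof (cases "{v \<in> C. w \<in> agree v} = {}")
    case False
    then obtain v where v: "v \<in> C" "w \<in> agree v" by auto
    have "card {v \<in> C. w \<in> agree v} \<le> d w"
      by (rule card_mono) (use agree_sym agree_sub in auto)
    moreover have "10 * d w \<le> 11 * d v"
      using agree_dist[OF v(2)] card_le_sym_diff[of "N w" "N v"]
      by (simp add: Un_commute)
    moreover have "9 * d v \<le> 11 * d u" using near_degree v C by auto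
    ultimately show ?thesis by linarith
  next
    case True then show ?thesis by (metis card.empty mult_0_right zero_le)
  qed
  have "card ?R = (\<Sum>v\<in>C. card (agree v \<inter> N u))" using finC by simp
  moreover have "(\<Sum>v\<in>C. 4 * d u) \<le> (\<Sum>v\<in>C. 9 * card (agree v \<inter> N u))"
    by (rule sum_mono) (rule lower)
  ultimately have 1: "card C * (4 * d u) \<le> 9 * card ?R" by (simp add: sum_distrib_left)
  have "?R = (\<lambda>(w, v). (v, w)) ` (SIGMA w:N u. {v \<in> C. w \<in> agree v})" by auto
  then have "card ?R = card (SIGMA w:N u. {v \<in> C. w \<in> agree v})"
    by (simp add: card_image inj_on_def)
  also have "\<dots> = (\<Sum>w\<in>N u. card {v \<in> C. w \<in> agree v})" using finC by simp
  finally have "9 * card ?R = (\<Sum>w\<in>N u. 9 * card {v \<in> C. w \<in> agree v})"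
    by (simp add: sum_distrib_left)
  also have "\<dots> \<le> (\<Sum>w\<in>N u. 14 * d u)" by (rule sum_mono) (rule upper)
  finally have 2: "9 * card ?R \<le> 14 * d u * d u" by simp
  have "(4 * card C) * d u = card C * (4 * d u)" by simp
  also note 1
  also note 2
  finally have "(4 * card C) * d u \<le> (14 * d u) * d u" .
  then have "4 * card C \<le> 14 * d u" using d_pos[OF u] by simp
  then show ?thesis by simp
qed

lemma clustering_cost_le:
  assumes P: "partition_on V P" and Q: "partition_on V Q"
    and tog: "\<And>u v. u \<in> V \<Longrightarrow> v \<in> V \<Longrightarrow>
      together P u v \<longleftrightarrow> u = v \<or> heavy u \<and> heavy v \<and> near u v"
  shows "clustering_cost V E P \<le> 4254 * clustering_cost V E Q"
proof -
  \<comment> \<open>Mistakes of \<open>P\<close> are disagreeing edges, edges at light vertices, or non-edges inside a class;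
    each of these is charged to mistakes of \<open>Q\<close>, either directly or because the degree of an
    endpoint is bounded by its number of mistakes (\<open>Big\<close> and \<open>Neg\<close>).\<close>
  define m where "m u = card (mistakes V E Q u)" for u
  define S where "S = (\<Sum>u\<in>V. m u)"
  define Mis where "Mis = (SIGMA u:V. mistakes V E Q u)"
  define Dis where "Dis = (SIGMA u:V. {v \<in> N u. \<not> Ag u v})"
  define Big where "Big = (SIGMA u:{u \<in> V. d u \<le> 100 * m u}. N u)"
  define Light where "Light = (SIGMA u:{u \<in> V. \<not> heavy u}. N u)"
  define Neg where "Neg = (SIGMA u:{u \<in> V. d u \<le> 4 * m u}. {v \<in> V. heavy v \<and> near u v})"
  have finm: "finite (mistakes V E Q u)" for u using finV by (simp add: mistakes_def)
  have fin: "finite Mis" "finite Dis" "finite Big" "finite Light" "finite Neg"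
    using finV finm by (auto simp: Mis_def Dis_def Big_def Light_def Neg_def intro!: finite_SigmaI)
  have cMis: "card Mis = S" using finV finm by (simp add: Mis_def S_def m_def)
  have restr: "(\<Sum>u\<in>{u \<in> V. R u}. c * m u) \<le> c * S" for R c
    unfolding S_def sum_distrib_left using finV by (intro sum_mono2) auto
  have cBig: "card Big \<le> 100 * S"
  proof -
    have "card Big = (\<Sum>u\<in>{u \<in> V. d u \<le> 100 * m u}. d u)" using finV by (simp add: Big_def)
    also have "\<dots> \<le> (\<Sum>u\<in>{u \<in> V. d u \<le> 100 * m u}. 100 * m u)" by (rule sum_mono) auto
    also have "\<dots> \<le> 100 * S" by (rule restr)
    finally show ?thesis .
  qed
  have dist_together: "card (sym_diff (N u) (N v)) \<le> m u + m v"
    if "u \<in> V" "v \<in> V" "together Q u v" for u v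
  proof -
    have "sym_diff (N u) (N v) \<subseteq> mistakes V E Q u \<union> mistakes V E Q v"
    proof
      fix x assume x: "x \<in> sym_diff (N u) (N v)"
      then have "x \<in> V" using N_subset by auto
      moreover have "together Q u x \<longleftrightarrow> together Q v x"
        using together_trans[OF Q] together_sym that(3) by metis
      ultimately show "x \<in> mistakes V E Q u \<union> mistakes V E Q v"
        using x by (auto simp: mistakes_def)
    qed
    then have "card (sym_diff (N u) (N v)) \<le> card (mistakes V E Q u \<union> mistakes V E Q v)"
      using finm by (intro card_mono) auto
    also have "\<dots> \<le> m u + m v" unfolding m_def by (rule card_Un_le)
    finally show ?thesis .
  qed
  have "Dis \<subseteq> Mis \<union> Big \<union> Big\<inverse>"
  proof
    fix p assume "p \<in> Dis"
    then obtain u v where p: "p = (u, v)" and uv: "u \<in> V" "v \<in> N u" "\<not> Ag u v"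
      by (auto simp: Dis_def)
    have vV: "v \<in> V" using uv N_subset by auto
    show "p \<in> Mis \<union> Big \<union> Big\<inverse>"
    proof (cases "together Q u v")
      case True
      have "\<not> Ag v u" using uv(3) Ag_sym by blast
      then have "d u \<le> 50 * (m u + m v)" "d v \<le> 50 * (m u + m v)"
        using Ag_far[OF uv(1) vV uv(3)] Ag_far[OF vV uv(1)] dist_together[OF uv(1) vV True]
        by (simp_all add: Un_commute)
      \<comment> \<open>The endpoint with more mistakes pays alone, which doubles the 50. If it is
        \<open>v\<close>, the pair lies in \<open>Big\<inverse>\<close>.\<close>
      then have "d u \<le> 100 * m u \<or> d v \<le> 100 * m v"
        by (cases "m u \<le> m v") simp_all
      then show ?thesis using uv vV p nbrs_sym[of v E u] by (auto simp: Big_def)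
    next
      case False
      then show ?thesis using uv vV p by (auto simp: Mis_def mistakes_def)
    qed
  qed
  then have "card Dis \<le> card (Mis \<union> Big \<union> Big\<inverse>)" using fin by (intro card_mono) auto
  also have "\<dots> \<le> card Mis + card Big + card (Big\<inverse>)"
    by (meson add_le_mono card_Un_le le_refl order_trans)
  finally have cDis: "card Dis \<le> 201 * S" using cMis cBig by (simp add: card_inverse)
  \<comment> \<open>More than a tenth of the neighbours of a light vertex disagree with it, so each
    disagreeing pair pays for ten neighbours.\<close>
  have cLight: "card Light \<le> 10 * card Dis"
  proof -
    have "d u \<le> 10 * card {v \<in> N u. \<not> Ag u v}" if "\<not> heavy u" for u
    proof -
      have "N u = agree u \<union> {v \<in> N u. \<not> Ag u v}" by (auto simp: agreeing_def)
      then have "d u \<le> card (agree u) + card {v \<in> N u. \<not> Ag u v}" by (metis card_Un_le)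
      then show ?thesis using that unfolding heavy_vertex_def by linarith
    qed
    then have "(\<Sum>u\<in>{u \<in> V. \<not> heavy u}. d u) \<le> (\<Sum>u\<in>{u \<in> V. \<not> heavy u}. 10 * card {v \<in> N u. \<not> Ag u v})"
      by (intro sum_mono) auto
    also have "\<dots> \<le> (\<Sum>u\<in>V. 10 * card {v \<in> N u. \<not> Ag u v})"
      using finV by (intro sum_mono2) auto
    finally show ?thesis using finV by (simp add: Light_def Dis_def sum_distrib_left)
  qed
  have cNeg: "card Neg \<le> 16 * S"
  proof -
    have "card Neg = (\<Sum>u\<in>{u \<in> V. d u \<le> 4 * m u}. card {v \<in> V. heavy v \<and> near u v})"
      using finV by (simp add: Neg_def)
    also have "\<dots> \<le> (\<Sum>u\<in>{u \<in> V. d u \<le> 4 * m u}. 16 * m u)"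
    proof (rule sum_mono)
      fix u assume u: "u \<in> {u \<in> V. d u \<le> 4 * m u}"
      then show "card {v \<in> V. heavy v \<and> near u v} \<le> 16 * m u"
        using near_class_card[of u] by fastforce
    qed
    also have "\<dots> \<le> 16 * S" by (rule restr)
    finally show ?thesis .
  qed
  have sub: "(SIGMA u:V. mistakes V E P u) \<subseteq> Dis \<union> Light \<union> Light\<inverse> \<union> Mis \<union> Neg \<union> Neg\<inverse>"
  proof
    fix p assume "p \<in> (SIGMA u:V. mistakes V E P u)"
    then obtain u v where p: "p = (u, v)" and uv: "u \<in> V" "v \<in> V" "(v \<in> N u) \<noteq> together P u v"
      by (auto simp: mistakes_def)
    show "p \<in> Dis \<union> Light \<union> Light\<inverse> \<union> Mis \<union> Neg \<union> Neg\<inverse>"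
    proof (cases "v \<in> N u")
      case True
      then have nt: "\<not> together P u v" using uv by simp
      show ?thesis
      proof (cases "Ag u v \<and> heavy u \<and> heavy v")
        case True
        then have "u \<in> agree u \<inter> agree v"
          using self_agree[OF uv(1)] \<open>v \<in> N u\<close> agree_sym[of u v] by (auto simp: agreeing_def)
        then show ?thesis using nt tog[OF uv(1,2)] True by (auto simp: near_def)
      next
        case False
        then show ?thesis using p uv True nbrs_sym[of v E u] by (auto simp: Dis_def Light_def)
      qed
    next
      case False
      then have h: "heavy u" "heavy v" "near u v"
        using uv tog[OF uv(1,2)] self_N by auto
      show ?thesis
      proof (cases "together Q u v")
        case True
        then show ?thesis using p uv False by (auto simp: Mis_def mistakes_def)
      next
        case sep: False
        \<comment> \<open>As \<open>Q\<close> separates \<open>u\<close> from \<open>v\<close>, a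
          common neighbour is apart from one of them, and that positive edge is a mistake.\<close>
        have "N u \<inter> N v \<subseteq> mistakes V E Q u \<union> mistakes V E Q v"
          using sep together_trans[OF Q] together_sym N_subset
          by (fastforce simp: mistakes_def)
        then have "card (N u \<inter> N v) \<le> card (mistakes V E Q u \<union> mistakes V E Q v)"
          using finm by (intro card_mono) auto
        also have "\<dots> \<le> m u + m v" unfolding m_def by (rule card_Un_le)
        finally have 1: "card (N u \<inter> N v) \<le> m u + m v" .
        have "d u \<le> card ((N u \<inter> N v) \<union> sym_diff (N u) (N v))"
          "d v \<le> card ((N u \<inter> N v) \<union> sym_diff (N u) (N v))" by (intro card_mono; auto)+
        then have 2: "d u \<le> card (N u \<inter> N v) + card (sym_diff (N u) (N v))"
          "d v \<le> card (N u \<inter> N v) + card (sym_diff (N u) (N v))"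
          by (meson card_Un_le order_trans)+
        \<comment> \<open>The last two premises make \<open>x\<close> at most 2/9 of
          \<open>a\<close>, so 7/9 of \<open>a\<close> is at most \<open>s\<close>.\<close>
        have arith: "a \<le> 2 * s" if "i \<le> s" "a \<le> i + x" "10 * x \<le> a + b" "9 * b \<le> 11 * a"
          for a b i s x :: nat
          using that by linarith
        have "d u \<le> 2 * (m u + m v)"
          by (rule arith[OF 1 2(1) near_dist[OF h(3)] near_degree(2)[OF h(3)]])
        moreover have "d v \<le> 2 * (m u + m v)"
          by (rule arith[OF 1 2(2) _ near_degree(1)[OF h(3)]]) (use near_dist[OF h(3)] in simp)
        ultimately have "d u \<le> 4 * m u \<or> d v \<le> 4 * m v"
          by (cases "m u \<le> m v") simp_all
        then show ?thesis using p uv h near_sym[OF h(3)] by (auto simp: Neg_def)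
      qed
    qed
  qed
  have "2 * clustering_cost V E P = card (SIGMA u:V. mistakes V E P u)"
    using sum_mistakes[OF graph P] finV by (simp add: mistakes_def)
  also have "\<dots> \<le> card (Dis \<union> Light \<union> Light\<inverse> \<union> Mis \<union> Neg \<union> Neg\<inverse>)"
    using sub fin by (intro card_mono) auto
  also have "\<dots> \<le> card Dis + card Light + card (Light\<inverse>) + card Mis + card Neg + card (Neg\<inverse>)"
    by (meson add_le_mono card_Un_le le_refl order_trans)
  \<comment> \<open>The sum is 201 for \<open>Dis\<close>, twice 2010 for \<open>Light\<close> and
    its converse, 1 for \<open>Mis\<close>, and twice 16 for \<open>Neg\<close> and its
    converse.\<close>
  also have "\<dots> \<le> 4254 * S"
    using cDis cLight cNeg cMis by (simp add: card_inverse)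
  also have "S = 2 * clustering_cost V E Q"
    unfolding S_def m_def by (rule sum_mistakes[OF graph Q])
  finally show ?thesis by simp
qed

lemma approximate_clustering_near_classes:
  assumes P: "partition_on V P"
    and tog: "\<And>u v. u \<in> V \<Longrightarrow> v \<in> V \<Longrightarrow>
      together P u v \<longleftrightarrow> u = v \<or> heavy u \<and> heavy v \<and> near u v"
  shows "approximate_clustering 4254 V E P"
proof -
  have "optimal_cost V E \<in> clustering_cost V E ` {P. partition_on V P}"
    unfolding optimal_cost_def using P finitely_many_partition_on[OF finV] by (intro Min_in) auto
  then obtain Q where Q: "partition_on V Q" "optimal_cost V E = clustering_cost V E Q" by auto
  have "real (clustering_cost V E P) \<le> real (4254 * clustering_cost V E Q)"
    using clustering_cost_le[OF P Q(1) tog] by (intro of_nat_mono) auto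
  then show ?thesis using P Q by (simp add: approximate_clustering_def)
qed

end

section \<open>Min-wise sketches\<close>

text \<open>Hoeffding's inequality for the indicators of \<open>P (f i)\<close>: they are
  independent because \<open>f\<close> is drawn from a product, and \<open>q\<close> is their common
  mean.\<close>

lemma measure_Pi_pmf_card_bounds:
  fixes p :: "'a pmf" and z :: 'a and k :: nat and e :: real and P :: "'a \<Rightarrow> bool"
  assumes "k > 0" "e \<ge> 0"
  defines "q \<equiv> measure_pmf.prob p {x. P x}"
  defines "M \<equiv> Pi_pmf {..<k} z (\<lambda>_. p)"
  shows measure_Pi_pmf_card_ge:
      "measure_pmf.prob M {f. real (card {i. i < k \<and> P (f i)}) \<ge> k * (q + e)} \<le> exp (- 2 * e\<^sup>2 * k)" (is ?ge)
    and measure_Pi_pmf_card_le: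
      "measure_pmf.prob M {f. real (card {i. i < k \<and> P (f i)}) \<le> k * (q - e)} \<le> exp (- 2 * e\<^sup>2 * k)" (is ?le)
proof -
  define X :: "nat \<Rightarrow> (nat \<Rightarrow> 'a) \<Rightarrow> real" where "X i f = of_bool (P (f i))" for i f
  have "prob_space.indep_vars (measure_pmf M) (\<lambda>_. borel)
      (\<lambda>i. (\<lambda>x. of_bool (P x) :: real) \<circ> (\<lambda>f. f i)) {..<k}"
    unfolding M_def
    by (rule prob_space.indep_vars_compose[OF measure_pmf.prob_space_axioms indep_vars_Pi_pmf]) auto
  then have ind: "prob_space.indep_vars (measure_pmf M) (\<lambda>_. borel) X {..<k}"
    by (simp add: X_def[abs_def] o_def)
  interpret indep_interval_bounded_random_variables "measure_pmf M" "{..<k}" X "\<lambda>_. 0" "\<lambda>_. 1"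
    by unfold_locales (auto simp: ind X_def)
  interpret H: Hoeffding_ineq "measure_pmf M" "{..<k}" X "\<lambda>_. 0" "\<lambda>_. 1"
    "\<Sum>i<k. measure_pmf.expectation M (X i)"
    by unfold_locales
  have E: "measure_pmf.expectation M (X i) = q" if "i < k" for i
  proof -
    have "measure_pmf.expectation M (X i)
        = measure_pmf.expectation (map_pmf (\<lambda>f. f i) M) (\<lambda>x. indicator {x. P x} x)"
      by (simp add: X_def[abs_def] indicator_def)
    also have "map_pmf (\<lambda>f. f i) M = p" using that by (simp add: M_def Pi_pmf_component)
    finally show ?thesis by (simp add: q_def)
  qed
  have S: "(\<Sum>i<k. X i f) = real (card {i. i < k \<and> P (f i)})" for f
  proof -
    have "{i. i < k \<and> P (f i)} = {..<k} \<inter> {i. P (f i)}" by auto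
    then show ?thesis by (simp add: X_def of_bool_def sum.If_cases)
  qed
  have ar: "- 2 * (real k * e)\<^sup>2 / (\<Sum>i<k. (1 - 0)\<^sup>2) = - 2 * e\<^sup>2 * k"
    using assms(1) by (simp add: field_simps power2_eq_square)
  have ge0: "real k * e \<ge> 0" using assms by simp
  have pos: "(\<Sum>i<k. (1 - 0 :: real)\<^sup>2) > 0" using assms(1) by simp
  have mu: "(\<Sum>i<k. measure_pmf.expectation M (X i)) = k * q" using E by simp
  show ?ge using H.Hoeffding_ineq_ge[OF ge0 pos] unfolding ar S mu by (simp add: algebra_simps)
  show ?le using H.Hoeffding_ineq_le[OF ge0 pos] unfolding ar S mu by (simp add: algebra_simps)
qed

text \<open>The algorithm draws one vector of words per machine, while the analysis wants one
  independent hash function per coordinate. Both tables have the same law: if all entries outside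
  \<open>A \<times> B\<close> are \<open>z\<close>, the mass is the product of the masses of the
  entries, and otherwise it is 0.\<close>

lemma Pi_pmf_swap:
  assumes [simp]: "finite A" "finite B"
  shows "Pi_pmf B (\<lambda>_. z) (\<lambda>_. Pi_pmf A z (\<lambda>_. p))
    = map_pmf (\<lambda>f b a. f a b) (Pi_pmf A (\<lambda>_. z) (\<lambda>_. Pi_pmf B z (\<lambda>_. p)))"
proof (rule pmf_eqI)
  fix g :: "'b \<Rightarrow> 'a \<Rightarrow> 'c"
  let ?s = "\<lambda>f b a. f a b" 
  have inj: "inj ?s" by (auto simp: inj_def fun_eq_iff)
  have "pmf (map_pmf ?s (Pi_pmf A (\<lambda>_. z) (\<lambda>_. Pi_pmf B z (\<lambda>_. p)))) (?s (\<lambda>a b. g b a))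
      = pmf (Pi_pmf A (\<lambda>_. z) (\<lambda>_. Pi_pmf B z (\<lambda>_. p))) (\<lambda>a b. g b a)"
    by (rule pmf_map_inj'[OF inj])
  also have "\<dots> = pmf (Pi_pmf B (\<lambda>_. z) (\<lambda>_. Pi_pmf A z (\<lambda>_. p))) g"
  proof (cases "\<forall>a b. a \<in> A \<and> b \<in> B \<or> g b a = z")
    case True
    have "pmf (Pi_pmf A (\<lambda>_. z) (\<lambda>_. Pi_pmf B z (\<lambda>_. p))) (\<lambda>a b. g b a)
      = (\<Prod>a\<in>A. \<Prod>b\<in>B. pmf p (g b a))"
      using True by (subst pmf_Pi') (auto intro!: prod.cong pmf_Pi')
    also have "\<dots> = (\<Prod>b\<in>B. \<Prod>a\<in>A. pmf p (g b a))" by (rule prod.swap)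
    also have "\<dots> = pmf (Pi_pmf B (\<lambda>_. z) (\<lambda>_. Pi_pmf A z (\<lambda>_. p))) g"
      using True by (subst pmf_Pi') (auto intro!: prod.cong pmf_Pi'[symmetric])
    finally show ?thesis .
  next
    case False
    then obtain a b where ab: "a \<notin> A \<or> b \<notin> B" "g b a \<noteq> z" by auto
    have 1: "pmf (Pi_pmf A (\<lambda>_. z) (\<lambda>_. Pi_pmf B z (\<lambda>_. p))) (\<lambda>a b. g b a) = 0"
    proof (cases "a \<in> A")
      case True
      then have "pmf (Pi_pmf B z (\<lambda>_. p)) (\<lambda>b. g b a) = 0"
        using ab by (intro pmf_Pi_outside) auto
      then show ?thesis using True by (subst pmf_Pi) (auto intro!: prod_zero bexI simp del: pmf_Pi)
    next
      case False
      then show ?thesis using ab by (intro pmf_Pi_outside) (auto simp: fun_eq_iff)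
    qed
    have "pmf (Pi_pmf B (\<lambda>_. z) (\<lambda>_. Pi_pmf A z (\<lambda>_. p))) g = 0"
    proof (cases "b \<in> B")
      case True
      then have "pmf (Pi_pmf A z (\<lambda>_. p)) (g b) = 0"
        using ab by (intro pmf_Pi_outside) auto
      then show ?thesis using True by (subst pmf_Pi) (auto intro!: prod_zero bexI simp del: pmf_Pi)
    next
      case False
      then show ?thesis using ab by (intro pmf_Pi_outside) (auto simp: fun_eq_iff)
    qed
    then show ?thesis using 1 by simp
  qed
  finally show "pmf (Pi_pmf B (\<lambda>_. z) (\<lambda>_. Pi_pmf A z (\<lambda>_. p))) g
    = pmf (map_pmf ?s (Pi_pmf A (\<lambda>_. z) (\<lambda>_. Pi_pmf B z (\<lambda>_. p)))) g" by simp
qed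

abbreviation uniform_below :: "nat \<Rightarrow> nat pmf" where
  "uniform_below W \<equiv> pmf_of_set {..<W}"

text \<open>Compares the sum with the telescoping differences \<open>(j + 1)\<^sup>m - j\<^sup>m\<close>.\<close>

lemma sum_powers_ge:
  "real W ^ m \<le> real m * ((\<Sum>j<W. real j ^ (m - 1)) + real W ^ (m - 1))" if m0: "m > 0"
proof (induction W)
  case 0
  then show ?case using m0 by (cases m) auto
next
  case (Suc W)
  obtain l where m: "m = Suc l" using m0 by (cases m) auto
  let ?a = "real (Suc W)" and ?b = "real W"
  have "?a ^ m - ?b ^ m = (?a - ?b) * (\<Sum>i<m. ?a ^ i * ?b ^ (m - Suc i))"
    using diff_power_eq_sum[of ?a l ?b] by (simp add: m)
  also have "\<dots> \<le> (\<Sum>i<m. ?a ^ l)"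
  proof -
    have "?a ^ i * ?b ^ (m - Suc i) \<le> ?a ^ l" if "i < m" for i
    proof -
      have "?a ^ i * ?b ^ (m - Suc i) \<le> ?a ^ i * ?a ^ (m - Suc i)"
        by (intro mult_left_mono power_mono) auto
      also have "\<dots> = ?a ^ l" using that m by (simp flip: power_add)
      finally show ?thesis .
    qed
    then show ?thesis
      by (simp only: diff_Suc_Suc of_nat_Suc add_diff_cancel_left' mult_1 add_diff_cancel) (intro sum_mono, simp)
  qed
  finally have "?a ^ m \<le> ?b ^ m + m * ?a ^ l" by simp
  also have "\<dots> \<le> real m * ((\<Sum>j<W. real j ^ (m - 1)) + real W ^ (m - 1)) + m * ?a ^ l"
    using Suc by simp
  finally show ?case by (simp add: m algebra_simps)
qed

text \<open>Words from a finite range may tie. Strictness makes the events for distinct elements of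
  \<open>U\<close> disjoint, at the price of an error \<open>1 / W\<close> in their
  probabilities.\<close>

definition strict_min_on :: "'v set \<Rightarrow> ('v \<Rightarrow> nat) \<Rightarrow> 'v \<Rightarrow> bool" where
  "strict_min_on U h w \<longleftrightarrow> (\<forall>v\<in>U - {w}. h w < h v)"

text \<open>Split by the value \<open>x\<close> at \<open>w\<close>: the other \<open>m - 1\<close>
  values exceed it with probability \<open>((W - 1 - x) / W) ^ (m - 1)\<close>. Summation over
  \<open>x\<close> gives a discrete form of the integral of \<open>t ^ (m - 1)\<close> over the unit
  interval.\<close>

lemma prob_strict_min_ge:
  fixes U I :: "'v set"
  assumes "finite I" "U \<subseteq> I" "w \<in> U" "W > 0"
  shows "measure_pmf.prob (Pi_pmf I z (\<lambda>_. uniform_below W)) {h. strict_min_on U h w}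
    \<ge> 1 / card U - 1 / W"
proof -
  let ?M = "Pi_pmf I z (\<lambda>_. uniform_below W)"
  define m where "m = card U"
  have finU: "finite U" using assms by (meson finite_subset)
  have m: "m > 0" using assms finU by (auto simp: m_def card_gt_0_iff)
  have cU: "card (U - {w}) = m - 1" using assms finU by (simp add: m_def)
  define B where "B x v = (if v = w then {x} else if v \<in> U then {x<..} else UNIV)" for x :: nat and v
  have pB: "measure_pmf.prob ?M (Pi I (B x)) = (1 / W) * (real (W - 1 - x) / W) ^ (m - 1)"
    if x: "x < W" for x
  proof -
    have "measure_pmf.prob ?M (Pi I (B x)) = (\<Prod>v\<in>I. measure_pmf.prob (uniform_below W) (B x v))"
      using assms by (intro measure_Pi_pmf_Pi) auto
    also have "\<dots> = (\<Prod>v\<in>U. measure_pmf.prob (uniform_below W) (B x v))"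
      using assms by (intro prod.mono_neutral_right) (auto simp: B_def)
    also have "\<dots> = measure_pmf.prob (uniform_below W) (B x w)
        * (\<Prod>v\<in>U - {w}. measure_pmf.prob (uniform_below W) (B x v))"
      using assms finU by (simp add: prod.remove)
    also have "measure_pmf.prob (uniform_below W) (B x w) = 1 / W"
      using x assms by (simp add: B_def measure_pmf_of_set lessThan_empty_iff)
    also have "(\<Prod>v\<in>U - {w}. measure_pmf.prob (uniform_below W) (B x v))
        = (\<Prod>v\<in>U - {w}. real (W - 1 - x) / W)"
    proof (rule prod.cong)
      fix v assume "v \<in> U - {w}"
      then have "measure_pmf.prob (uniform_below W) (B x v) = real (card ({..<W} \<inter> {x<..})) / W"
        using assms by (simp add: B_def measure_pmf_of_set lessThan_empty_iff)
      also have "{..<W} \<inter> {x<..} = {Suc x..<W}" by auto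
      finally show "measure_pmf.prob (uniform_below W) (B x v) = real (W - 1 - x) / W" by simp
    qed simp
    finally show ?thesis by (simp add: cU)
  qed
  have disj: "disjoint_family_on (\<lambda>x. Pi I (B x)) {..<W}"
    using assms by (fastforce simp: disjoint_family_on_def B_def Pi_def)
  have "1 / real m - 1 / W \<le> (\<Sum>j<W. real j ^ (m - 1)) / W ^ m"
  proof -
    have "real W ^ m \<le> real m * ((\<Sum>j<W. real j ^ (m - 1)) + real W ^ (m - 1))"
      by (rule sum_powers_ge[OF m])
    then have "1 \<le> real m * ((\<Sum>j<W. real j ^ (m - 1)) + real W ^ (m - 1)) / W ^ m"
      using assms(4) by (simp add: field_simps)
    also have "\<dots> = real m * ((\<Sum>j<W. real j ^ (m - 1)) / W ^ m + 1 / W)"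
      using assms(4) m by (cases m) (simp_all add: field_simps)
    finally show ?thesis using m by (simp add: field_simps)
  qed
  also have "(\<Sum>j<W. real j ^ (m - 1)) = (\<Sum>j<W. real (W - Suc j) ^ (m - 1))"
    by (rule sum.nat_diff_reindex[symmetric])
  also have "\<dots> / W ^ m = (\<Sum>x<W. measure_pmf.prob ?M (Pi I (B x)))"
    unfolding sum_divide_distrib
  proof (rule sum.cong)
    fix x assume "x \<in> {..<W}"
    then have x: "x < W" by simp
    obtain l where l: "m = Suc l" using m by (cases m) auto
    show "real (W - Suc x) ^ (m - 1) / real (W ^ m) = measure_pmf.prob ?M (Pi I (B x))"
      unfolding pB[OF x] by (simp add: l power_divide)
  qed simp
  also have "\<dots> = measure_pmf.prob ?M (\<Union>x<W. Pi I (B x))"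
    using disj by (intro measure_pmf.finite_measure_finite_Union[symmetric]) auto
  also have "\<dots> \<le> measure_pmf.prob ?M {h. strict_min_on U h w}"
  proof (intro measure_pmf.finite_measure_mono subsetI)
    fix h assume "h \<in> (\<Union>x<W. Pi I (B x))"
    then obtain x where x: "\<And>v. v \<in> I \<Longrightarrow> h v \<in> B x v" by (auto simp: Pi_def)
    have "h w = x" using x[of w] assms by (auto simp: B_def)
    moreover have "x < h v" if "v \<in> U - {w}" for v using x[of v] that assms by (auto simp: B_def)
    ultimately show "h \<in> {h. strict_min_on U h w}" by (auto simp: strict_min_on_def)
  qed simp
  finally show ?thesis by (simp add: m_def)
qed

lemma prob_strict_min_in_ge:
  fixes U I :: "'v set"
  assumes I: "finite I" "U \<subseteq> I" and W: "W > 0" and D: "D \<subseteq> U"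
  shows "measure_pmf.prob (Pi_pmf I z (\<lambda>_. uniform_below W)) {h. \<exists>w\<in>D. strict_min_on U h w}
    \<ge> card D / card U - card D / W"
proof -
  let ?M = "Pi_pmf I z (\<lambda>_. uniform_below W)"
  have finD: "finite D" using I D by (meson finite_subset)
  have disj: "disjoint_family_on (\<lambda>w. {h. strict_min_on U h w}) D"
  proof -
    have False if "v \<in> D" "w \<in> D" "v \<noteq> w" "strict_min_on U h v" "strict_min_on U h w" for v w h
    proof -
      have "h v < h w" "h w < h v" using that D by (auto simp: strict_min_on_def)
      then show ?thesis by simp
    qed
    then show ?thesis by (auto simp: disjoint_family_on_def)
  qed
  have "card D / card U - card D / W = (\<Sum>w\<in>D. 1 / card U - 1 / W)"
    by (simp add: algebra_simps)
  also have "\<dots> \<le> (\<Sum>w\<in>D. measure_pmf.prob ?M {h. strict_min_on U h w})"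
    using D by (intro sum_mono prob_strict_min_ge assms) auto
  also have "\<dots> = measure_pmf.prob ?M (\<Union>w\<in>D. {h. strict_min_on U h w})"
    using disj finD by (intro measure_pmf.finite_measure_finite_Union[symmetric]) auto
  also have "(\<Union>w\<in>D. {h. strict_min_on U h w}) = {h. \<exists>w\<in>D. strict_min_on U h w}" by auto
  finally show ?thesis .
qed

lemma Min_strict_min_on:
  assumes "finite A" "w \<in> A" "A \<subseteq> U" "strict_min_on U h w"
  shows "Min (h ` A) = h w"
proof (rule Min_eqI)
  fix y assume "y \<in> h ` A"
  then obtain v where v: "v \<in> A" "y = h v" by auto
  show "h w \<le> y"
  proof (cases "v = w")
    case False
    then have "v \<in> U - {w}" using v assms(3) by auto
    then show ?thesis using v assms(4) by (auto simp: strict_min_on_def intro: less_imp_le)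
  qed (simp add: v)
qed (use assms in auto)

text \<open>A strict minimum of \<open>A \<union> B\<close> in the symmetric difference separates
  the two minima, while one in the intersection makes them equal. Both events are bounded from
  below, and the complement of the second yields the upper bound on \<open>p\<close>. Ties account
  for \<open>card I / W\<close>.\<close>

lemma prob_Min_neq_bounds:
  fixes A B I :: "'v set" and z :: nat
  assumes I: "finite I" "A \<subseteq> I" "B \<subseteq> I" and ne: "A \<noteq> {}" "B \<noteq> {}" and W: "W > 0"
  defines "p \<equiv> measure_pmf.prob (Pi_pmf I z (\<lambda>_. uniform_below W)) {h. Min (h ` A) \<noteq> Min (h ` B)}"
  shows "card (sym_diff A B) / card (A \<union> B) - card I / W \<le> p"
    and "p \<le> card (sym_diff A B) / card (A \<union> B) + card I / W"
proof -
  let ?M = "Pi_pmf I z (\<lambda>_. uniform_below W)"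
  let ?U = "A \<union> B"
  have fin: "finite A" "finite B" using I by (meson finite_subset)+
  have small: "real (card D) / W \<le> real (card I) / W" if "D \<subseteq> ?U" for D
    using that I by (intro divide_right_mono of_nat_mono card_mono) auto
  have Upos: "card ?U > 0" using fin ne by (simp add: card_gt_0_iff)
  have cU: "real (card ?U) = card (sym_diff A B) + card (A \<inter> B)"
  proof -
    have "A \<union> B = sym_diff A B \<union> (A \<inter> B)" by auto
    moreover have "card (sym_diff A B \<union> (A \<inter> B)) = card (sym_diff A B) + card (A \<inter> B)"
      using fin by (intro card_Un_disjoint) auto
    ultimately show ?thesis by simp
  qed
  have "card (sym_diff A B) / card ?U - card (sym_diff A B) / W
      \<le> measure_pmf.prob ?M {h. \<exists>w\<in>sym_diff A B. strict_min_on ?U h w}"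
    using I W by (intro prob_strict_min_in_ge) auto
  also have "\<dots> \<le> p" unfolding p_def
  proof (intro measure_pmf.finite_measure_mono)
    have ne_min: "Min (h ` X) \<noteq> h w" if "strict_min_on ?U h w" "X \<subseteq> ?U" "w \<notin> X" "finite X" "X \<noteq> {}" for h w X
    proof -
      have "Min (h ` X) \<in> h ` X" using that by (intro Min_in) auto
      then obtain x where "x \<in> X" "Min (h ` X) = h x" by auto
      moreover have "x \<in> ?U - {w}" using \<open>x \<in> X\<close> that by auto
      ultimately show ?thesis using that(1) unfolding strict_min_on_def by (metis less_irrefl)
    qed
    show "{h. \<exists>w\<in>sym_diff A B. strict_min_on ?U h w} \<subseteq> {h. Min (h ` A) \<noteq> Min (h ` B)}"
    proof (clarify)
      fix h w assume w: "w \<in> sym_diff A B" "strict_min_on ?U h w" and eq: "Min (h ` A) = Min (h ` B)"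
      from w(1) consider "w \<in> A" "w \<notin> B" | "w \<in> B" "w \<notin> A" by auto
      then show False
      proof cases
        case 1
        then show False
          using Min_strict_min_on[OF fin(1) 1(1) _ w(2)] ne_min[OF w(2) _ 1(2) fin(2) ne(2)] eq by auto
      next
        case 2
        then show False
          using Min_strict_min_on[OF fin(2) 2(1) _ w(2)] ne_min[OF w(2) _ 2(2) fin(1) ne(1)] eq by auto
      qed
    qed
  qed simp
  finally show "card (sym_diff A B) / card ?U - card I / W \<le> p"
    using small[of "sym_diff A B"] by (smt (verit) Diff_subset Un_mono Un_commute)
  have "card (A \<inter> B) / card ?U - card (A \<inter> B) / W
      \<le> measure_pmf.prob ?M {h. \<exists>w\<in>A \<inter> B. strict_min_on ?U h w}"
    using I W by (intro prob_strict_min_in_ge) auto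
  also have "\<dots> \<le> measure_pmf.prob ?M (UNIV - {h. Min (h ` A) \<noteq> Min (h ` B)})"
  proof (intro measure_pmf.finite_measure_mono subsetI)
    fix h assume "h \<in> {h. \<exists>w\<in>A \<inter> B. strict_min_on ?U h w}"
    then obtain w where w: "w \<in> A" "w \<in> B" "strict_min_on ?U h w" by auto
    have "Min (h ` A) = h w" "Min (h ` B) = h w"
      using Min_strict_min_on[OF fin(1) w(1) _ w(3)] Min_strict_min_on[OF fin(2) w(2) _ w(3)] by auto
    then show "h \<in> UNIV - {h. Min (h ` A) \<noteq> Min (h ` B)}" by simp
  qed simp
  also have "\<dots> = 1 - p" unfolding p_def
    using measure_pmf.prob_compl[of "{h. Min (h ` A) \<noteq> Min (h ` B)}" ?M] by simp
  finally have "card (A \<inter> B) / card ?U - card I / W \<le> 1 - p"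
    using small[of "A \<inter> B"] by (simp add: le_infI1 le_supI1)
  moreover have "card (sym_diff A B) / card ?U + card (A \<inter> B) / card ?U = 1"
    using cU Upos by (simp flip: add_divide_distrib)
  ultimately show "p \<le> card (sym_diff A B) / card ?U + card I / W" by simp
qed


section \<open>Judging agreement from sketches\<close>

definition mismatches :: "nat \<Rightarrow> ('v \<Rightarrow> nat \<Rightarrow> nat) \<Rightarrow> 'v set \<Rightarrow> 'v set \<Rightarrow> nat" where
  "mismatches k \<omega> A B = card {c. c < k \<and> Min ((\<lambda>v. \<omega> v c) ` A) \<noteq> Min ((\<lambda>v. \<omega> v c) ` B)}"

text \<open>Only answers outside the gap count as wrong. They concern Jaccard distances above 1/11
  or below 1/50, and the cut 1/25 lies between the two.\<close>

definition misjudged :: "nat \<Rightarrow> ('v \<Rightarrow> nat \<Rightarrow> nat) \<Rightarrow> 'v set \<Rightarrow> 'v set \<Rightarrow> bool" where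
  "misjudged k \<omega> A B \<longleftrightarrow>
     (if 25 * mismatches k \<omega> A B \<le> k then card A < 10 * card (sym_diff A B)
      else 50 * card (sym_diff A B) < card A)"

text \<open>Ties move the mismatch probability by at most 1/100, since \<open>W\<close> is at least
  \<open>100 * card I\<close>; sampling may move the frequency by another 1/100. The cut tolerates
  both: \<open>1/50 + 2/100 = 1/25\<close>, and \<open>1/11 - 2/100\<close> is still above 1/25.
  Hoeffding's exponent is \<open>2 / 100^2 = 1/5000\<close>.\<close>

lemma prob_misjudged_le:
  fixes A B I :: "'v set"
  assumes I: "finite I" "A \<subseteq> I" "B \<subseteq> I" and ne: "A \<noteq> {}" "B \<noteq> {}"
    and W: "W > 0" "100 * card I \<le> W" and k: "k > 0"
  shows "measure_pmf.prob (Pi_pmf I (\<lambda>_. 0) (\<lambda>_. Pi_pmf {..<k} 0 (\<lambda>_. uniform_below W)))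
    {\<omega>. misjudged k \<omega> A B} \<le> exp (- real k / 5000)"
proof -
  let ?H = "Pi_pmf I 0 (\<lambda>_. uniform_below W)"
  let ?M = "Pi_pmf {..<k} (\<lambda>_. 0) (\<lambda>_. ?H)"
  let ?P = "\<lambda>h. Min (h ` A) \<noteq> Min (h ` B)"
  define q where "q = measure_pmf.prob ?H {h. ?P h}"
  define D where "D = card (sym_diff A B)"
  define U where "U = card (A \<union> B)"
  define mis where "mis f = card {c. c < k \<and> ?P (f c)}" for f :: "nat \<Rightarrow> 'v \<Rightarrow> nat"
  have fin: "finite A" "finite B" using I by (meson finite_subset)+
  have q: "D / U - 1 / 100 \<le> q" "q \<le> D / U + 1 / 100"
  proof -
    have "real (100 * card I) \<le> real W" using W(2) by (rule of_nat_mono)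
    then have "card I / W \<le> 1 / 100" using W by (simp add: field_simps)
    then show "D / U - 1 / 100 \<le> q" "q \<le> D / U + 1 / 100"
      using prob_Min_neq_bounds[OF I ne W(1), of 0] unfolding q_def D_def U_def by linarith+
  qed
  have U: "card A \<le> U" "U \<le> card A + D" "U > 0"
  proof -
    show "card A \<le> U" unfolding U_def using fin by (intro card_mono) auto
    have "A \<union> B \<subseteq> A \<union> sym_diff A B" by auto
    then have "U \<le> card (A \<union> sym_diff A B)" unfolding U_def using fin by (intro card_mono) auto
    then show "U \<le> card A + D" using card_Un_le[of A "sym_diff A B"] unfolding D_def by linarith
    show "U > 0" unfolding U_def using fin ne by (simp add: card_gt_0_iff)
  qed
  have "measure_pmf.prob (Pi_pmf I (\<lambda>_. 0) (\<lambda>_. Pi_pmf {..<k} 0 (\<lambda>_. uniform_below W)))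
      {\<omega>. misjudged k \<omega> A B}
    = measure_pmf.prob ?M {f. misjudged k (\<lambda>b a. f a b) A B}"
    by (subst Pi_pmf_swap) (use I in \<open>auto simp: vimage_def\<close>)
  also have "{f. misjudged k (\<lambda>b a. f a b) A B} =
      {f. if 25 * mis f \<le> k then card A < 10 * D else 50 * D < card A}"
    by (simp add: misjudged_def mismatches_def mis_def D_def)
  also have "measure_pmf.prob ?M \<dots> \<le> exp (- 2 * (1 / 100)\<^sup>2 * k)"
  proof -
    consider "card A < 10 * D" | "50 * D < card A" | "10 * D \<le> card A" "card A \<le> 50 * D" by linarith
    then show ?thesis
    proof cases
      case 1
      then have "U < 11 * D" using U by linarith
      then have "real U < real (11 * D)" by (rule of_nat_less_iff[THEN iffD2])
      then have "1 / 11 < D / U" using U by (simp add: field_simps)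
      then have "1 / 25 \<le> q - 1 / 100" using q by linarith
      then have le: "k * (1 / 25) \<le> k * (q - 1 / 100)" by (intro mult_left_mono) auto
      have "real (mis f) \<le> k * (q - 1 / 100)" if "25 * mis f \<le> k" for f
      proof -
        have "real (25 * mis f) \<le> real k" using that by (rule of_nat_mono)
        then show ?thesis using le by simp
      qed
      then have "{f. if 25 * mis f \<le> k then card A < 10 * D else 50 * D < card A}
          \<subseteq> {f. real (mis f) \<le> k * (q - 1 / 100)}"
        using 1 by (auto split: if_splits)
      then have "measure_pmf.prob ?M {f. if 25 * mis f \<le> k then card A < 10 * D else 50 * D < card A}
          \<le> measure_pmf.prob ?M {f. real (mis f) \<le> k * (q - 1 / 100)}"
        by (intro measure_pmf.finite_measure_mono) auto
      also have "\<dots> \<le> exp (- 2 * (1 / 100)\<^sup>2 * k)"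
        unfolding mis_def q_def using k by (intro measure_Pi_pmf_card_le) auto
      finally show ?thesis .
    next
      case 2
      then have "50 * D < U" using U by linarith
      then have "real (50 * D) < real U" by (rule of_nat_less_iff[THEN iffD2])
      then have "D / U < 1 / 50" using U by (simp add: field_simps)
      then have "q + 1 / 100 \<le> 1 / 25" using q by linarith
      then have le: "k * (q + 1 / 100) \<le> k * (1 / 25)" by (intro mult_left_mono) auto
      have "k * (q + 1 / 100) \<le> real (mis f)" if "\<not> 25 * mis f \<le> k" for f
      proof -
        have "real k \<le> real (25 * mis f)" using that by (intro of_nat_mono) simp
        then show ?thesis using le by simp
      qed
      then have "{f. if 25 * mis f \<le> k then card A < 10 * D else 50 * D < card A}
          \<subseteq> {f. k * (q + 1 / 100) \<le> real (mis f)}"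
        using 2 by (auto split: if_splits)
      then have "measure_pmf.prob ?M {f. if 25 * mis f \<le> k then card A < 10 * D else 50 * D < card A}
          \<le> measure_pmf.prob ?M {f. k * (q + 1 / 100) \<le> real (mis f)}"
        by (intro measure_pmf.finite_measure_mono) auto
      also have "\<dots> \<le> exp (- 2 * (1 / 100)\<^sup>2 * k)"
        unfolding mis_def q_def using k by (intro measure_Pi_pmf_card_ge) auto
      finally show ?thesis .
    next
      \<comment> \<open>Inside the gap both answers are acceptable and the bad event is
        empty.\<close>
      case 3
      then have "{f. if 25 * mis f \<le> k then card A < 10 * D else 50 * D < card A} = {}"
        by (auto split: if_splits)
      then show ?thesis by (metis exp_ge_zero measure_empty)
    qed
  qed
  also have "- 2 * (1 / 100)\<^sup>2 * real k = - real k / 5000" by (simp add: power2_eq_square)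
  finally show ?thesis .
qed

text \<open>Union bound over at most \<open>n^2\<close> pairs. The constant
  \<open>15000 = 3 * 5000\<close> makes each of them fail with probability at most
  \<open>1 / n^3\<close>.\<close>

lemma prob_no_misjudged_ge:
  fixes I :: "'v set" and n :: nat
  assumes I: "finite I" and F: "finite F" "card F \<le> n"
    and sub: "\<And>A. A \<in> F \<Longrightarrow> A \<subseteq> I \<and> A \<noteq> {}"
    and n: "n > 0" and W: "W > 0" "100 * card I \<le> W" and k: "k > 0" "15000 * ln n \<le> real k"
  shows "measure_pmf.prob (Pi_pmf I (\<lambda>_. 0) (\<lambda>_. Pi_pmf {..<k} 0 (\<lambda>_. uniform_below W)))
    {\<omega>. \<forall>A\<in>F. \<forall>B\<in>F. \<not> misjudged k \<omega> A B} \<ge> 1 - 1 / n"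
proof -
  let ?M = "Pi_pmf I (\<lambda>_. 0) (\<lambda>_. Pi_pmf {..<k} 0 (\<lambda>_. uniform_below W))"
  let ?bad = "\<lambda>(A, B). {\<omega>. misjudged k \<omega> A B}"
  have "measure_pmf.prob ?M (\<Union>p\<in>F \<times> F. ?bad p) \<le> (\<Sum>p\<in>F \<times> F. measure_pmf.prob ?M (?bad p))"
    using F by (intro measure_pmf.finite_measure_subadditive_finite) auto
  also have "\<dots> \<le> (\<Sum>p\<in>F \<times> F. exp (- real k / 5000))"
    using prob_misjudged_le[OF I _ _ _ _ W k(1)] sub by (intro sum_mono) auto
  also have "\<dots> = real (card F) * real (card F) * exp (- real k / 5000)"
    by (simp add: card_cartesian_product)
  also have "\<dots> \<le> real n * real n * exp (- 3 * ln n)"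
    using F k by (intro mult_mono) auto
  also have "exp (- 3 * ln n) = 1 / real n ^ 3"
  proof -
    have "exp (- 3 * ln (real n)) = inverse (exp (3 * ln (real n)))" by (simp add: exp_minus)
    also have "exp (3 * ln (real n)) = exp (ln (real n)) ^ 3"
      using exp_of_nat_mult[of 3 "ln (real n)"] by simp
    finally show ?thesis using n by (simp add: divide_inverse)
  qed
  also have "real n * real n * (1 / real n ^ 3) = 1 / n" using n by (simp add: power3_eq_cube)
  finally have "measure_pmf.prob ?M (\<Union>p\<in>F \<times> F. ?bad p) \<le> 1 / n" .
  moreover have "{\<omega>. \<forall>A\<in>F. \<forall>B\<in>F. \<not> misjudged k \<omega> A B} = UNIV - (\<Union>p\<in>F \<times> F. ?bad p)"
    by auto
  ultimately show ?thesis using measure_pmf.prob_compl[of "\<Union>p\<in>F \<times> F. ?bad p" ?M] by simp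
qed

section \<open>Executions with a single random round\<close>

text \<open>With fixed coins an execution is deterministic. Machines numbered \<open>M\<close> and
  above get the default value of \<open>Pi_pmf\<close>, so that profiles coincide as
  functions.\<close>

primrec run :: "nat \<Rightarrow> (nat \<Rightarrow> nat \<Rightarrow> nat list \<Rightarrow> nat list list \<Rightarrow> nat list \<times> message list) \<Rightarrow>
    profile \<Rightarrow> nat \<Rightarrow> profile" where
  "run M f a 0 = a"
| "run M f a (Suc r) = (\<lambda>i. if i < M then f r i (fst (run M f a r i)) (inbox M (run M f a r) i) else ([], []))"

lemma Pi_pmf_map_dependent:
  assumes "finite I"
  shows "Pi_pmf I d (\<lambda>i. map_pmf (g i) D)
    = map_pmf (\<lambda>\<omega> i. if i \<in> I then g i (\<omega> i) else d) (Pi_pmf I z (\<lambda>_. D))"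
  unfolding map_pmf_def using assms by (subst Pi_pmf_bind[of I d _ _ z]) simp_all

text \<open>The coins of the only random round \<open>r0\<close> may be drawn in advance: the
  trajectory before that round does not depend on them, and afterwards everything is determined.
  Statements about executions thereby become statements about a fixed
  \<open>\<omega>\<close>.\<close>

lemma history_eq_run:
  fixes D :: "'x pmf" and inp :: "nat \<Rightarrow> (nat \<times> nat) list"
  assumes M: "machines A n = M"
    and step: "\<And>r i m ib. local_step A n r i m ib =
      map_pmf (\<lambda>x. step r i x m ib) (if r = r0 then D else return_pmf z)"
  defines "R \<equiv> \<lambda>\<omega>. run M (\<lambda>r i. step r i (if r = r0 then \<omega> i else z)) (initial_profile inp)"
  shows "history A n inp r = map_pmf (\<lambda>\<omega>. map (R \<omega>) [0..<Suc r]) (Pi_pmf {..<M} z (\<lambda>_. D))"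
proof (induction r)
  case 0
  have "R \<omega> 0 = initial_profile inp" for \<omega> by (simp add: R_def)
  then show ?case by simp
next
  case (Suc r)
  let ?\<Omega> = "Pi_pmf {..<M} z (\<lambda>_. D)"
  let ?f = "\<lambda>\<omega> r i. step r i (if r = r0 then \<omega> i else z)"
  have R_other: "R \<omega> (Suc q) = (\<lambda>i. if i < M then step q i z (fst (R \<omega> q i)) (inbox M (R \<omega> q) i) else ([], []))"
    if "q \<noteq> r0" for \<omega> q
    unfolding R_def run.simps if_not_P[OF that] by (rule refl)
  have R_r0: "R \<omega> (Suc r0) = (\<lambda>i. if i < M then step r0 i (\<omega> i) (fst (R \<omega> r0 i)) (inbox M (R \<omega> r0) i) else ([], []))"
    for \<omega>
    unfolding R_def run.simps if_P[OF refl] by (rule refl)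
  have last: "last (map (R \<omega>) [0..<Suc r]) = R \<omega> r" for \<omega> by simp
  have app: "map (R \<omega>) [0..<Suc r] @ [R \<omega> (Suc r)] = map (R \<omega>) [0..<Suc (Suc r)]" for \<omega> by simp
  show ?case
  proof (cases "r = r0")
    case False
    have "round_step A n r (R \<omega> r) = return_pmf (R \<omega> (Suc r))" for \<omega>
      using False by (simp add: round_step_def M step R_other)
    then have "history A n inp (Suc r) =
        bind_pmf (map_pmf (\<lambda>\<omega>. map (R \<omega>) [0..<Suc r]) ?\<Omega>)
          (\<lambda>h. map_pmf (\<lambda>a. h @ [a]) (round_step A n r (last h)))"
      using Suc by simp
    also have "\<dots> = bind_pmf ?\<Omega> (\<lambda>\<omega>. return_pmf (map (R \<omega>) [0..<Suc r] @ [R \<omega> (Suc r)]))"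
      unfolding bind_map_pmf last \<open>\<And>\<omega>. round_step A n r (R \<omega> r) = return_pmf (R \<omega> (Suc r))\<close> by simp
    finally show ?thesis unfolding app by (simp only: map_pmf_def)
  next
    case True
    have const: "R \<omega> q = R (\<lambda>_. z) q" if "q \<le> r" for \<omega> q
      using that
    proof (induction q)
      case (Suc q)
      then have ne: "q \<noteq> r0" and eq: "R \<omega> q = R (\<lambda>_. z) q" using True by auto
      show ?case unfolding R_other[OF ne] eq ..
    qed (simp add: R_def)
    let ?h = "map (R (\<lambda>_. z)) [0..<Suc r]"
    have h: "map (R \<omega>) [0..<Suc r] = ?h" for \<omega> by (intro map_cong refl const) auto
    then have h_fun: "(\<lambda>\<omega>. map (R \<omega>) [0..<Suc r]) = (\<lambda>_. ?h)" by (intro ext)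
    have "history A n inp (Suc r) = map_pmf (\<lambda>a. ?h @ [a]) (round_step A n r (last ?h))"
      using Suc unfolding h_fun by (simp del: upt_Suc add: bind_return_pmf)
    also have "last ?h = R (\<lambda>_. z) r" by simp
    also have "round_step A n r \<dots> =
        map_pmf (\<lambda>\<omega> i. if i \<in> {..<M} then step r i (\<omega> i) (fst (R (\<lambda>_. z) r i))
          (inbox M (R (\<lambda>_. z) r) i) else ([], [])) ?\<Omega>"
      unfolding round_step_def M step if_P[OF True] by (rule Pi_pmf_map_dependent) simp
    also have "(\<lambda>\<omega> i. if i \<in> {..<M} then step r i (\<omega> i) (fst (R (\<lambda>_. z) r i))
          (inbox M (R (\<lambda>_. z) r) i) else ([], [])) = (\<lambda>\<omega>. R \<omega> (Suc r))"
    proof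
      fix \<omega>
      have eq: "R \<omega> r = R (\<lambda>_. z) r" by (rule const) simp
      show "(\<lambda>i. if i \<in> {..<M} then step r i (\<omega> i) (fst (R (\<lambda>_. z) r i))
          (inbox M (R (\<lambda>_. z) r) i) else ([], [])) = R \<omega> (Suc r)"
        unfolding True R_r0 eq[unfolded True] by simp
    qed
    finally have "history A n inp (Suc r) = map_pmf (\<lambda>\<omega>. ?h @ [R \<omega> (Suc r)]) ?\<Omega>"
      by (simp add: pmf.map_comp o_def)
    also have "(\<lambda>\<omega>. ?h @ [R \<omega> (Suc r)]) = (\<lambda>\<omega>. map (R \<omega>) [0..<Suc (Suc r)])"
    proof
      fix \<omega>
      show "?h @ [R \<omega> (Suc r)] = map (R \<omega>) [0..<Suc (Suc r)]"
        unfolding app[symmetric] h[of \<omega>] ..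
    qed
    finally show ?thesis .
  qed
qed

section \<open>Aggregation and broadcast in trees of machines\<close>

text \<open>
  Round 0 scatters the input, after which cycles of \<open>2 * T + 1\<close> phases follow. In the phases \<open>p < T\<close>
  the machines of level \<open>p\<close> send to their parents, prefixing their own number so that the parent
  learns its children; in phase \<open>T\<close> the roots compute the next value; it travels down in the phases
  up to \<open>2 * T\<close>, when the leaves pass it on to their partners. A machine acts exactly in the phases
  in which it has received something, so it need not know its level.
\<close>

locale tree_program =
  fixes T :: nat
    and par swp :: "nat \<Rightarrow> nat"
    and leaf :: "nat \<Rightarrow> nat \<Rightarrow> nat list \<Rightarrow> nat list \<Rightarrow> nat list"
    and comb :: "nat \<Rightarrow> nat list list \<Rightarrow> nat list"
    and upd :: "nat \<Rightarrow> nat \<Rightarrow> 'x \<Rightarrow> nat list \<Rightarrow> nat list \<Rightarrow> nat list"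
    and scatter :: "nat list \<Rightarrow> nat list"
begin

text \<open>On the way up an inner machine replaces its memory by the numbers of its children, and
  on the way down it reads its destinations from there; the root uses the numbers at once. In phase
  0 the memory of a leaf is the value of its own root, and its only message is the value of its
  partner's root.\<close>

definition phase_step :: "nat \<Rightarrow> nat \<Rightarrow> nat \<Rightarrow> 'x \<Rightarrow> nat list \<Rightarrow> nat list list \<Rightarrow> nat list \<times> message list" where
  "phase_step s p i z m ib =
    (if ib = [] then (m, [])
     else if p = 0 then ([], [(par i, i # leaf s i m (hd ib))])
     else if p < T then (map hd ib, [(par i, i # comb s ib)])
     else if p = T then (let x = upd s i z m (comb s ib) in (x, map (\<lambda>c. (c, x)) (map hd ib)))
     else if p < 2 * T then ([], map (\<lambda>c. (c, hd ib)) m)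
     else (hd ib, [(swp i, hd ib)]))"

text \<open>The empty payloads of round 0 merely wake up the leaves: an inbox that holds an empty
  payload is not an empty inbox.\<close>

definition step :: "nat \<Rightarrow> nat \<Rightarrow> 'x \<Rightarrow> nat list \<Rightarrow> nat list list \<Rightarrow> nat list \<times> message list" where
  "step r i z m ib =
    (if r = 0 then ([], map (\<lambda>d. (d, [])) (scatter m))
     else phase_step ((r - 1) div (2 * T + 1)) ((r - 1) mod (2 * T + 1)) i z m ib)"

end

text \<open>If every sender has at most one message for \<open>j\<close>, the inbox is ordered by
  sender, which is also the order of \<open>ch\<close>.\<close>

lemma inbox_eq_map_filter:
  assumes "\<And>i. i < M \<Longrightarrow> map snd (filter (\<lambda>m. fst m = j) (snd (a i))) = (if Q i then [g i] else [])"
  shows "inbox M a j = map g (filter Q [0..<M])"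
proof -
  have "inbox M a j = concat (map (\<lambda>i. if Q i then [g i] else []) [0..<M])"
    unfolding inbox_def using assms by (intro arg_cong[of _ _ concat] map_cong) auto
  also have "concat (map (\<lambda>i. if Q i then [g i] else []) xs) = map g (filter Q xs)" for xs
    by (induction xs) auto
  finally show ?thesis .
qed

lemma filter_eq_upt: "filter (\<lambda>i. i = k) [0..<M] = (if k < M then [k] else [])"
  by (induction M) auto

lemma filter_eq_distinct: "distinct xs \<Longrightarrow> filter (\<lambda>i. i = k) xs = (if k \<in> set xs then [k] else [])"
  by (induction xs) auto

text \<open>The assumption \<open>has_child\<close> ensures that every active inner machine is
  reached on the way up, and \<open>upd_indep\<close> that after cycle 0 the dummy \<open>z\<close>
  can stand for the real coins.\<close>

locale tree_simulation = tree_program T par swp leaf comb upd scatter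
  for T par swp leaf comb and upd :: "nat \<Rightarrow> nat \<Rightarrow> 'x \<Rightarrow> nat list \<Rightarrow> nat list \<Rightarrow> nat list" and scatter +
  fixes M :: nat and active :: "nat \<Rightarrow> bool" and lev root :: "nat \<Rightarrow> nat" and \<omega> :: "nat \<Rightarrow> 'x" and z :: 'x
  assumes T_pos: "T > 0"
    and active_less: "\<And>i. active i \<Longrightarrow> i < M"
    and lev_le: "\<And>i. active i \<Longrightarrow> lev i \<le> T"
    and active_par: "\<And>i. active i \<Longrightarrow> lev i < T \<Longrightarrow> active (par i)"
    and lev_par: "\<And>i. active i \<Longrightarrow> lev i < T \<Longrightarrow> lev (par i) = Suc (lev i)"
    and root_par: "\<And>i. active i \<Longrightarrow> lev i < T \<Longrightarrow> root (par i) = root i"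
    and root_self: "\<And>i. active i \<Longrightarrow> lev i = T \<Longrightarrow> root i = i"
    and has_child: "\<And>i. active i \<Longrightarrow> 0 < lev i \<Longrightarrow> \<exists>c. active c \<and> lev c < T \<and> par c = i"
    and active_swp: "\<And>i. active i \<Longrightarrow> lev i = 0 \<Longrightarrow> active (swp i)"
    and lev_swp: "\<And>i. active i \<Longrightarrow> lev i = 0 \<Longrightarrow> lev (swp i) = 0"
    and swp_swp: "\<And>i. active i \<Longrightarrow> lev i = 0 \<Longrightarrow> swp (swp i) = i"
    and upd_indep: "\<And>s i m y. s > 0 \<Longrightarrow> upd s i z m y = upd s i (\<omega> i) m y"
begin

definition ch :: "nat \<Rightarrow> nat list" where
  "ch i = filter (\<lambda>c. active c \<and> lev c < T \<and> par c = i) [0..<M]"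

text \<open>
  \<open>x s i\<close> is the value of the root \<open>i\<close> at the beginning of cycle \<open>s\<close>, and \<open>y s i\<close> the aggregate that
  machine \<open>i\<close> sends upwards in this cycle.
\<close>

primrec val :: "(nat \<Rightarrow> nat list) \<Rightarrow> nat \<Rightarrow> nat \<Rightarrow> nat \<Rightarrow> nat list" where
  "val X s 0 i = leaf s i (X (root i)) (X (root (swp i)))"
| "val X s (Suc t) i = comb s (map (\<lambda>c. c # val X s t c) (ch i))"

primrec x :: "nat \<Rightarrow> nat \<Rightarrow> nat list" where
  "x 0 = (\<lambda>i. [])"
| "x (Suc s) = (\<lambda>i. upd s i (\<omega> i) (x s i) (val (x s) s T i))"

definition y :: "nat \<Rightarrow> nat \<Rightarrow> nat list" where
  "y s i = val (x s) s (lev i) i"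

text \<open>
  Memory and inbox of machine \<open>i\<close> before phase \<open>p\<close> of cycle \<open>s\<close>; the case \<open>p = 2 * T + 1\<close> describes
  the end of the cycle.
\<close>

definition mem_before :: "nat \<Rightarrow> nat \<Rightarrow> nat \<Rightarrow> nat list" where
  "mem_before s p i =
    (if \<not> active i then []
     else if lev i = T then (if p \<le> T then x s i else x (Suc s) i)
     else if lev i = 0 then (if p = 0 then x s (root i) else if p = 2 * T + 1 then x (Suc s) (root i) else [])
     else if lev i < p \<and> p \<le> 2 * T - lev i then ch i else [])"

definition in_before :: "nat \<Rightarrow> nat \<Rightarrow> nat \<Rightarrow> nat list list" where
  "in_before s p i =
    (if \<not> active i then []
     else if p = 0 then (if lev i = 0 then [x s (root (swp i))] else [])
     else if p \<le> T then (if lev i = p then map (\<lambda>c. c # y s c) (ch i) else [])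
     else if p \<le> 2 * T then (if lev i = 2 * T - p then [x (Suc s) (root i)] else [])
     else if lev i = 0 then [x (Suc s) (root (swp i))] else [])"

definition sent :: "nat \<Rightarrow> nat \<Rightarrow> nat \<Rightarrow> message list" where
  "sent s p i =
    (if \<not> active i then []
     else if p < T then (if lev i = p then [(par i, i # y s i)] else [])
     else if p < 2 * T then (if lev i = 2 * T - p then map (\<lambda>c. (c, x (Suc s) (root i))) (ch i) else [])
     else if lev i = 0 then [(swp i, x (Suc s) (root i))] else [])"

lemma set_ch: "set (ch i) = {c. active c \<and> lev c < T \<and> par c = i}"
  using active_less by (auto simp: ch_def)

lemma distinct_ch: "distinct (ch i)" by (simp add: ch_def)

lemma lev_ch: "c \<in> set (ch i) \<Longrightarrow> lev i = Suc (lev c)"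
  using lev_par by (auto simp: set_ch)

lemma ch_nonempty: "active i \<Longrightarrow> 0 < lev i \<Longrightarrow> ch i \<noteq> []"
  using has_child[of i] set_ch[of i] by (metis (mono_tags, lifting) empty_iff list.set(1) mem_Collect_eq)

lemma y_leaf: "lev i = 0 \<Longrightarrow> y s i = leaf s i (x s (root i)) (x s (root (swp i)))"
  by (simp add: y_def)

lemma y_inner:
  assumes "0 < lev i" shows "y s i = comb s (map (\<lambda>c. c # y s c) (ch i))"
proof -
  obtain t where t: "lev i = Suc t" using assms gr0_conv_Suc by auto
  then have "lev c = t" if "c \<in> set (ch i)" for c using lev_ch[OF that] by simp
  then show ?thesis by (auto simp: y_def t cong: map_cong)
qed

lemma x_root: "lev i = T \<Longrightarrow> x (Suc s) i = upd s i (\<omega> i) (x s i) (y s i)"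
  by (simp add: y_def)

text \<open>The inbox of an active machine of level \<open>l\<close> is nonempty exactly before the
  phases \<open>l\<close> and \<open>2 * T - l\<close>, which coincide at the root. In all other
  phases both sides leave the memory unchanged and send nothing.\<close>

lemma phase_step_eq:
  assumes "p \<le> 2 * T" "s = 0 \<and> p = T \<longrightarrow> w = \<omega> i" "\<not> (s = 0 \<and> p = T) \<longrightarrow> w = z"
  shows "phase_step s p i w (mem_before s p i) (in_before s p i) = (mem_before s (Suc p) i, sent s p i)"
proof (cases "active i \<and> in_before s p i \<noteq> []")
  case False
  then have e: "in_before s p i = []" by (auto simp: in_before_def)
  have "mem_before s p i = mem_before s (Suc p) i \<and> sent s p i = []"
  proof (cases "active i")
    case act: True
    have lt: "lev i \<le> T" by (rule lev_le[OF act])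
    consider "p = 0" "lev i \<noteq> 0" | "0 < p" "p \<le> T" "lev i \<noteq> p" | "T < p" "lev i \<noteq> 2 * T - p"
      using e act ch_nonempty[of i] assms(1)
      by (cases "p = 0"; cases "p \<le> T") (auto simp: in_before_def split: if_splits)
    then show ?thesis
      using act lt T_pos assms(1) by cases (auto simp: mem_before_def sent_def)
  qed (auto simp: mem_before_def sent_def)
  then show ?thesis using e by (simp add: phase_step_def)
next
  case True
  then have act: "active i" and ne: "in_before s p i \<noteq> []" by auto
  consider "p = 0" "lev i = 0" | "0 < p" "p < T" "lev i = p" | "p = T" "lev i = T"
    | "T < p" "p < 2 * T" "lev i = 2 * T - p" | "p = 2 * T" "lev i = 0"
    using ne act assms(1) T_pos
    by (cases "p = 0"; cases "p \<le> T"; cases "p = T"; cases "p = 2 * T") (auto simp: in_before_def split: if_splits)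
  then show ?thesis
  proof cases
    case 1
    then show ?thesis using act T_pos
      by (simp add: phase_step_def mem_before_def in_before_def sent_def y_leaf)
  next
    case 2
    then show ?thesis using act ch_nonempty[OF act]
      by (simp add: phase_step_def mem_before_def in_before_def sent_def y_inner[of i] o_def)
  next
    case 3
    have "upd s i w (x s i) (y s i) = x (Suc s) i"
      using 3 assms(2,3) upd_indep[of s] x_root[of i s] by (cases "s = 0") auto
    then show ?thesis using 3 act ch_nonempty[OF act] T_pos root_self[OF act]
      by (simp add: phase_step_def mem_before_def in_before_def sent_def y_inner[of i, symmetric] o_def Let_def
          del: x.simps)
  next
    case 4
    then show ?thesis using act
      by (auto simp: phase_step_def mem_before_def in_before_def sent_def simp del: x.simps)
  next
    case 5
    then show ?thesis using act T_pos
      by (simp add: phase_step_def mem_before_def in_before_def sent_def del: x.simps)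
  qed
qed

text \<open>On the way up the senders to \<open>j\<close> are its children, on the way down its
  parent alone. In the last phase it is the partner alone, because \<open>swp\<close> is an
  involution on the active leaves.\<close>

lemma inbox_sent:
  assumes p: "p \<le> 2 * T" and a: "\<And>i. i < M \<Longrightarrow> snd (a i) = sent s p i"
  shows "inbox M a j = in_before s (Suc p) j"
proof -
  consider "p < T" | "T \<le> p" "p < 2 * T" | "p = 2 * T" using p by linarith
  then show ?thesis
  proof cases
    case 1
    have "inbox M a j = map (\<lambda>i. i # y s i) (filter (\<lambda>i. active i \<and> lev i = p \<and> par i = j) [0..<M])"
      using 1 by (intro inbox_eq_map_filter) (simp add: a sent_def)
    also have "\<dots> = in_before s (Suc p) j"
    proof (cases "active j \<and> lev j = Suc p")
      case True
      then have "(active i \<and> lev i = p \<and> par i = j) = (active i \<and> lev i < T \<and> par i = j)" for i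
        using lev_par[of i] 1 by auto
      then show ?thesis using True 1 by (simp add: in_before_def ch_def)
    next
      case False
      then have "\<not> (active i \<and> lev i = p \<and> par i = j)" for i
        using lev_par[of i] active_par[of i] 1 by auto
      then show ?thesis using False 1 by (auto simp: in_before_def)
    qed
    finally show ?thesis .
  next
    case 2
    have "inbox M a j = map (\<lambda>i. x (Suc s) (root i))
      (filter (\<lambda>i. active i \<and> lev i = 2 * T - p \<and> j \<in> set (ch i)) [0..<M])"
    proof (rule inbox_eq_map_filter)
      fix i assume "i < M"
      show "map snd (filter (\<lambda>m. fst m = j) (snd (a i)))
        = (if active i \<and> lev i = 2 * T - p \<and> j \<in> set (ch i) then [x (Suc s) (root i)] else [])"
        using 2 \<open>i < M\<close> filter_eq_distinct[OF distinct_ch, of j i]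
        by (simp add: a sent_def filter_map o_def del: x.simps)
    qed
    also have "\<dots> = in_before s (Suc p) j"
    proof (cases "active j \<and> lev j = 2 * T - Suc p")
      case True
      then have lt: "lev j < T" using 2 by auto
      have "(active i \<and> lev i = 2 * T - p \<and> j \<in> set (ch i)) = (i = par j)" for i
        using True 2 lt lev_par[of j] active_par[of j] by (auto simp: set_ch)
      then show ?thesis
        using True 2 lt active_less[OF active_par[of j]] root_par[of j]
        by (simp add: in_before_def filter_eq_upt del: x.simps)
    next
      case False
      then have "\<not> (active i \<and> lev i = 2 * T - p \<and> j \<in> set (ch i))" for i
        using lev_ch[of j i] 2 by (auto simp: set_ch)
      then show ?thesis using False 2 by (auto simp: in_before_def)
    qed
    finally show ?thesis .
  next
    case 3
    have "inbox M a j = map (\<lambda>i. x (Suc s) (root i)) (filter (\<lambda>i. active i \<and> lev i = 0 \<and> swp i = j) [0..<M])"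
      using 3 T_pos by (intro inbox_eq_map_filter) (simp add: a sent_def del: x.simps)
    also have "\<dots> = in_before s (Suc p) j"
    proof (cases "active j \<and> lev j = 0")
      case True
      then have "(active i \<and> lev i = 0 \<and> swp i = j) = (i = swp j)" for i
        using active_swp[of j] lev_swp[of j] swp_swp[of j] swp_swp[of i] by auto
      then show ?thesis
        using True 3 T_pos active_less[OF active_swp[of j]]
        by (simp add: in_before_def filter_eq_upt del: x.simps)
    next
      case False
      then have "\<not> (active i \<and> lev i = 0 \<and> swp i = j)" for i
        using active_swp[of i] lev_swp[of i] by auto
      then show ?thesis using False 3 T_pos by (auto simp: in_before_def)
    qed
    finally show ?thesis .
  qed
qed

lemma cycle_end: "mem_before s (Suc (2 * T)) = mem_before (Suc s) 0" "in_before s (Suc (2 * T)) = in_before (Suc s) 0"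
  using T_pos by (auto simp: mem_before_def in_before_def fun_eq_iff)

definition prof :: "profile \<Rightarrow> nat \<Rightarrow> profile" where
  "prof a = run M (\<lambda>r i. step r i (if r = Suc T then \<omega> i else z)) a"

definition scattered :: "profile \<Rightarrow> bool" where
  "scattered a \<longleftrightarrow> (\<forall>j<M. inbox M (prof a 1) j = (if active j \<and> lev j = 0 then [[]] else []))"

text \<open>The outer \<open>Suc\<close> accounts for the scattering round, so this is the profile
  just before phase \<open>p\<close> of cycle \<open>s\<close>. The value \<open>2 * T + 1\<close>
  of \<open>p\<close> is the overlap with phase 0 of the next cycle and carries the induction over
  cycles.\<close>

lemma prof_eq:
  assumes sc: "scattered a" and p: "p \<le> 2 * T + 1" and i: "i < M"
  shows "fst (prof a (Suc (s * (2 * T + 1) + p)) i) = mem_before s p i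
    \<and> inbox M (prof a (Suc (s * (2 * T + 1) + p))) i = in_before s p i
    \<and> (\<forall>q. p = Suc q \<longrightarrow> snd (prof a (Suc (s * (2 * T + 1) + p)) i) = sent s q i)"
proof -
  define P where "P s p \<longleftrightarrow> (\<forall>i<M. fst (prof a (Suc (s * (2 * T + 1) + p)) i) = mem_before s p i
    \<and> inbox M (prof a (Suc (s * (2 * T + 1) + p))) i = in_before s p i
    \<and> (\<forall>q. p = Suc q \<longrightarrow> snd (prof a (Suc (s * (2 * T + 1) + p)) i) = sent s q i))" for s p
  have 00: "P 0 0"
  proof -
    have "fst (prof a 1 i) = []" if "i < M" for i using that by (simp add: prof_def step_def)
    then show ?thesis using sc T_pos by (auto simp: P_def scattered_def mem_before_def in_before_def)
  qed
  have st: "P s (Suc p)" if "P s p" "p \<le> 2 * T" for s p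
  proof -
    let ?r = "Suc (s * (2 * T + 1) + p)"
    have dm: "(?r - 1) div (2 * T + 1) = s" "(?r - 1) mod (2 * T + 1) = p"
    proof -
      have e: "?r - 1 = p + s * (2 * T + 1)" by simp
      show "(?r - 1) div (2 * T + 1) = s" "(?r - 1) mod (2 * T + 1) = p"
        unfolding e using that(2) by (simp_all only: div_mult_self1 mod_mult_self1) simp_all
    qed
    \<comment> \<open>The coins are used when the roots compute their first values, in phase
      \<open>T\<close> of cycle 0.\<close>
    have rT: "?r = Suc T \<longleftrightarrow> s = 0 \<and> p = T"
    proof (cases s)
      case (Suc s')
      have "T < s * (2 * T + 1)" unfolding Suc by simp
      then show ?thesis using Suc by linarith
    qed simp
    have *: "prof a (Suc ?r) i = (mem_before s (Suc p) i, sent s p i)" if i: "i < M" for i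
    proof -
      have "prof a (Suc ?r) i = phase_step s p i (if ?r = Suc T then \<omega> i else z) (fst (prof a ?r i)) (inbox M (prof a ?r) i)"
        using i dm by (simp add: prof_def step_def)
      also have "\<dots> = (mem_before s (Suc p) i, sent s p i)"
        using \<open>P s p\<close> i \<open>p \<le> 2 * T\<close> rT by (subst phase_step_eq[symmetric]) (auto simp: P_def)
      finally show ?thesis .
    qed
    have "inbox M (prof a (Suc ?r)) j = in_before s (Suc p) j" for j
      using that(2) * by (intro inbox_sent) auto
    then show ?thesis using * by (simp add: P_def)
  qed
  have ind: "P s p" if "P s 0" "p \<le> 2 * T + 1" for s p
    using that(2) by (induction p) (use that(1) st in auto)
  have wrap: "P (Suc s) 0" if "P s (2 * T + 1)" for s
    using that by (simp add: P_def cycle_end add.commute add.left_commute)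
  have "P s 0" by (induction s) (use 00 ind wrap in auto)
  then show ?thesis using ind p i by (auto simp: P_def)
qed


lemma prof_Suc_Suc:
  assumes "scattered a"
  obtains s p where "p \<le> 2 * T" "\<And>i. i < M \<Longrightarrow> fst (prof a (Suc (Suc q)) i) = mem_before s (Suc p) i"
    "\<And>i. i < M \<Longrightarrow> inbox M (prof a (Suc (Suc q))) i = in_before s (Suc p) i"
    "\<And>i. i < M \<Longrightarrow> snd (prof a (Suc (Suc q)) i) = sent s p i"
proof -
  define s p where "s = q div (2 * T + 1)" and "p = q mod (2 * T + 1)"
  have "p < 2 * T + 1" unfolding p_def by (rule mod_less_divisor) simp
  then have p: "p \<le> 2 * T" "Suc p \<le> 2 * T + 1" by simp_all
  have "q = s * (2 * T + 1) + p" unfolding s_def p_def by (simp only: div_mult_mod_eq)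
  then have q: "Suc (s * (2 * T + 1) + Suc p) = Suc (Suc q)" by simp
  show thesis using that[OF p(1), of s] prof_eq[OF assms p(2), of _ s, unfolded q] by blast
qed

text \<open>A message takes at most \<open>l + 2\<close> words: the header, possibly the number of
  the sender, and a value. At any time a machine sends or receives at most
  \<open>1 + length (ch i)\<close> messages.\<close>

lemma memory_usage_prof_le:
  assumes sc: "scattered a" and i: "i < M"
    and x: "\<And>s i. active i \<Longrightarrow> length (x s (root i)) \<le> l"
    and y: "\<And>s i. active i \<Longrightarrow> length (y s i) \<le> l"
  shows "memory_usage M (prof a (Suc (Suc q))) i \<le> (if active i then (1 + length (ch i)) * (2 * l + 3) else 0)"
proof -
  obtain s p where p: "p \<le> 2 * T" and eq: "fst (prof a (Suc (Suc q)) i) = mem_before s (Suc p) i"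
    "inbox M (prof a (Suc (Suc q))) i = in_before s (Suc p) i"
    "snd (prof a (Suc (Suc q)) i) = sent s p i"
    using prof_Suc_Suc[OF sc, of q] i by metis
  show ?thesis
  proof (cases "active i")
    case False
    then show ?thesis
      by (simp add: memory_usage_def eq mem_before_def in_before_def sent_def payloads_size_def)
  next
    case act: True
    let ?c = "length (ch i)"
    note xr = x[OF act]
    have xs: "length (x s (root (swp i))) \<le> l" if "lev i = 0" for s
      by (rule x[OF active_swp[OF act that]])
    have cl: "(\<Sum>c\<leftarrow>cs. 1 + length (f c)) \<le> length cs * (l + 2)"
      if "\<And>c. c \<in> set cs \<Longrightarrow> length (f c) \<le> Suc l" for cs :: "nat list" and f :: "nat \<Rightarrow> nat list"
      using that
    proof (induction cs)
      case (Cons c cs)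
      have "length (f c) \<le> Suc l" by (rule Cons.prems) simp
      moreover have "(\<Sum>c\<leftarrow>cs. 1 + length (f c)) \<le> length cs * (l + 2)"
        using Cons.prems by (intro Cons.IH) simp
      ultimately show ?case by simp
    qed simp
    have yc: "length (y s c) \<le> l" if "c \<in> set (ch i)" for c using that y by (auto simp: set_ch)
    have "length (mem_before s (Suc p) i) \<le> l + ?c"
      using xr[of s] xr[of "Suc s"] root_self[OF act] by (auto simp: mem_before_def trans_le_add1 simp del: x.simps)
    moreover have "payloads_size (map snd (sent s p i)) \<le> (1 + ?c) * (l + 2)"
      using xr[of "Suc s"] y[OF act, of s] cl[of "ch i" "\<lambda>_. x (Suc s) (root i)"]
      by (auto simp: sent_def payloads_size_def o_def simp del: x.simps)
    moreover have "payloads_size (in_before s (Suc p) i) \<le> (1 + ?c) * (l + 2)"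
      using xr[of "Suc s"] xs[of "Suc s"] yc cl[of "ch i" "\<lambda>c. c # y s c"]
      by (auto simp: in_before_def payloads_size_def o_def simp del: x.simps)
    ultimately have "memory_usage M (prof a (Suc (Suc q))) i \<le> (l + ?c) + (1 + ?c) * (l + 2)"
      unfolding memory_usage_def eq by linarith
    also have "\<dots> \<le> (1 + ?c) * (2 * l + 3)" by (simp add: algebra_simps)
    finally show ?thesis using act by simp
  qed
qed

lemma words_below_prof:
  assumes sc: "scattered a" and W: "M \<le> W"
    and x: "\<And>s i. active i \<Longrightarrow> set (x s (root i)) \<subseteq> {..<W}"
    and y: "\<And>s i. active i \<Longrightarrow> set (y s i) \<subseteq> {..<W}"
  shows "words_below W M (prof a (Suc (Suc q)))"
  unfolding words_below_def
proof (intro allI impI)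
  fix i assume i: "i < M"
  obtain s p where p: "p \<le> 2 * T" and eq: "fst (prof a (Suc (Suc q)) i) = mem_before s (Suc p) i"
    "snd (prof a (Suc (Suc q)) i) = sent s p i"
    using prof_Suc_Suc[OF sc, of q] i by metis
  have chM: "set (ch j) \<subseteq> {..<M}" for j using active_less by (auto simp: set_ch)
  have "set (mem_before s (Suc p) i) \<subseteq> {..<W}"
    using x[of i] root_self[of i] chM[of i] W by (auto simp: mem_before_def simp del: x.simps) fastforce+
  moreover have "d < M \<and> set m \<subseteq> {..<W}" if "(d, m) \<in> set (sent s p i)" for d m
  proof (cases "active i")
    case act: True
    consider "lev i < T" "d = par i" "m = i # y s i" | "d \<in> set (ch i)" "m = x (Suc s) (root i)"
      | "lev i = 0" "d = swp i" "m = x (Suc s) (root i)"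
      using \<open>(d, m) \<in> set (sent s p i)\<close> act by (auto simp: sent_def simp del: x.simps split: if_splits)
    then show ?thesis
    proof cases
      case 1
      then show ?thesis using active_less[OF active_par[OF act]] y[OF act, of s] i W by auto
    next
      case 2
      then show ?thesis using chM[of i] x[OF act, of "Suc s"] by (auto simp del: x.simps)
    next
      case 3
      then show ?thesis using active_less[OF active_swp[OF act]] x[OF act, of "Suc s"]
        by (auto simp del: x.simps)
    qed
  qed (use that in \<open>simp add: sent_def\<close>)
  ultimately show "set (fst (prof a (Suc (Suc q)) i)) \<subseteq> {..<W} \<and>
      (\<forall>(d, m)\<in>set (snd (prof a (Suc (Suc q)) i)). d < M \<and> set m \<subseteq> {..<W})"
    unfolding eq by auto
qed

lemma prof_cycle_end:
  assumes "scattered a" "i < M"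
  shows "fst (prof a (Suc (s * (2 * T + 1))) i) =
    (if active i \<and> (lev i = T \<or> lev i = 0) then x s (root i) else [])"
  using prof_eq[OF assms(1) _ assms(2), of 0 s] root_self[of i] by (auto simp: mem_before_def)

end

section \<open>The clustering program\<close>

text \<open>
  Machine \<open>addr n t u q\<close> is the node of level \<open>t\<close> in the tree of \<open>u\<close> whose subtree holds the
  neighbours \<open>v\<close> of \<open>u\<close> with \<open>v div B ^ t = q\<close>. Apart from the input, only nodes with a nonempty subtree use memory,
  which keeps the total memory proportional to the number of edges.
\<close>

definition addr :: "nat \<Rightarrow> nat \<Rightarrow> nat \<Rightarrow> nat \<Rightarrow> nat" where
  "addr n t u q = (t * n + u) * n + q"

definition addr_level :: "nat \<Rightarrow> nat \<Rightarrow> nat" where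
  "addr_level n i = i div n div n"

definition addr_owner :: "nat \<Rightarrow> nat \<Rightarrow> nat" where
  "addr_owner n i = i div n mod n"

definition addr_index :: "nat \<Rightarrow> nat \<Rightarrow> nat" where
  "addr_index n i = i mod n"

definition addr_parent :: "nat \<Rightarrow> nat \<Rightarrow> nat \<Rightarrow> nat" where
  "addr_parent n B i = addr n (Suc (addr_level n i)) (addr_owner n i) (addr_index n i div B)"

definition addr_swap :: "nat \<Rightarrow> nat \<Rightarrow> nat" where
  "addr_swap n i = addr n 0 (addr_index n i) (addr_owner n i)"

lemma addr_components [simp]:
  assumes "u < n" "q < n"
  shows "addr_level n (addr n t u q) = t" "addr_owner n (addr n t u q) = u"
    "addr_index n (addr n t u q) = q"
proof -
  have "addr n t u q div n = t * n + u" using assms by (simp add: addr_def)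
  then show "addr_level n (addr n t u q) = t" "addr_owner n (addr n t u q) = u"
    using assms by (simp_all add: addr_level_def addr_owner_def)
  show "addr_index n (addr n t u q) = q" using assms by (simp add: addr_index_def addr_def)
qed

lemma addr_eq: "addr n (addr_level n i) (addr_owner n i) (addr_index n i) = i"
  by (simp add: addr_def addr_level_def addr_owner_def addr_index_def)

definition num_machines :: "nat \<Rightarrow> nat \<Rightarrow> nat" where
  "num_machines T n = Suc T * n * n"

lemma addr_less_iff:
  assumes "n > 0" shows "i < num_machines T n \<longleftrightarrow> addr_level n i \<le> T"
proof -
  have "addr_level n i < Suc T \<longleftrightarrow> i div n < Suc T * n"
    unfolding addr_level_def using assms by (simp only: div_less_iff_less_mult)
  also have "\<dots> \<longleftrightarrow> i < num_machines T n"
    using assms by (simp only: div_less_iff_less_mult num_machines_def)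
  finally show ?thesis by auto
qed

lemma addr_inject:
  assumes "u < n" "q < n" "u' < n" "q' < n"
  shows "addr n t u q = addr n t' u' q' \<longleftrightarrow> t = t' \<and> u = u' \<and> q = q'"
  using assms addr_components by metis

definition edge_leaves :: "nat \<Rightarrow> nat \<times> nat \<Rightarrow> nat list" where
  "edge_leaves n = (\<lambda>(u, v). if u = v then [addr n 0 u u] else [addr n 0 u v, addr n 0 v u])"

fun scatter_words :: "nat \<Rightarrow> nat list \<Rightarrow> nat list" where
  "scatter_words n (u # v # ws) = edge_leaves n (u, v) @ scatter_words n ws"
| "scatter_words n _ = []"

lemma scatter_words_encode_pairs:
  "scatter_words n (encode_pairs ps) = concat (map (edge_leaves n) ps)"
  by (induction ps) (auto simp: encode_pairs_def)

definition sketches_agree :: "nat \<Rightarrow> nat list \<Rightarrow> nat list \<Rightarrow> bool" where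
  "sketches_agree k X Y \<longleftrightarrow> 25 * card {c. c < k \<and> X ! c \<noteq> Y ! c} \<le> k"

text \<open>
  The leaf \<open>(u, v)\<close> holds the value \<open>m\<close> of \<open>u\<close> and receives the value \<open>r\<close> of \<open>v\<close>. The values are
  random words before cycle 1, sketches before cycle 2, \<open>[heavy] @ sketch\<close> before cycle 3 and
  \<open>[heavy, least heavy] @ sketch\<close> before cycle 4; \<open>n\<close> stands for a missing vertex.
\<close>

definition leaf_program :: "nat \<Rightarrow> nat \<Rightarrow> nat \<Rightarrow> nat \<Rightarrow> nat list \<Rightarrow> nat list \<Rightarrow> nat list" where
  "leaf_program n k s i m r =
    (if s = 1 then r
     else if s = 2 then [of_bool (sketches_agree k m r), 1]
     else if s = 3 then [if sketches_agree k (tl m) (tl r) \<and> hd r = 1 then addr_index n i else n]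
     else if s = 4 then [if sketches_agree k (tl (tl m)) (tl (tl r)) then r ! 1 else n]
     else [])"

definition aggregate :: "nat \<Rightarrow> ('v \<Rightarrow> nat) \<Rightarrow> 'v set \<Rightarrow> nat" where
  "aggregate s f A = (if s = 2 then sum f A else Min (f ` A))"

text \<open>
  Payloads start with the number of the sender, so the set of payloads loses no multiplicities.
\<close>

definition comb_program :: "nat \<Rightarrow> nat list list \<Rightarrow> nat list" where
  "comb_program s ib = map (\<lambda>j. aggregate s (\<lambda>m. m ! Suc j) (set ib)) [0..<length (hd ib) - 1]"

text \<open>The label of a light vertex is at least \<open>n\<close>, hence different from all
  labels of heavy vertices, which are themselves vertices. Cycle 4 puts the owner in front so that
  the value is an output pair.\<close>

definition upd_program ::
    "nat \<Rightarrow> nat \<Rightarrow> nat \<Rightarrow> nat \<Rightarrow> (nat \<Rightarrow> nat) \<Rightarrow> nat list \<Rightarrow> nat list \<Rightarrow> nat list" where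
  "upd_program n k s i w m y =
    (if s = 0 then map w [0..<k]
     else if s = 1 then y
     else if s = 2 then of_bool (9 * y ! 1 \<le> 10 * y ! 0) # m
     else if s = 3 then hd m # hd y # tl m
     else if s = 4 then [addr_owner n i, if hd m = 1 then hd y else n + addr_owner n i]
     else [])"

lemma aggregate_image:
  assumes "inj_on g A" shows "aggregate s f (g ` A) = aggregate s (\<lambda>a. f (g a)) A"
  using assms by (simp add: aggregate_def sum.reindex image_image o_def)

text \<open>Sums and minima can be computed part by part over a disjoint union; this is what lets a
  tree aggregate them level by level.\<close>

lemma aggregate_UN:
  assumes I: "finite I" "I \<noteq> {}" and A: "\<And>i. i \<in> I \<Longrightarrow> finite (A i) \<and> A i \<noteq> {}"
    and disj: "\<And>i j. i \<in> I \<Longrightarrow> j \<in> I \<Longrightarrow> i \<noteq> j \<Longrightarrow> A i \<inter> A j = {}"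
  shows "aggregate s f (\<Union>i\<in>I. A i) = aggregate s (\<lambda>i. aggregate s f (A i)) I"
proof (cases "s = 2")
  case True
  then show ?thesis using assms by (simp add: aggregate_def sum.UNION_disjoint)
next
  case False
  have "Min (f ` (\<Union>i\<in>I. A i)) = Min ((\<lambda>i. Min (f ` A i)) ` I)"
  proof (rule Min_eqI)
    have fin: "finite (\<Union>i\<in>I. A i)" using I A by auto
    then show "finite (f ` (\<Union>i\<in>I. A i))" by simp
    show "Min ((\<lambda>i. Min (f ` A i)) ` I) \<le> b" if b: "b \<in> f ` (\<Union>i\<in>I. A i)" for b
    proof -
      obtain i a where ia: "i \<in> I" "a \<in> A i" "b = f a" using b by auto
      have "Min ((\<lambda>i. Min (f ` A i)) ` I) \<le> Min (f ` A i)" using I ia by (intro Min_le) auto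
      also have "\<dots> \<le> b" using A[OF ia(1)] ia by (intro Min_le) auto
      finally show ?thesis .
    qed
    have "Min ((\<lambda>i. Min (f ` A i)) ` I) \<in> (\<lambda>i. Min (f ` A i)) ` I" using I by (intro Min_in) auto
    then obtain i where i: "i \<in> I" "Min ((\<lambda>i. Min (f ` A i)) ` I) = Min (f ` A i)" by auto
    have "Min (f ` A i) \<in> f ` A i" using A[OF i(1)] by (intro Min_in) auto
    then show "Min ((\<lambda>i. Min (f ` A i)) ` I) \<in> f ` (\<Union>i\<in>I. A i)" using i by auto
  qed
  then show ?thesis using False by (simp add: aggregate_def)
qed

lemma aggregate_singleton: "aggregate s f {a} = f a" by (simp add: aggregate_def)

text \<open>By \<open>n \<le> B ^ T\<close> the only index in use at level \<open>T\<close> is 0, so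
  each vertex has a single root covering its whole neighbourhood.\<close>

locale clustering_network =
  fixes n T B k :: nat and E :: "nat set set" and \<omega> :: "nat \<Rightarrow> nat \<Rightarrow> nat"
  assumes graph: "signed_graph {..<n} E" and n_pos: "n > 0" and T_pos: "T > 0"
    and B_pos: "B > 0" and n_le: "n \<le> B ^ T"
begin

abbreviation N where "N \<equiv> nbrs E"

definition leaves :: "nat \<Rightarrow> nat set" where
  "leaves i = {v \<in> N (addr_owner n i). v div B ^ addr_level n i = addr_index n i}"

definition active :: "nat \<Rightarrow> bool" where
  "active i \<longleftrightarrow> addr_level n i \<le> T \<and> leaves i \<noteq> {}"

definition vertex :: "nat \<Rightarrow> nat" where "vertex u = addr n T u 0"

lemma N_less: "v \<in> N u \<Longrightarrow> v < n" "v \<in> N u \<Longrightarrow> u < n"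
  using signed_graph_edgeD[OF graph] by (auto simp: nbrs_def)

lemma self_N: "u < n \<Longrightarrow> u \<in> N u" using graph by (simp add: nbrs_def signed_graph_def)

lemma fin_N [simp]: "finite (N u)" by (rule finite_subset[of _ "{..<n}"]) (auto dest: N_less)

lemma fin_leaves [simp]: "finite (leaves i)" by (simp add: leaves_def)

lemma owner_less: "addr_owner n i < n" using n_pos by (simp add: addr_owner_def)
lemma index_less: "addr_index n i < n" using n_pos by (simp add: addr_index_def)

lemma div_less_n: "v < n \<Longrightarrow> v div c < n" using div_le_dividend le_less_trans by blast

lemma parent_components:
  "addr_level n (addr_parent n B i) = Suc (addr_level n i)"
  "addr_owner n (addr_parent n B i) = addr_owner n i"
  "addr_index n (addr_parent n B i) = addr_index n i div B"
  using owner_less div_less_n[OF index_less] by (simp_all add: addr_parent_def)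

lemma swap_components:
  "addr_level n (addr_swap n i) = 0"
  "addr_owner n (addr_swap n i) = addr_index n i"
  "addr_index n (addr_swap n i) = addr_owner n i"
  using owner_less index_less by (simp_all add: addr_swap_def)

lemma leaves_parent: "leaves i \<subseteq> leaves (addr_parent n B i)"
proof -
  have "v div (B * B ^ l) = v div B ^ l div B" for v l
    by (simp add: div_mult2_eq[symmetric] mult.commute)
  then show ?thesis by (auto simp: leaves_def parent_components)
qed

lemma child_exists:
  assumes "v \<in> leaves i" "addr_level n i = Suc t"
  obtains c where "addr_level n c = t" "v \<in> leaves c" "addr_parent n B c = i" "addr_owner n c = addr_owner n i"
proof -
  let ?c = "addr n t (addr_owner n i) (v div B ^ t)"
  have v: "v \<in> N (addr_owner n i)" "v div B ^ Suc t = addr_index n i" "v < n"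
    using assms N_less by (auto simp: leaves_def)
  note less = owner_less[of i] div_less_n[OF v(3), of "B ^ t"]
  have "addr_parent n B ?c = addr n (addr_level n i) (addr_owner n i) (v div B ^ t div B)"
    using less assms(2) by (simp add: addr_parent_def)
  also have "v div B ^ t div B = addr_index n i"
    using v by (simp add: div_mult2_eq[symmetric] mult.commute)
  finally have "addr_parent n B ?c = i" by (simp add: addr_eq)
  then show thesis using that[of ?c] less v by (simp add: leaves_def)
qed

lemma active_less: "active i \<Longrightarrow> i < num_machines T n"
  using addr_less_iff[OF n_pos, of i T] by (simp add: active_def)

sublocale tree_simulation T "addr_parent n B" "addr_swap n" "leaf_program n k" comb_program
  "upd_program n k" "scatter_words n" "num_machines T n" active "addr_level n"
  "\<lambda>i. vertex (addr_owner n i)" \<omega> "\<lambda>_. 0"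
proof
  show "T > 0" by (rule T_pos)
next
  fix i assume "active i" then show "i < num_machines T n" by (rule active_less)
next
  fix i assume "active i" then show "addr_level n i \<le> T" by (simp add: active_def)
next
  fix i assume "active i" "addr_level n i < T"
  then show "active (addr_parent n B i)"
    using leaves_parent[of i] by (auto simp: active_def parent_components)
next
  fix i show "addr_level n (addr_parent n B i) = Suc (addr_level n i)" by (rule parent_components)
next
  fix i show "vertex (addr_owner n (addr_parent n B i)) = vertex (addr_owner n i)"
    by (simp add: parent_components)
next
  fix i assume i: "active i" "addr_level n i = T"
  then obtain v where v: "v \<in> N (addr_owner n i)" "v div B ^ T = addr_index n i"
    by (auto simp: active_def leaves_def)
  then have "v < B ^ T" using N_less[OF v(1)] n_le by simp
  then have "addr_index n i = 0" using v by simp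
  then show "vertex (addr_owner n i) = i" using i addr_eq[of n i] by (simp add: vertex_def)
next
  fix i assume i: "active i" "0 < addr_level n i"
  then obtain t v where tv: "addr_level n i = Suc t" "v \<in> leaves i"
    by (auto simp: active_def gr0_conv_Suc)
  obtain c where c: "addr_level n c = t" "v \<in> leaves c" "addr_parent n B c = i"
    by (rule child_exists[OF tv(2,1)])
  then have "active c" "addr_level n c < T" using tv i by (auto simp: active_def)
  then show "\<exists>c. active c \<and> addr_level n c < T \<and> addr_parent n B c = i" using c by blast
next
  fix i assume i: "active i" "addr_level n i = 0"
  then have "addr_index n i \<in> N (addr_owner n i)" by (auto simp: active_def leaves_def)
  then have "addr_owner n i \<in> N (addr_index n i)" using nbrs_sym[of "addr_index n i"] by blast
  then show "active (addr_swap n i)" by (auto simp: active_def leaves_def swap_components)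
next
  fix i show "addr_level n (addr_swap n i) = 0" by (rule swap_components)
next
  fix i assume "addr_level n i = 0"
  then show "addr_swap n (addr_swap n i) = i"
    using addr_eq[of n i] by (simp add: addr_swap_def[of n "addr_swap n i"] swap_components)
next
  fix s i m y assume "(s::nat) > 0"
  then show "upd_program n k s i (\<lambda>_. 0) m y = upd_program n k s i (\<omega> i) m y"
    by (simp add: upd_program_def)
qed

lemma leaves_eq_UN_ch:
  assumes "active i" "0 < addr_level n i"
  shows "leaves i = (\<Union>c\<in>set (ch i). leaves c)"
proof
  obtain t where t: "addr_level n i = Suc t" using assms(2) by (auto simp: gr0_conv_Suc)
  show "leaves i \<subseteq> (\<Union>c\<in>set (ch i). leaves c)"
  proof
    fix v assume v: "v \<in> leaves i"
    obtain c where c: "addr_level n c = t" "v \<in> leaves c" "addr_parent n B c = i"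
      using child_exists[OF v t] by metis
    then have "active c" "addr_level n c < T" using t assms(1) by (auto simp: active_def)
    then show "v \<in> (\<Union>c\<in>set (ch i). leaves c)" using c by (auto simp: set_ch)
  qed
  show "(\<Union>c\<in>set (ch i). leaves c) \<subseteq> leaves i" using leaves_parent by (auto simp: set_ch)
qed

lemma ch_eqI:
  assumes "c \<in> set (ch i)" "c' \<in> set (ch i)" "addr_index n c = addr_index n c'"
  shows "c = c'"
proof -
  have "addr_parent n B c = i" "addr_parent n B c' = i" using assms by (auto simp: set_ch)
  then have "addr_level n c = addr_level n c'" "addr_owner n c = addr_owner n c'"
    using parent_components(1,2)[of c] parent_components(1,2)[of c'] by auto
  then have "addr n (addr_level n c) (addr_owner n c) (addr_index n c) =
      addr n (addr_level n c') (addr_owner n c') (addr_index n c')"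
    using assms(3) by simp
  then show ?thesis unfolding addr_eq .
qed

lemma leaves_disjoint:
  assumes "c \<in> set (ch i)" "c' \<in> set (ch i)" "c \<noteq> c'"
  shows "leaves c \<inter> leaves c' = {}"
proof -
  have "addr_parent n B c = i" "addr_parent n B c' = i" using assms by (auto simp: set_ch)
  then have "addr_level n c = addr_level n c'"
    using parent_components(1)[of c] parent_components(1)[of c'] by auto
  then show ?thesis using ch_eqI[OF assms(1,2)] assms(3) by (auto simp: leaves_def)
qed

text \<open>Siblings differ only in their index, which lies among the \<open>B\<close> numbers whose
  quotient by \<open>B\<close> is the index of the parent.\<close>

lemma length_ch_le: "length (ch i) \<le> B"
proof -
  have "length (ch i) = card (addr_index n ` set (ch i))"
    using ch_eqI[of _ i] by (subst card_image) (auto simp: inj_on_def distinct_card distinct_ch)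
  also have "addr_index n ` set (ch i) \<subseteq> {addr_index n i * B..<addr_index n i * B + B}"
  proof
    fix q assume "q \<in> addr_index n ` set (ch i)"
    then have "q div B = addr_index n i" using parent_components by (auto simp: set_ch)
    then have "q = addr_index n i * B + q mod B" by (metis div_mult_mod_eq)
    moreover have "q mod B < B" using B_pos by simp
    ultimately show "q \<in> {addr_index n i * B..<addr_index n i * B + B}" by simp
  qed
  then have "card (addr_index n ` set (ch i)) \<le> card {addr_index n i * B..<addr_index n i * B + B}"
    by (intro card_mono) auto
  finally show ?thesis by simp
qed

definition leaf_value :: "nat \<Rightarrow> nat \<Rightarrow> nat \<Rightarrow> nat list" where
  "leaf_value s u v = leaf_program n k s (addr n 0 u v) (x s (vertex u)) (x s (vertex v))"

text \<open>Induction on the level, as the leaf sets of the children partition that of the node. The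
  common length \<open>l\<close> matters because \<open>comb_program\<close> reads the number of
  coordinates off the first message.\<close>

lemma y_eq_aggregate:
  assumes len: "\<And>u v. v \<in> N u \<Longrightarrow> length (leaf_value s u v) = l"
  shows "active i \<Longrightarrow> y s i = map (\<lambda>j. aggregate s (\<lambda>v. leaf_value s (addr_owner n i) v ! j) (leaves i)) [0..<l]"
proof (induction "addr_level n i" arbitrary: i)
  case 0
  then have lv: "leaves i = {addr_index n i}" "addr_index n i \<in> N (addr_owner n i)"
    by (auto simp: active_def leaves_def)
  have "y s i = leaf_value s (addr_owner n i) (addr_index n i)"
    using 0(1) addr_eq[of n i] by (simp add: y_leaf leaf_value_def swap_components)
  also have "\<dots> = map (\<lambda>j. leaf_value s (addr_owner n i) (addr_index n i) ! j) [0..<l]"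
    using len[OF lv(2)] map_nth by metis
  finally show ?case by (simp add: lv(1) aggregate_singleton)
next
  case (Suc t)
  let ?f = "\<lambda>v j. leaf_value s (addr_owner n i) v ! j"
  have pos: "0 < addr_level n i" using Suc(2) by simp
  have IH: "y s c = map (\<lambda>j. aggregate s (\<lambda>v. ?f v j) (leaves c)) [0..<l]" if "c \<in> set (ch i)" for c
  proof -
    have c: "active c" "addr_parent n B c = i" using that by (auto simp: set_ch)
    then have "t = addr_level n c" "addr_owner n c = addr_owner n i"
      using Suc(2) parent_components[of c] by auto
    then show ?thesis using Suc(1)[of c] c by simp
  qed
  have ne: "ch i \<noteq> []" by (rule ch_nonempty[OF Suc(3) pos])
  have inj: "inj_on (\<lambda>c. c # y s c) (set (ch i))" by (auto simp: inj_on_def)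
  have hd: "length (hd (map (\<lambda>c. c # y s c) (ch i))) - 1 = l"
    using ne IH[of "hd (ch i)"] by (simp add: hd_map)
  have "y s i = comb_program s (map (\<lambda>c. c # y s c) (ch i))" by (rule y_inner[OF pos])
  also have "\<dots> = map (\<lambda>j. aggregate s (\<lambda>c. y s c ! j) (set (ch i))) [0..<l]"
    unfolding comb_program_def hd set_map aggregate_image[OF inj] by simp
  also have "\<dots> = map (\<lambda>j. aggregate s (\<lambda>v. ?f v j) (leaves i)) [0..<l]"
  proof (rule map_cong)
    fix j assume j: "j \<in> set [0..<l]"
    have "aggregate s (\<lambda>c. y s c ! j) (set (ch i)) = aggregate s (\<lambda>c. aggregate s (\<lambda>v. ?f v j) (leaves c)) (set (ch i))"
      using IH j by (auto simp: aggregate_def intro!: sum.cong arg_cong[of _ _ Min] image_cong)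
    also have "\<dots> = aggregate s (\<lambda>v. ?f v j) (\<Union>c\<in>set (ch i). leaves c)"
    proof (rule aggregate_UN[symmetric])
      show "finite (leaves c) \<and> leaves c \<noteq> {}" if "c \<in> set (ch i)" for c
        using that by (simp add: set_ch active_def)
      show "leaves c \<inter> leaves c' = {}" if "c \<in> set (ch i)" "c' \<in> set (ch i)" "c \<noteq> c'" for c c'
        by (rule leaves_disjoint[OF that])
    qed (use ne in simp_all)
    finally show "aggregate s (\<lambda>c. y s c ! j) (set (ch i)) = aggregate s (\<lambda>v. ?f v j) (leaves i)"
      using leaves_eq_UN_ch[OF Suc(3) pos] by simp
  qed simp
  finally show ?case .
qed

lemma vertex_components:
  assumes "u < n"
  shows "addr_level n (vertex u) = T" "addr_owner n (vertex u) = u" "addr_index n (vertex u) = 0"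
  using assms n_pos by (simp_all add: vertex_def)

lemma vertex_leaves: "u < n \<Longrightarrow> leaves (vertex u) = N u"
  using N_less n_le by (fastforce simp: leaves_def vertex_components)

lemma active_vertex: "u < n \<Longrightarrow> active (vertex u)"
  using self_N[of u] by (auto simp: active_def vertex_leaves vertex_components)

lemma x_Suc_vertex:
  assumes u: "u < n" and len: "\<And>u v. v \<in> N u \<Longrightarrow> length (leaf_value s u v) = l"
  shows "x (Suc s) (vertex u) = upd_program n k s (vertex u) (\<omega> (vertex u)) (x s (vertex u))
    (map (\<lambda>j. aggregate s (\<lambda>v. leaf_value s u v ! j) (N u)) [0..<l])"
  using x_root[of "vertex u" s] y_eq_aggregate[OF len active_vertex[OF u]] u
  by (simp add: vertex_components vertex_leaves del: x.simps)

end

section \<open>Labels obtained from least heavy vertices\<close>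

lemma Min_image_le:
  assumes "finite A" "a \<in> A" "f a \<le> c" shows "Min (f ` A) \<le> c"
  using assms by (meson Min_le finite_imageI imageI order_trans)

lemma Min_image_less:
  assumes "finite A" "A \<noteq> {}" "\<And>a. a \<in> A \<Longrightarrow> f a < c" shows "Min (f ` A) < c"
proof -
  have "Min (f ` A) \<in> f ` A" using assms by (intro Min_in) auto
  then obtain a where "a \<in> A" "Min (f ` A) = f a" by auto
  then show ?thesis using assms(3)[of a] by simp
qed

definition least_heavy :: "nat \<Rightarrow> nat set set \<Rightarrow> (nat \<Rightarrow> nat \<Rightarrow> bool) \<Rightarrow> nat \<Rightarrow> nat" where
  "least_heavy n E Ag y = Min ((\<lambda>v. if Ag y v \<and> heavy_vertex E Ag v then v else n) ` nbrs E y)"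

text \<open>For heavy \<open>u\<close> this is the least heavy vertex near \<open>u\<close>, reached
  through the common agreeing vertex in two steps; \<open>n\<close> stands for a missing
  candidate.\<close>

definition cluster_label :: "nat \<Rightarrow> nat set set \<Rightarrow> (nat \<Rightarrow> nat \<Rightarrow> bool) \<Rightarrow> nat \<Rightarrow> nat" where
  "cluster_label n E Ag u =
    (if heavy_vertex E Ag u then Min ((\<lambda>v. if Ag u v then least_heavy n E Ag v else n) ` nbrs E u)
     else n + u)"

locale agreement_nat = agreement "{..<n}" E Ag for n :: nat and E Ag
begin

lemma least_heavy_le:
  assumes "w \<in> agree y" "heavy w" shows "least_heavy n E Ag y \<le> w"
  unfolding least_heavy_def using assms by (intro Min_image_le[of _ w]) (auto simp: agreeing_def)

lemma least_heavy_less: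
  assumes "y < n" "least_heavy n E Ag y < n"
  shows "least_heavy n E Ag y \<in> agree y \<and> heavy (least_heavy n E Ag y)"
proof -
  have "least_heavy n E Ag y \<in> (\<lambda>v. if Ag y v \<and> heavy v then v else n) ` N y"
    unfolding least_heavy_def using self_N[of y] assms by (intro Min_in) auto
  then show ?thesis using assms by (auto simp: agreeing_def split: if_splits)
qed

lemma cluster_label_heavy:
  assumes "u < n" "heavy u"
  shows "heavy (cluster_label n E Ag u) \<and> near u (cluster_label n E Ag u) \<and> cluster_label n E Ag u < n"
    and "\<And>w. heavy w \<Longrightarrow> near u w \<Longrightarrow> cluster_label n E Ag u \<le> w"
proof -
  let ?f = "\<lambda>v. if Ag u v then least_heavy n E Ag v else n"
  have l: "cluster_label n E Ag u = Min (?f ` N u)" using assms by (simp add: cluster_label_def)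
  show le: "cluster_label n E Ag u \<le> w" if w: "heavy w" "near u w" for w
  proof -
    obtain y where y: "y \<in> agree u" "y \<in> agree w" using w by (auto simp: near_def)
    have "cluster_label n E Ag u \<le> ?f y"
      unfolding l using y by (intro Min_le) (auto simp: agreeing_def)
    also have "\<dots> \<le> w" using least_heavy_le[of w y] y agree_sym[of w y] w by (simp add: agreeing_def)
    finally show ?thesis .
  qed
  \<comment> \<open>\<open>u\<close> is itself a candidate, so the placeholder \<open>n\<close> is
    never the minimum.\<close>
  have "near u u" using self_agree[of u] assms by (auto simp: near_def)
  then have less: "cluster_label n E Ag u < n" using le[of u] assms by simp
  have "Min (?f ` N u) \<in> ?f ` N u" using self_N[of u] assms by (intro Min_in) auto
  then obtain y where y: "y \<in> agree u" "cluster_label n E Ag u = least_heavy n E Ag y"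
    using less unfolding l by (auto simp: agreeing_def split: if_splits)
  have "y < n" using y N_subset[of u] by (auto simp: agreeing_def)
  then show "heavy (cluster_label n E Ag u) \<and> near u (cluster_label n E Ag u) \<and> cluster_label n E Ag u < n"
    using least_heavy_less[of y] y less agree_sym[of "cluster_label n E Ag u" y] by (auto simp: near_def)
qed

text \<open>Nearness is an equivalence on the heavy vertices, so the least heavy vertex near
  \<open>u\<close> is a canonical representative of its class.\<close>

lemma cluster_label_eq_iff:
  assumes u: "u < n" and v: "v < n"
  shows "cluster_label n E Ag u = cluster_label n E Ag v \<longleftrightarrow> u = v \<or> heavy u \<and> heavy v \<and> near u v"
proof -
  have light: "n \<le> cluster_label n E Ag w" "cluster_label n E Ag w = n + w" if "\<not> heavy w" for w
    using that by (auto simp: cluster_label_def)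
  let ?l = "cluster_label n E Ag"
  consider "heavy u" "heavy v" | "\<not> heavy u" | "\<not> heavy v" by blast
  then show ?thesis
  proof cases
    case 1
    note hu = cluster_label_heavy[OF u 1(1)] and hv = cluster_label_heavy[OF v 1(2)]
    show ?thesis
    proof
      assume "?l u = ?l v"
      then show "u = v \<or> heavy u \<and> heavy v \<and> near u v"
        using near_trans[of u "?l u" v] near_sym[of v "?l v"] hu(1) hv(1) 1 u v by auto
    next
      assume "u = v \<or> heavy u \<and> heavy v \<and> near u v"
      moreover have "?l u = ?l v" if "near u v"
      proof (rule antisym)
        have "near u (?l v)" using near_trans[of u v "?l v"] hv(1) 1 u v that by auto
        then show "?l u \<le> ?l v" using hu(2) hv(1) by auto
        have "near v (?l u)" using near_trans[of v u "?l u"] hu(1) 1 u v near_sym[OF that] by auto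
        then show "?l v \<le> ?l u" using hv(2) hu(1) by auto
      qed
      ultimately show "?l u = ?l v" by blast
    qed
  next
    case 2
    then show ?thesis using light[of u] light[of v] cluster_label_heavy(1)[OF v] by fastforce
  next
    case 3
    then show ?thesis using light[of u] light[of v] cluster_label_heavy(1)[OF u] by fastforce
  qed
qed

lemma approximate_clustering_labels:
  "approximate_clustering 4254 {..<n} E
    ((\<lambda>l. {v \<in> {..<n}. cluster_label n E Ag v = l}) ` cluster_label n E Ag ` {..<n})"
  (is "approximate_clustering _ _ _ ?P")
proof (rule approximate_clustering_near_classes)
  show "partition_on {..<n} ?P" by (rule partition_onI) (auto simp: disjnt_def)
  fix u v assume "u \<in> {..<n}" "v \<in> {..<n}"
  then show "together ?P u v \<longleftrightarrow> u = v \<or> heavy u \<and> heavy v \<and> near u v"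
    using cluster_label_eq_iff[of u v] by (auto simp: together_def)
qed

end

section \<open>Values at the roots after each cycle\<close>

context clustering_network
begin

declare x.simps [simp del]

text \<open>Coins are indexed by machines, and those of the roots \<open>vertex v\<close> serve as
  the random words of the vertices.\<close>

definition sketch :: "nat \<Rightarrow> nat list" where
  "sketch u = map (\<lambda>c. Min ((\<lambda>v. \<omega> (vertex v) c) ` N u)) [0..<k]"

definition Ag :: "nat \<Rightarrow> nat \<Rightarrow> bool" where
  "Ag u v \<longleftrightarrow> sketches_agree k (sketch u) (sketch v)"

lemma Ag_iff_mismatches: "Ag u v \<longleftrightarrow> 25 * mismatches k (\<lambda>v. \<omega> (vertex v)) (N u) (N v) \<le> k"
proof -
  have "{c. c < k \<and> sketch u ! c \<noteq> sketch v ! c} =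
      {c. c < k \<and> Min ((\<lambda>v. \<omega> (vertex v) c) ` N u) \<noteq> Min ((\<lambda>v. \<omega> (vertex v) c) ` N v)}"
    by (auto simp: sketch_def)
  then show ?thesis by (simp add: Ag_def sketches_agree_def mismatches_def)
qed

lemma leaf_value_0: "leaf_value 0 u v = []" by (simp add: leaf_value_def leaf_program_def)

lemma x_1: "u < n \<Longrightarrow> x 1 (vertex u) = map (\<omega> (vertex u)) [0..<k]"
  using x_Suc_vertex[of u 0 0] by (simp add: leaf_value_0 upd_program_def)

lemma leaf_value_1: "v \<in> N u \<Longrightarrow> leaf_value 1 u v = map (\<omega> (vertex v)) [0..<k]"
  using N_less[of v u] x_1[of v] by (simp add: leaf_value_def leaf_program_def)

lemma x_2: "u < n \<Longrightarrow> x 2 (vertex u) = sketch u"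
proof -
  assume u: "u < n"
  have "x (Suc 1) (vertex u) = map (\<lambda>j. aggregate 1 (\<lambda>v. leaf_value 1 u v ! j) (N u)) [0..<k]"
    by (subst x_Suc_vertex[OF u, of 1 k]) (simp_all add: leaf_value_1[simplified] upd_program_def)
  also have "\<dots> = sketch u" unfolding sketch_def
  proof (rule map_cong)
    fix j assume j: "j \<in> set [0..<k]"
    show "aggregate 1 (\<lambda>v. leaf_value 1 u v ! j) (N u) = Min ((\<lambda>v. \<omega> (vertex v) j) ` N u)"
      unfolding aggregate_def using j leaf_value_1
      by (auto intro!: arg_cong[of _ _ Min] image_cong)
  qed simp
  finally show ?thesis by (simp add: numeral_2_eq_2)
qed

lemma leaf_value_2: "v \<in> N u \<Longrightarrow> leaf_value 2 u v = [of_bool (Ag u v), 1]"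
  using N_less[of v u] x_2[of u] x_2[of v] by (simp add: leaf_value_def leaf_program_def Ag_def)

text \<open>The leaves send pairs to be summed: the first components count the agreeing neighbours,
  the constant second components count all neighbours.\<close>

lemma x_3: "u < n \<Longrightarrow> x 3 (vertex u) = of_bool (heavy_vertex E Ag u) # sketch u"
proof -
  assume u: "u < n"
  have sum1: "(\<Sum>v\<in>N u. leaf_value 2 u v ! 0) = card (agreeing E Ag u)"
  proof -
    have "(\<Sum>v\<in>N u. leaf_value 2 u v ! 0) = (\<Sum>v\<in>N u. of_bool (Ag u v))"
      by (rule sum.cong) (auto simp: leaf_value_2)
    also have "\<dots> = card (N u \<inter> {v. Ag u v})" by (simp add: of_bool_def sum.If_cases)
    also have "N u \<inter> {v. Ag u v} = agreeing E Ag u" by (auto simp: agreeing_def)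
    finally show ?thesis .
  qed
  have sum2: "(\<Sum>v\<in>N u. leaf_value 2 u v ! 1) = card (N u)"
    using sum.cong[of "N u" "N u" "\<lambda>v. leaf_value 2 u v ! 1" "\<lambda>_. 1"] by (simp add: leaf_value_2)
  have "x (Suc 2) (vertex u) = upd_program n k 2 (vertex u) (\<omega> (vertex u)) (sketch u)
      (map (\<lambda>j. aggregate 2 (\<lambda>v. leaf_value 2 u v ! j) (N u)) [0..<2])"
    by (subst x_Suc_vertex[OF u, of 2 2]) (simp_all add: leaf_value_2 x_2 u)
  then show ?thesis using sum1 sum2
    by (simp add: upd_program_def aggregate_def heavy_vertex_def upt_rec numeral_3_eq_3 numeral_2_eq_2)
qed

lemma leaf_value_3:
  "v \<in> N u \<Longrightarrow> leaf_value 3 u v = [if Ag u v \<and> heavy_vertex E Ag v then v else n]"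
  using N_less[of v u] x_3[of u] x_3[of v] by (simp add: leaf_value_def leaf_program_def Ag_def)

lemma x_4:
  "u < n \<Longrightarrow> x 4 (vertex u) = of_bool (heavy_vertex E Ag u) # least_heavy n E Ag u # sketch u"
proof -
  assume u: "u < n"
  have eq: "(\<lambda>v. leaf_value 3 u v ! 0) ` N u = (\<lambda>v. if Ag u v \<and> heavy_vertex E Ag v then v else n) ` N u"
    by (rule image_cong) (auto simp: leaf_value_3)
  have "x (Suc 3) (vertex u) = upd_program n k 3 (vertex u) (\<omega> (vertex u))
      (of_bool (heavy_vertex E Ag u) # sketch u)
      (map (\<lambda>j. aggregate 3 (\<lambda>v. leaf_value 3 u v ! j) (N u)) [0..<1])"
    by (subst x_Suc_vertex[OF u, of 3 1]) (simp_all add: leaf_value_3 x_3 u)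
  then show ?thesis by (simp add: upd_program_def aggregate_def eq least_heavy_def)
qed

lemma leaf_value_4:
  "v \<in> N u \<Longrightarrow> leaf_value 4 u v = [if Ag u v then least_heavy n E Ag v else n]"
  using N_less[of v u] x_4[of u] x_4[of v] by (simp add: leaf_value_def leaf_program_def Ag_def)

lemma x_5: "u < n \<Longrightarrow> x 5 (vertex u) = [u, cluster_label n E Ag u]"
proof -
  assume u: "u < n"
  have eq: "(\<lambda>v. leaf_value 4 u v ! 0) ` N u = (\<lambda>v. if Ag u v then least_heavy n E Ag v else n) ` N u"
    by (rule image_cong) (auto simp: leaf_value_4)
  have "x (Suc 4) (vertex u) = upd_program n k 4 (vertex u) (\<omega> (vertex u))
      (of_bool (heavy_vertex E Ag u) # least_heavy n E Ag u # sketch u)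
      (map (\<lambda>j. aggregate 4 (\<lambda>v. leaf_value 4 u v ! j) (N u)) [0..<1])"
    by (subst x_Suc_vertex[OF u, of 4 1]) (simp_all add: leaf_value_4 x_4 u)
  then show ?thesis
    by (simp add: upd_program_def aggregate_def eq cluster_label_def vertex_components u)
qed

lemma leaf_value_ge_5: "s \<ge> 5 \<Longrightarrow> leaf_value s u v = []"
  by (simp add: leaf_value_def leaf_program_def)

lemma x_ge_6: "s \<ge> 5 \<Longrightarrow> u < n \<Longrightarrow> x (Suc s) (vertex u) = []"
  by (subst x_Suc_vertex[of u s 0]) (simp_all add: leaf_value_ge_5 upd_program_def)

lemma leaf_value_length:
  obtains l where "l \<le> k + 2" "\<And>u v. v \<in> N u \<Longrightarrow> length (leaf_value s u v) = l"
proof -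
  consider "s = 0" | "s = 1" | "s = 2" | "s = 3" | "s = 4" | "s \<ge> 5" by linarith
  then show thesis
    by cases (rule that[of 0] that[of k] that[of 2] that[of 1];
      simp add: leaf_value_0 leaf_value_1[simplified] leaf_value_2 leaf_value_3 leaf_value_4 leaf_value_ge_5; fail)+
qed

text \<open>The longest value occurs before cycle 4, when two words accompany the sketch.\<close>

lemma length_x_vertex:
  assumes u: "u < n" shows "length (x s (vertex u)) \<le> k + 2"
proof -
  consider "s = 0" | "s = 1" | "s = 2" | "s = 3" | "s = 4" | "s = 5" | "s \<ge> 6" by linarith
  then show ?thesis
  proof cases
    case 7
    then obtain r where "s = Suc r" "r \<ge> 5" by (cases s) auto
    then show ?thesis using x_ge_6 u by simp
  qed (simp_all add: u x_1[simplified] x_2 x_3 x_4 x_5 sketch_def x.simps(1))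
qed

lemma length_y: assumes "active i" shows "length (y s i) \<le> k + 2"
proof -
  obtain l where "l \<le> k + 2" "\<And>u v. v \<in> N u \<Longrightarrow> length (leaf_value s u v) = l"
    by (rule leaf_value_length[of s]) blast
  then show ?thesis using y_eq_aggregate[of s l i] assms by simp
qed

lemma least_heavy_le_n: "u < n \<Longrightarrow> least_heavy n E Ag u \<le> n"
  unfolding least_heavy_def using self_N[of u] by (intro Min_image_le[of _ u]) auto

lemma cluster_label_le: "u < n \<Longrightarrow> cluster_label n E Ag u \<le> 2 * n"
proof -
  assume u: "u < n"
  have "Min ((\<lambda>v. if Ag u v then least_heavy n E Ag v else n) ` N u) \<le> 2 * n"
    using self_N[OF u] least_heavy_le_n[OF u] by (intro Min_image_le[of _ u]) auto
  then show ?thesis using u by (simp add: cluster_label_def)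
qed

lemma sketch_less:
  assumes "\<And>i c. \<omega> i c < W" "u < n" shows "set (sketch u) \<subseteq> {..<W}"
proof -
  have "Min ((\<lambda>v. \<omega> (vertex v) c) ` N u) < W" for c
    using self_N[OF assms(2)] assms(1) by (intro Min_image_less) auto
  then show ?thesis by (auto simp: sketch_def)
qed

lemma x_vertex_less:
  assumes W: "\<And>i c. \<omega> i c < W" "2 * n + 2 \<le> W" and u: "u < n"
  shows "set (x s (vertex u)) \<subseteq> {..<W}"
proof -
  note sk = sketch_less[OF W(1) u]
  have less: "least_heavy n E Ag u < W" "cluster_label n E Ag u < W" "u < W"
    using least_heavy_le_n[OF u] cluster_label_le[OF u] u W by linarith+
  consider "s = 0" | "s = 1" | "s = 2" | "s = 3" | "s = 4" | "s = 5" | "s \<ge> 6" by linarith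
  then show ?thesis
  proof cases
    case 7
    then obtain r where "s = Suc r" "r \<ge> 5" by (cases s) auto
    then show ?thesis using x_ge_6 u by simp
  qed (use sk less W in \<open>auto simp: u x_1[simplified] x_2 x_3 x_4 x_5 x.simps(1)\<close>)
qed

text \<open>Minima inherit the bound of the leaf values. Sums occur only in cycle 2, where at most
  \<open>n\<close> summands of size at most 1 are added.\<close>

lemma y_less:
  assumes W: "\<And>i c. \<omega> i c < W" "2 * n + 2 \<le> W" and act: "active i"
  shows "set (y s i) \<subseteq> {..<W}"
proof -
  obtain l where l: "l \<le> k + 2" "\<And>u v. v \<in> N u \<Longrightarrow> length (leaf_value s u v) = l"
    by (rule leaf_value_length[of s]) blast
  let ?u = "addr_owner n i"
  have lv: "leaves i \<subseteq> N ?u" "leaves i \<noteq> {}" using act by (auto simp: leaves_def active_def)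
  have le: "leaf_value s ?u v ! j \<le> (if s = 1 then W - 1 else n)" "s = 2 \<Longrightarrow> leaf_value s ?u v ! j \<le> 1"
    if v: "v \<in> leaves i" and j: "j < l" for v j
  proof -
    have vN: "v \<in> N ?u" "v < n" using v lv N_less by auto
    have len: "length (leaf_value s ?u v) = l" by (rule l(2)[OF vN(1)])
    consider "s = 0" | "s = 1" | "s = 2" | "s = 3" | "s = 4" | "s \<ge> 5" by linarith
    then have "leaf_value s ?u v ! j \<le> (if s = 1 then W - 1 else n) \<and> (s = 2 \<longrightarrow> leaf_value s ?u v ! j \<le> 1)"
    proof cases
      case 2
      have "\<omega> (vertex v) j \<le> W - 1" using W(1)[of "vertex v" j] by simp
      moreover have "j < k" using len j leaf_value_1[OF vN(1)] 2 by simp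
      then have "leaf_value 1 ?u v ! j = \<omega> (vertex v) j" by (simp only: leaf_value_1[OF vN(1)]) simp
      ultimately show ?thesis using 2 by simp
    next
      case 3
      note lv2 = leaf_value_2[OF vN(1)]
      have "j = 0 \<or> j = 1" using 3 len j lv2 by auto
      then show ?thesis using 3 n_pos lv2 by auto
    qed (use len j vN least_heavy_le_n[OF vN(2)] in
        \<open>auto simp: leaf_value_0 leaf_value_3 leaf_value_4 leaf_value_ge_5\<close>)
    then show "leaf_value s ?u v ! j \<le> (if s = 1 then W - 1 else n)"
      "s = 2 \<Longrightarrow> leaf_value s ?u v ! j \<le> 1" by blast+
  qed
  have "aggregate s (\<lambda>v. leaf_value s ?u v ! j) (leaves i) < W" if j: "j < l" for j
  proof (cases "s = 2")
    case True
    have "(\<Sum>v\<in>leaves i. leaf_value s ?u v ! j) \<le> (\<Sum>v\<in>leaves i. 1)"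
      using le(2)[OF _ j True] by (rule sum_mono)
    also have "\<dots> = card (leaves i)" by simp
    also have "\<dots> \<le> card {..<n}" using lv N_less by (intro card_mono) auto
    finally show ?thesis using W True by (simp add: aggregate_def)
  next
    case False
    let ?f = "\<lambda>v. leaf_value s ?u v ! j"
    have "Min (?f ` leaves i) \<in> ?f ` leaves i" using lv by (intro Min_in) auto
    then obtain v where "v \<in> leaves i" "Min (?f ` leaves i) = ?f v" by auto
    then show ?thesis using le(1)[OF _ j, of v] W(2) False by (simp add: aggregate_def split: if_splits)
  qed
  then show ?thesis using y_eq_aggregate[of s l i] l act by auto
qed

end

section \<open>Scattering the input and memory bounds\<close>

context clustering_network
begin

abbreviation M where "M \<equiv> num_machines T n"

definition spread :: "(nat \<Rightarrow> (nat \<times> nat) list) \<Rightarrow> bool" where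
  "spread inp \<longleftrightarrow> (let es = map (\<lambda>(u, v). {u, v}) (concat (map inp [0..<M]))
    in distinct es \<and> set es = E)"

text \<open>An edge addresses the leaves of both orientations and a loop its single leaf, so
  distinct edges address disjoint sets of leaves. Hence each leaf is woken exactly once, whichever
  orientations the input uses.\<close>

lemma scatter_distinct:
  assumes "distinct (map (\<lambda>(u, v). {u, v}) ps)" "\<And>u v. (u, v) \<in> set ps \<Longrightarrow> u < n \<and> v < n"
  shows "distinct (concat (map (edge_leaves n) ps)) \<and>
    set (concat (map (edge_leaves n) ps)) = {addr n 0 u v | u v. {u, v} \<in> (\<lambda>(u, v). {u, v}) ` set ps}"
  using assms
proof (induction ps)
  case (Cons p ps)
  obtain u v where p: "p = (u, v)" by (cases p)
  have uv: "u < n" "v < n" using Cons.prems(2)[of u v] p by auto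
  have less: "a < n \<and> b < n" if "{a, b} \<in> (\<lambda>(u, v). {u, v}) ` set ps" for a b
    using that Cons.prems(2) by (fastforce simp: doubleton_eq_iff)
  have "distinct (concat (map (edge_leaves n) ps)) \<and>
      set (concat (map (edge_leaves n) ps)) = {addr n 0 u v | u v. {u, v} \<in> (\<lambda>(u, v). {u, v}) ` set ps}"
    by (rule Cons.IH) (use Cons.prems in auto)
  note IH = conjunct1[OF this] conjunct2[OF this]
  have new: "{u, v} \<notin> (\<lambda>(u, v). {u, v}) ` set ps" using Cons.prems(1) unfolding p by simp
  have notin: "addr n 0 a b \<notin> set (concat (map (edge_leaves n) ps))"
    if ab: "a < n" "b < n" "{a, b} = {u, v}" for a b
  proof (rule notI)
    assume "addr n 0 a b \<in> set (concat (map (edge_leaves n) ps))"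
    then obtain a' b' where *: "addr n 0 a b = addr n 0 a' b'" "{a', b'} \<in> (\<lambda>(u, v). {u, v}) ` set ps"
      unfolding IH(2) mem_Collect_eq by (elim exE conjE)
    then have "a = a' \<and> b = b'" using addr_inject[of a n b a' b' 0 0] ab(1,2) less[OF *(2)] by simp
    then show False using *(2) ab(3) new by simp
  qed
  have "distinct (edge_leaves n p)" using uv addr_inject[OF uv uv(2,1)] p by (auto simp: edge_leaves_def)
  then have 1: "distinct (concat (map (edge_leaves n) (p # ps)))"
    using IH(1) notin[of u v] notin[of v u] uv p by (auto simp: edge_leaves_def insert_commute)
  have "set (edge_leaves n p) = {addr n 0 a b | a b. {a, b} = {u, v}}"
    using p by (auto simp: edge_leaves_def doubleton_eq_iff)
  then have 2: "set (concat (map (edge_leaves n) (p # ps))) =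
      {addr n 0 a b | a b. {a, b} = {u, v}} \<union> {addr n 0 u v | u v. {u, v} \<in> (\<lambda>(u, v). {u, v}) ` set ps}"
    using IH(2) by simp
  also have "\<dots> = {addr n 0 u v | u v. {u, v} \<in> (\<lambda>(u, v). {u, v}) ` set (p # ps)}"
  proof -
    have img: "(\<lambda>(u, v). {u, v}) ` set (p # ps) = insert {u, v} ((\<lambda>(u, v). {u, v}) ` set ps)"
      unfolding p by simp
    show ?thesis
      unfolding img by (simp only: insert_iff conj_disj_distribL ex_disj_distrib Collect_disj_eq)
  qed
  finally show ?case using 1 by blast
qed auto

lemma active_leaf_iff: "active j \<and> addr_level n j = 0 \<longleftrightarrow> (\<exists>u v. v \<in> N u \<and> j = addr n 0 u v)"
proof
  assume "active j \<and> addr_level n j = 0"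
  then have "addr_index n j \<in> N (addr_owner n j)" "j = addr n 0 (addr_owner n j) (addr_index n j)"
    using addr_eq[of n j] by (auto simp: active_def leaves_def)
  then show "\<exists>u v. v \<in> N u \<and> j = addr n 0 u v" by blast
next
  assume "\<exists>u v. v \<in> N u \<and> j = addr n 0 u v"
  then obtain u v where "v \<in> N u" "j = addr n 0 u v" by blast
  moreover from this have "u < n" "v < n" using N_less by auto
  ultimately show "active j \<and> addr_level n j = 0" by (auto simp: active_def leaves_def)
qed

context
  fixes inp :: "nat \<Rightarrow> (nat \<times> nat) list"
  assumes spread: "spread inp"
begin

abbreviation input_pairs where "input_pairs \<equiv> concat (map inp [0..<M])"

lemma input_pairs: "distinct (map (\<lambda>(u, v). {u, v}) input_pairs)" "(\<lambda>(u, v). {u, v}) ` set input_pairs = E"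
  using spread by (auto simp: spread_def Let_def)

lemma input_pairs_less: "(u, v) \<in> set input_pairs \<Longrightarrow> u < n \<and> v < n"
proof -
  assume "(u, v) \<in> set input_pairs"
  then have "{u, v} \<in> E" unfolding input_pairs(2)[symmetric] by (rule rev_image_eqI) simp
  then show ?thesis using signed_graph_edgeD[OF graph] by auto
qed

lemma scatter_input:
  "distinct (concat (map (edge_leaves n) input_pairs))"
  "set (concat (map (edge_leaves n) input_pairs)) = {j. active j \<and> addr_level n j = 0}"
  using scatter_distinct[OF input_pairs(1) input_pairs_less]
  unfolding active_leaf_iff input_pairs(2) nbrs_def by auto

lemma card_edges: "card E = length input_pairs"
  using distinct_card[OF input_pairs(1)] input_pairs(2) by simp

lemma sum_input_length: "(\<Sum>i<M. length (encode_pairs (inp i))) = 2 * card E"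
proof -
  have enc: "length (encode_pairs ps) = 2 * length ps" for ps
    by (induction ps) (auto simp: encode_pairs_def)
  have "length input_pairs = (\<Sum>i\<leftarrow>[0..<M]. length (inp i))" by (simp add: length_concat o_def)
  also have "\<dots> = (\<Sum>i<M. length (inp i))" by (simp add: sum_list_distinct_conv_sum_set atLeast0LessThan)
  finally show ?thesis by (simp add: enc card_edges sum_distrib_left)
qed

lemma scattered_input: "scattered (initial_profile inp)"
  unfolding scattered_def
proof (intro allI impI)
  fix j assume "j < M"
  let ?a = "prof (initial_profile inp) (Suc 0)"
  have a: "snd (?a i) = map (\<lambda>d. (d, [])) (concat (map (edge_leaves n) (inp i)))" if "i < M" for i
    using that by (simp add: prof_def step_def initial_profile_def scatter_words_encode_pairs)
  have "inbox M ?a j = concat (map (\<lambda>i. map (\<lambda>_. []) (filter (\<lambda>d. d = j) (concat (map (edge_leaves n) (inp i))))) [0..<M])"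
    unfolding inbox_def by (intro arg_cong[of _ _ concat] map_cong) (simp_all add: a filter_map o_def)
  also have "\<dots> = map (\<lambda>_. []) (filter (\<lambda>d. d = j) (concat (map (edge_leaves n) input_pairs)))"
  proof -
    have "concat (map (\<lambda>i. map g (filter Q (concat (map e (inp i))))) xs)
      = map g (filter Q (concat (map e (concat (map inp xs)))))"
      for g :: "nat \<Rightarrow> nat list" and Q and e :: "nat \<times> nat \<Rightarrow> nat list" and xs
      by (induction xs) auto
    then show ?thesis .
  qed
  also have "\<dots> = (if active j \<and> addr_level n j = 0 then [[]] else [])"
    unfolding filter_eq_distinct[OF scatter_input(1)] scatter_input(2) by simp
  finally show "inbox M (prof (initial_profile inp) 1) j =
    (if active j \<and> addr_level n j = 0 then [[]] else [])" by simp
qed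

text \<open>An active node is determined by its level and any one leaf below it, and an edge has at
  most two leaves.\<close>

lemma card_active_le: "card {i. active i} \<le> Suc T * (2 * card E)"
proof -
  let ?L = "set (concat (map (edge_leaves n) input_pairs))"
  let ?g = "\<lambda>(t, i). addr n t (addr_owner n i) (addr_index n i div B ^ t)"
  have "{i. active i} \<subseteq> ?g ` ({..T} \<times> ?L)"
  proof
    fix i assume "i \<in> {i. active i}"
    then obtain v where v: "v \<in> N (addr_owner n i)" "v div B ^ addr_level n i = addr_index n i"
      and lev: "addr_level n i \<le> T" by (auto simp: active_def leaves_def)
    have "addr n 0 (addr_owner n i) v \<in> ?L" unfolding scatter_input(2) mem_Collect_eq active_leaf_iff using v by blast
    moreover have "i = ?g (addr_level n i, addr n 0 (addr_owner n i) v)"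
      using v N_less[OF v(1)] addr_eq[of n i] by simp
    ultimately show "i \<in> ?g ` ({..T} \<times> ?L)" using lev by blast
  qed
  then have "card {i. active i} \<le> card (?g ` ({..T} \<times> ?L))" by (intro card_mono) auto
  also have "\<dots> \<le> card ({..T} \<times> ?L)" by (intro card_image_le) auto
  also have "\<dots> = Suc T * card ?L" by (simp only: card_cartesian_product card_atMost)
  also have "\<dots> \<le> Suc T * (2 * card E)"
  proof (rule mult_le_mono2)
    have "card ?L \<le> length (concat (map (edge_leaves n) input_pairs))" by (rule card_length)
    also have "\<dots> \<le> 2 * length input_pairs"
    proof -
      have "length (concat (map (edge_leaves n) ps)) \<le> 2 * length ps" for ps
        by (induction ps) (auto simp: edge_leaves_def)
      then show ?thesis .
    qed
    finally show "card ?L \<le> 2 * card E" by (simp only: card_edges)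
  qed
  finally show ?thesis .
qed

text \<open>The child lists of different nodes are disjoint sets of active nodes, because the parent
  is a function of the child.\<close>

lemma sum_children_le: "(\<Sum>i | active i. 1 + length (ch i)) \<le> 2 * card {i. active i}"
proof -
  have fin: "finite {i. active i}" by (rule finite_subset[of _ "{..<M}"]) (auto dest: active_less)
  have "(\<Sum>i | active i. length (ch i)) = (\<Sum>i | active i. card (set (ch i)))"
    by (simp add: distinct_card distinct_ch)
  also have "\<dots> = card (\<Union>i\<in>{i. active i}. set (ch i))"
    using fin by (intro card_UN_disjoint[symmetric]) (auto simp: set_ch)
  also have "\<dots> \<le> card {i. active i}" using fin by (intro card_mono) (auto simp: set_ch)
  finally show ?thesis using fin by (simp add: sum_Suc)
qed

lemma usage_0: "memory_usage M (prof (initial_profile inp) 0) i = length (encode_pairs (inp i))"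
proof -
  have "inbox M (initial_profile inp) i = []" by (simp add: inbox_def initial_profile_def)
  then show ?thesis by (simp add: memory_usage_def prof_def initial_profile_def payloads_size_def)
qed

text \<open>An edge occupies two words and causes at most two messages with empty payload, one word
  each. The input itself is dropped in this round, so scattering needs no extra room.\<close>

lemma usage_1:
  assumes "i < M"
  shows "memory_usage M (prof (initial_profile inp) 1) i \<le> max (length (encode_pairs (inp i))) (if active i then 1 else 0)"
proof -
  let ?a = "prof (initial_profile inp) (Suc 0)"
  have a: "?a i = ([], map (\<lambda>d. (d, [])) (concat (map (edge_leaves n) (inp i))))"
    using assms by (simp add: prof_def step_def initial_profile_def scatter_words_encode_pairs)
  have "payloads_size (map snd (snd (?a i))) = length (concat (map (edge_leaves n) (inp i)))"
    unfolding a by (simp add: payloads_size_def o_def sum_list_triv)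
  also have "\<dots> \<le> length (encode_pairs (inp i))"
  proof -
    have "length (concat (map (edge_leaves n) ps)) \<le> length (encode_pairs ps)" for ps
      by (induction ps) (auto simp: edge_leaves_def encode_pairs_def)
    then show ?thesis .
  qed
  finally have "payloads_size (map snd (snd (?a i))) \<le> length (encode_pairs (inp i))" .
  moreover have "payloads_size (inbox M ?a i) \<le> (if active i then 1 else 0)"
    using scattered_input assms by (auto simp: scattered_def payloads_size_def)
  ultimately show ?thesis by (auto simp: memory_usage_def a)
qed

lemma usage_Suc_Suc:
  assumes "i < M"
  shows "memory_usage M (prof (initial_profile inp) (Suc (Suc q))) i
    \<le> (if active i then (1 + length (ch i)) * (2 * k + 7) else 0)"
proof -
  have "memory_usage M (prof (initial_profile inp) (Suc (Suc q))) i
    \<le> (if active i then (1 + length (ch i)) * (2 * (k + 2) + 3) else 0)"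
    by (rule memory_usage_prof_le[OF scattered_input assms])
      (rule length_x_vertex[OF owner_less] length_y; assumption)+
  also have "2 * (k + 2) + 3 = 2 * k + 7" by simp
  finally show ?thesis .
qed

lemma usage_le:
  assumes i: "i < M"
  shows "memory_usage M (prof (initial_profile inp) q) i
    \<le> length (encode_pairs (inp i)) + (if active i then (1 + length (ch i)) * (2 * k + 7) else 0)"
proof -
  consider "q = 0" | "q = 1" | r where "q = Suc (Suc r)" by (metis One_nat_def not0_implies_Suc)
  then show ?thesis
  proof cases
    case 2
    have "memory_usage M (prof (initial_profile inp) q) i \<le> length (encode_pairs (inp i)) + (if active i then 1 else 0)"
      using usage_1[OF i] unfolding 2 by (auto split: if_splits)
    then show ?thesis by (auto split: if_splits)
  next
    case (3 r)
    then show ?thesis using usage_Suc_Suc[OF i, of r] by simp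
  qed (simp add: usage_0)
qed

text \<open>After the scattering round the input is gone; hence the memory has to suffice for the
  input and for the tree separately, not for their sum.\<close>

lemma usage_le_machine_memory:
  assumes i: "i < M" and S: "length (encode_pairs (inp i)) \<le> S" "(1 + B) * (2 * k + 7) \<le> S"
  shows "memory_usage M (prof (initial_profile inp) q) i \<le> S"
proof -
  have "1 \<le> S" using S(2) by (cases S) auto
  consider "q = 0" | "q = 1" | r where "q = Suc (Suc r)" by (metis One_nat_def not0_implies_Suc)
  then show ?thesis
  proof cases
    case 2
    then show ?thesis using usage_1[OF i] S(1) \<open>1 \<le> S\<close> by (auto split: if_splits)
  next
    case (3 r)
    have "(1 + length (ch i)) * (2 * k + 7) \<le> (1 + B) * (2 * k + 7)"
      using length_ch_le[of i] by (intro mult_le_mono) auto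
    then have "(if active i then (1 + length (ch i)) * (2 * k + 7) else 0) \<le> S"
      using S(2) by (simp only: split: if_split) (meson order_trans zero_le)
    then show ?thesis unfolding 3 using usage_Suc_Suc[OF i, of r] by (rule order_trans[rotated])
  qed (use S usage_0 in simp)
qed

lemma total_memory_prof_le:
  assumes "h \<noteq> []" "set h \<subseteq> range (prof (initial_profile inp))"
  shows "total_memory M h \<le> 2 * card E + (2 * k + 7) * (4 * Suc T * card E)"
proof -
  let ?c = "\<lambda>i. if active i then (1 + length (ch i)) * (2 * k + 7) else 0"
  have "total_memory M h \<le> (\<Sum>i<M. length (encode_pairs (inp i)) + ?c i)"
    unfolding total_memory_def
  proof (rule sum_mono)
    fix i assume "i \<in> {..<M}"
    then show "Max ((\<lambda>a. memory_usage M a i) ` set h) \<le> length (encode_pairs (inp i)) + ?c i"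
      using assms usage_le[of i] by (intro Max.boundedI) auto
  qed
  also have "\<dots> = 2 * card E + (\<Sum>i<M. ?c i)" by (simp add: sum.distrib sum_input_length)
  also have "(\<Sum>i<M. ?c i) = (\<Sum>i | active i. (1 + length (ch i)) * (2 * k + 7))"
    using active_less by (intro sum.mono_neutral_cong_right) auto
  also have "\<dots> = (2 * k + 7) * (\<Sum>i | active i. 1 + length (ch i))"
    by (simp add: sum_distrib_left mult.commute)
  also have "\<dots> \<le> (2 * k + 7) * (4 * Suc T * card E)"
  proof (rule mult_le_mono2)
    have "2 * card {i. active i} \<le> 2 * (Suc T * (2 * card E))"
      by (rule mult_le_mono2[OF card_active_le])
    then show "(\<Sum>i | active i. 1 + length (ch i)) \<le> 4 * Suc T * card E"
      using sum_children_le by (simp add: algebra_simps)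
  qed
  finally show ?thesis by simp
qed

lemma words_below_prof_input:
  assumes W: "\<And>i c. \<omega> i c < W" "2 * n + 2 \<le> W" "M \<le> W"
  shows "words_below W M (prof (initial_profile inp) q)"
proof -
  have edge: "u < n \<and> v < n" if "i < M" "(u, v) \<in> set (inp i)" for i u v
  proof -
    have "(u, v) \<in> set input_pairs" using that by auto
    then show ?thesis by (rule input_pairs_less)
  qed
  consider "q = 0" | "q = 1" | r where "q = Suc (Suc r)" by (metis One_nat_def not0_implies_Suc)
  then show ?thesis
  proof cases
    case 1
    have "set (encode_pairs (inp i)) \<subseteq> {..<W}" if "i < M" for i
      using edge[OF that] W by (fastforce simp: encode_pairs_def)
    then show ?thesis using 1 by (simp add: words_below_def prof_def initial_profile_def)
  next
    case 2
    have "d < M" if "i < M" "d \<in> set (concat (map (edge_leaves n) (inp i)))" for i d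
    proof -
      have "d \<in> set (concat (map (edge_leaves n) input_pairs))" using that by auto
      then show ?thesis unfolding scatter_input(2) using active_less by auto
    qed
    then show ?thesis using 2
      by (auto simp: words_below_def prof_def step_def initial_profile_def scatter_words_encode_pairs)
  next
    case (3 r)
    show ?thesis unfolding 3
      by (rule words_below_prof[OF scattered_input W(3)])
        (rule x_vertex_less[OF W(1,2) owner_less] y_less[OF W(1,2)]; assumption)+
  qed
qed

text \<open>After the last cycle the leaves hold the pair of their root as well. Repeated pairs
  leave the set \<open>lab\<close> unchanged, so the leaves need no cleaning.\<close>

lemma outputs_labels:
  "outputs_clustering M (prof (initial_profile inp) (Suc (5 * (2 * T + 1))))
    ((\<lambda>l. {v \<in> {..<n}. cluster_label n E Ag v = l}) ` cluster_label n E Ag ` {..<n})"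
proof -
  define out where "out i = (if active i \<and> (addr_level n i = T \<or> addr_level n i = 0)
    then [(addr_owner n i, cluster_label n E Ag (addr_owner n i))] else [])" for i
  define lab where "lab = (\<Union>i<M. set (out i))"
  have lab: "lab = (\<lambda>u. (u, cluster_label n E Ag u)) ` {..<n}"
  proof
    show "lab \<subseteq> (\<lambda>u. (u, cluster_label n E Ag u)) ` {..<n}"
      using owner_less by (auto simp: lab_def out_def)
    show "(\<lambda>u. (u, cluster_label n E Ag u)) ` {..<n} \<subseteq> lab"
    proof
      fix p assume "p \<in> (\<lambda>u. (u, cluster_label n E Ag u)) ` {..<n}"
      then obtain u where u: "u < n" "p = (u, cluster_label n E Ag u)" by auto
      have "p \<in> set (out (vertex u))" using u active_vertex[of u] by (simp add: out_def vertex_components)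
      then show "p \<in> lab" unfolding lab_def using active_less[OF active_vertex[OF u(1)]] by blast
    qed
  qed
  show ?thesis unfolding outputs_clustering_def
  proof (intro exI[of _ out] conjI allI impI)
    fix i assume "i < M"
    then show "fst (prof (initial_profile inp) (Suc (5 * (2 * T + 1))) i) = encode_pairs (out i)"
      unfolding prof_cycle_end[OF scattered_input \<open>i < M\<close>]
      using x_5[OF owner_less, of i] by (simp add: out_def encode_pairs_def)
  next
    show "let lab = \<Union>i<M. set (out i)
      in (\<lambda>l. {v \<in> {..<n}. cluster_label n E Ag v = l}) ` cluster_label n E Ag ` {..<n} =
        (\<lambda>l. {v. (v, l) \<in> lab}) ` snd ` lab"
      unfolding lab_def[symmetric] Let_def lab image_image
      by (intro image_cong) auto
  qed
qed

end

end

section \<open>Correctness and resources of the assembled algorithm\<close>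

context clustering_network
begin

lemma vertex_inj: "inj_on vertex {..<n}"
  using addr_inject n_pos by (auto simp: inj_on_def vertex_def)

lemma mismatches_vertex:
  "mismatches k (\<lambda>v. \<omega> (vertex v)) A C = mismatches k \<omega> (vertex ` A) (vertex ` C)"
  by (simp add: mismatches_def image_image)

text \<open>The probability estimates concern sets of machines. Since \<open>vertex\<close> is
  injective, passing to images keeps all cardinalities, and not being misjudged is exactly the pair
  of threshold conditions on \<open>Ag\<close>.\<close>

lemma agreement_if_not_misjudged:
  assumes "\<And>u v. u < n \<Longrightarrow> v < n \<Longrightarrow> \<not> misjudged k \<omega> (vertex ` N u) (vertex ` N v)"
  shows "agreement_nat n E Ag"
proof -
  have sub: "N u \<subseteq> {..<n}" for u using N_less by auto
  have card_eq: "card (vertex ` N u) = card (N u)" for u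
    using inj_on_subset[OF vertex_inj sub] by (rule card_image)
  have "sym_diff (vertex ` N u) (vertex ` N v) = vertex ` sym_diff (N u) (N v)" for u v
    using inj_on_image_set_diff[OF vertex_inj] sub by (auto simp: image_Un)
  moreover have "card (vertex ` sym_diff (N u) (N v)) = card (sym_diff (N u) (N v))" for u v
    by (rule card_image[OF inj_on_subset[OF vertex_inj]]) (use sub in auto)
  ultimately have card_diff: "card (sym_diff (vertex ` N u) (vertex ` N v)) = card (sym_diff (N u) (N v))" for u v
    by simp
  have judged: "if Ag u v then 10 * card (sym_diff (N u) (N v)) \<le> card (N u)
      else card (N u) \<le> 50 * card (sym_diff (N u) (N v))" if "u < n" "v < n" for u v
    using assms[OF that] unfolding misjudged_def Ag_iff_mismatches mismatches_vertex card_eq card_diff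
    by (auto split: if_splits)
  show ?thesis
  proof
    show "signed_graph {..<n} E" by (rule graph)
    show "Ag u u" for u by (simp add: Ag_def sketches_agree_def)
    show "Ag v u" if "Ag u v" for u v
      using that by (simp add: Ag_def sketches_agree_def eq_commute)
    show "10 * card (sym_diff (N u) (N v)) \<le> card (N u)" if "u \<in> {..<n}" "v \<in> {..<n}" "Ag u v" for u v
      using judged[of u v] that by simp
    show "card (N u) \<le> 50 * card (sym_diff (N u) (N v))" if "u \<in> {..<n}" "v \<in> {..<n}" "\<not> Ag u v" for u v
      using judged[of u v] that by simp
  qed
qed

end

abbreviation clustering_step ::
    "nat \<Rightarrow> nat \<Rightarrow> nat \<Rightarrow> nat \<Rightarrow> nat \<Rightarrow> nat \<Rightarrow> (nat \<Rightarrow> nat) \<Rightarrow> nat list \<Rightarrow> nat list list \<Rightarrow> nat list \<times> message list" where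
  "clustering_step T b l n \<equiv> tree_program.step T (addr_parent n b) (addr_swap n) (leaf_program n l)
    comb_program (upd_program n l) (scatter_words n)"

definition clustering_algorithm :: "nat \<Rightarrow> (nat \<Rightarrow> nat) \<Rightarrow> (nat \<Rightarrow> nat) \<Rightarrow> (nat \<Rightarrow> nat) \<Rightarrow> mpc_algorithm" where
  "clustering_algorithm T B k W =
    \<lparr>machines = num_machines T,
     machine_memory = (\<lambda>n. (1 + B n) * (2 * k n + 7)),
     rounds = (\<lambda>n. Suc (5 * (2 * T + 1))),
     local_step = (\<lambda>n r i m ib. map_pmf
       (\<lambda>w. clustering_step T (B n) (k n) n r i w m ib)
       (if r = Suc T then Pi_pmf {..<k n} 0 (\<lambda>_. uniform_below (W n)) else return_pmf (\<lambda>_. 0)))\<rparr>"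

lemma execution_clustering_algorithm:
  "execution (clustering_algorithm T B k W) n inp =
    map_pmf (\<lambda>\<omega>. map (run (num_machines T n)
        (\<lambda>r i. clustering_step T (B n) (k n) n r i (if r = Suc T then \<omega> i else (\<lambda>_. 0)))
        (initial_profile inp)) [0..<Suc (Suc (5 * (2 * T + 1)))])
      (Pi_pmf {..<num_machines T n} (\<lambda>_. 0) (\<lambda>_. Pi_pmf {..<k n} 0 (\<lambda>_. uniform_below (W n))))"
proof -
  let ?A = "clustering_algorithm T B k W"
  have r: "rounds ?A n = Suc (5 * (2 * T + 1))" by (simp add: clustering_algorithm_def)
  show ?thesis unfolding execution_def r
    by (rule history_eq_run[where step = "clustering_step T (B n) (k n) n"])
      (simp_all add: clustering_algorithm_def)
qed

text \<open>One edge per machine: there are at least \<open>n * n\<close> machines, and each has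
  room for two words. This keeps the quantification over all distributions from being
  vacuous.\<close>

lemma input_distribution_exists:
  assumes G: "signed_graph {..<n} E" and n: "n > 0"
  shows "\<exists>inp. input_distribution (clustering_algorithm T B k W) n E inp"
proof -
  have sub: "E \<subseteq> (\<lambda>(u, v). {u, v}) ` ({..<n} \<times> {..<n})"
  proof
    fix e assume "e \<in> E"
    then have "e \<in> {{u, v} | u v. u \<in> {..<n} \<and> v \<in> {..<n}}" using G unfolding signed_graph_def by blast
    then obtain u v where uv: "e = {u, v}" "u < n" "v < n" unfolding mem_Collect_eq by (elim exE conjE) simp
    then show "e \<in> (\<lambda>(u, v). {u, v}) ` ({..<n} \<times> {..<n})" by (intro image_eqI[of _ _ "(u, v)"]) simp_all
  qed
  then have finE: "finite E" by (rule finite_subset) auto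
  have "card E \<le> card ((\<lambda>(u, v). {u, v}) ` ({..<n} \<times> {..<n}))" using sub by (intro card_mono) auto
  also have "\<dots> \<le> n * n"
    using card_image_le[of "{..<n} \<times> {..<n}" "\<lambda>(u, v). {u, v}"] by (simp add: card_cartesian_product)
  also have "\<dots> \<le> num_machines T n" by (simp add: num_machines_def)
  finally have cE: "card E \<le> num_machines T n" .
  obtain es where es: "distinct es" "set es = E" using finite_distinct_list[OF finE] by blast
  then have len: "length es \<le> num_machines T n" using cE distinct_card by fastforce
  have "\<forall>e\<in>E. \<exists>p. (\<lambda>(u, v). {u, v}) p = e" using sub by blast
  then obtain f where f: "\<And>e. e \<in> E \<Longrightarrow> (\<lambda>(u, v). {u, v}) (f e) = e" by metis
  define inp where "inp i = (if i < length es then [f (es ! i)] else [])" for i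
  have "concat (map inp [0..<length es + d]) = map f es" for d
  proof (induction d)
    case 0
    have "map inp [0..<length es] = map (\<lambda>e. [f e]) es"
      by (rule nth_equalityI) (auto simp: inp_def)
    then show ?case by simp
  qed (simp add: inp_def)
  from this[of "num_machines T n - length es"] have conc: "concat (map inp [0..<num_machines T n]) = map f es"
    using len by simp
  have "map (\<lambda>(u, v). {u, v}) (map f es) = es"
    unfolding map_map
  proof (rule map_idI)
    fix e assume "e \<in> set es"
    then show "((\<lambda>(u, v). {u, v}) \<circ> f) e = e" unfolding es(2) o_apply by (rule f)
  qed
  then have "input_distribution (clustering_algorithm T B k W) n E inp"
    using es conc by (simp add: input_distribution_def Let_def clustering_algorithm_def inp_def encode_pairs_def
        split: prod.splits)
  then show ?thesis by blast
qed

text \<open>With base \<open>n + 1 \<ge> 2\<close> the exponent splits as \<open>7 + T + 2\<close>,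
  for \<open>100 \<le> 2 ^ 7\<close>, \<open>Suc T \<le> 2 ^ T\<close> and \<open>n * n\<close>. The
  factor 100 is there because the range of the random words is 100 times the number of
  machines.\<close>

lemma num_machines_le:
  assumes "n > 0"
  shows "100 * num_machines T n \<le> (n + 1) ^ (T + 9)"
proof -
  have two: "2 ^ m \<le> (n + 1) ^ m" for m using assms by (intro power_mono) auto
  have "Suc T \<le> 2 ^ T" by (rule Suc_leI) (rule less_exp)
  then have "Suc T \<le> (n + 1) ^ T" using two[of T] by simp
  moreover have "n * n \<le> (n + 1) ^ 2" by (simp add: power2_eq_square)
  moreover have "100 \<le> (n + 1) ^ 7" using two[of 7] by simp
  ultimately have "100 * (Suc T * (n * n)) \<le> (n + 1) ^ 7 * ((n + 1) ^ T * (n + 1) ^ 2)"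
    by (intro mult_le_mono)
  also have "\<dots> = (n + 1) ^ (7 + (T + 2))" by (simp only: power_add)
  also have "7 + (T + 2) = T + 9" by simp
  finally show ?thesis by (simp only: num_machines_def mult.assoc)
qed

lemma clustering_algorithm_correct:
  assumes G: "signed_graph {..<n} E" and n: "n > 0" and T: "T > 0" and B: "B n > 0" "n \<le> B n ^ T"
    and k: "15000 * ln n \<le> real (k n)" "k n > 0"
    and W: "W = (\<lambda>n. 100 * num_machines T n)"
    and inp: "input_distribution (clustering_algorithm T B k W) n E inp"
  defines "A \<equiv> clustering_algorithm T B k W"
  shows "h \<in> set_pmf (execution A n inp) \<Longrightarrow> respects_mpc_model (T + 9) A n h"
    and "h \<in> set_pmf (execution A n inp) \<Longrightarrow>
      total_memory (machines A n) h \<le> 2 * card E + (2 * k n + 7) * (4 * Suc T * card E)"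
    and "measure_pmf.prob (execution A n inp) {h. succeeds 4254 A n E h} \<ge> 1 - 1 / n"
proof -
  let ?M = "num_machines T n"
  let ?\<Omega> = "Pi_pmf {..<?M} (\<lambda>_. 0) (\<lambda>_. Pi_pmf {..<k n} 0 (\<lambda>_. uniform_below (W n)))"
  let ?r = "Suc (5 * (2 * T + 1))"
  define R where "R \<omega> = run ?M
        (\<lambda>r i. clustering_step T (B n) (k n) n r i (if r = Suc T then \<omega> i else (\<lambda>_. 0)))
        (initial_profile inp)" for \<omega>
  have ex: "execution A n inp = map_pmf (\<lambda>\<omega>. map (R \<omega>) [0..<Suc ?r]) ?\<Omega>"
    unfolding A_def R_def by (rule execution_clustering_algorithm)
  have A: "machines A n = ?M" "machine_memory A n = (1 + B n) * (2 * k n + 7)"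
    by (simp_all add: A_def clustering_algorithm_def)
  have Mpos: "?M > 0" using n by (simp add: num_machines_def)
  have Wpos: "W n > 0" using Mpos by (simp add: W)
  have cn: "clustering_network n T (B n) E" by unfold_locales (use G n T B in auto)
  have spread: "clustering_network.spread n T E inp" 
    using inp by (simp add: clustering_network.spread_def[OF cn] input_distribution_def clustering_algorithm_def)
  have len: "length (encode_pairs (inp i)) \<le> (1 + B n) * (2 * k n + 7)" if "i < ?M" for i
    using inp that by (simp add: input_distribution_def clustering_algorithm_def)
  {
    assume "h \<in> set_pmf (execution A n inp)"
    then obtain \<omega> where \<omega>: "\<omega> \<in> set_pmf ?\<Omega>" and h: "h = map (R \<omega>) [0..<Suc ?r]"
      unfolding ex by auto
    interpret clustering_network n T "B n" "k n" E \<omega> by (rule cn)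
    have R: "R \<omega> = prof (initial_profile inp)" by (simp add: R_def prof_def)
    have hR: "h \<noteq> []" "set h \<subseteq> range (prof (initial_profile inp))" unfolding h R by auto
    \<comment> \<open>Entries outside the drawn table have the default value 0, so the bound holds
      for all indices.\<close>
    have small: "\<omega> i c < W n" for i c
    proof (cases "i < ?M \<and> c < k n")
      case True
      then have "\<omega> i \<in> set_pmf (Pi_pmf {..<k n} 0 (\<lambda>_. uniform_below (W n)))"
        using \<omega> by (auto simp: set_Pi_pmf PiE_dflt_def)
      then show ?thesis using True Wpos by (auto simp: set_Pi_pmf PiE_dflt_def set_pmf_of_set lessThan_empty_iff)
    next
      case False
      have "\<omega> i c = 0"
      proof (cases "i < ?M")
        case True
        then have "\<omega> i \<in> set_pmf (Pi_pmf {..<k n} 0 (\<lambda>_. uniform_below (W n)))"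
          using \<omega> by (auto simp: set_Pi_pmf PiE_dflt_def)
        then show ?thesis using False True by (auto simp: set_Pi_pmf PiE_dflt_def)
      next
        case False
        then show ?thesis using \<omega> by (auto simp: set_Pi_pmf PiE_dflt_def)
      qed
      then show ?thesis using Wpos by simp
    qed
    have WM: "W n \<le> (n + 1) ^ (T + 9)" unfolding W using num_machines_le[OF n] by simp
    have n2: "2 * n + 2 \<le> (n + 1) ^ (T + 9)"
    proof -
      have "2 * n + 2 \<le> (n + 1) ^ 2" using n by (simp add: power2_eq_square)
      also have "\<dots> \<le> (n + 1) ^ (T + 9)" by (intro power_increasing) auto
      finally show ?thesis .
    qed
    have M: "?M \<le> (n + 1) ^ (T + 9)" using num_machines_le[OF n, of T] by simp
    have words: "words_below ((n + 1) ^ (T + 9)) ?M (prof (initial_profile inp) q)" for q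
      using less_le_trans[OF small WM] n2 M by (intro words_below_prof_input[OF spread]) auto
    show "respects_mpc_model (T + 9) A n h"
      unfolding respects_mpc_model_def A
    proof (intro conjI ballI allI impI)
      fix a assume "a \<in> set h"
      then obtain q where a: "a = prof (initial_profile inp) q" using hR by auto
      show "words_below ((n + 1) ^ (T + 9)) ?M a" unfolding a by (rule words)
      fix i assume i: "i < ?M"
      show "memory_usage ?M a i \<le> (1 + B n) * (2 * k n + 7)"
        unfolding a by (rule usage_le_machine_memory[OF spread i len[OF i]]) simp
    qed (rule M)
    show "total_memory (machines A n) h \<le> 2 * card E + (2 * k n + 7) * (4 * Suc T * card E)"
      unfolding A by (rule total_memory_prof_le[OF spread hR])
  }
  \<comment> \<open>The neighbourhoods as sets of root machines, one for each vertex, hence at most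
    \<open>n\<close> of them.\<close>
  define F where "F = (\<lambda>u. (\<lambda>v. addr n T v 0) ` nbrs E u) ` {..<n}"
  have good: "succeeds 4254 A n E (map (R \<omega>) [0..<Suc ?r])" if "\<forall>X\<in>F. \<forall>Y\<in>F. \<not> misjudged (k n) \<omega> X Y" for \<omega>
  proof -
    interpret clustering_network n T "B n" "k n" E \<omega> by (rule cn)
    have ag: "agreement_nat n E Ag"
      by (rule agreement_if_not_misjudged) (use that in \<open>auto simp: F_def vertex_def\<close>)
    have R: "R \<omega> = prof (initial_profile inp)" by (simp add: R_def prof_def)
    have last: "last (map f [0..<Suc q]) = f q" for f :: "nat \<Rightarrow> profile" and q by simp
    show ?thesis unfolding succeeds_def A R last
      by (intro exI conjI) (rule outputs_labels[OF spread], rule agreement_nat.approximate_clustering_labels[OF ag])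
  qed
  have FI: "X \<subseteq> {..<?M} \<and> X \<noteq> {}" if X: "X \<in> F" for X
  proof -
    interpret clustering_network n T "B n" "k n" E "\<lambda>_ _. 0" by (rule cn)
    obtain u where u: "u < n" "X = vertex ` N u" using X by (auto simp: F_def vertex_def)
    have "vertex v < ?M" if "v \<in> N u" for v
      by (rule active_less[OF active_vertex[OF N_less(1)[OF that]]])
    then show ?thesis using u self_N[OF u(1)] by auto
  qed
  have "1 - 1 / real n \<le> measure_pmf.prob ?\<Omega> {\<omega>. \<forall>X\<in>F. \<forall>Y\<in>F. \<not> misjudged (k n) \<omega> X Y}"
  proof (rule prob_no_misjudged_ge)
    show "card F \<le> n" unfolding F_def using card_image_le[of "{..<n}"] by fastforce
  qed (use FI n k Wpos in \<open>auto simp: F_def W\<close>)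
  also have "\<dots> \<le> measure_pmf.prob ?\<Omega> ((\<lambda>\<omega>. map (R \<omega>) [0..<Suc ?r]) -` {h. succeeds 4254 A n E h})"
    using good by (intro measure_pmf.finite_measure_mono) auto
  finally show "measure_pmf.prob (execution A n inp) {h. succeeds 4254 A n E h} \<ge> 1 - 1 / n"
    unfolding ex by simp
qed

theorem theorem1p1:
  fixes \<delta> :: real
  assumes "\<delta> > 0"
  shows "\<exists>(A :: mpc_algorithm) (c :: nat) (R :: nat) (\<alpha> :: real) (K :: real) (L :: real).
    \<forall>(n :: nat) (Ep :: nat set set). n \<ge> 1 \<longrightarrow> signed_graph {..<n} Ep \<longrightarrow>
      rounds A n \<le> R \<and>
      real (machine_memory A n) \<le> K * real n powr \<delta> \<and>
      (\<exists>inp. input_distribution A n Ep inp) \<and>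
      (\<forall>inp. input_distribution A n Ep inp \<longrightarrow>
        (\<forall>h\<in>set_pmf (execution A n inp).
          respects_mpc_model c A n h \<and>
          (n \<ge> 2 \<longrightarrow>
            real (total_memory (machines A n) h) \<le> L * real (card Ep) * log 2 (real n))) \<and>
        measure_pmf.prob (execution A n inp) {h. succeeds \<alpha> A n Ep h} \<ge> 1 - 1 / real n)"
proof -
  \<comment> \<open>Half of the exponent pays for the branching \<open>B\<close>; the other half
    absorbs the logarithmic length of the sketches.\<close>
  define a where "a = \<delta> / 2"
  \<comment> \<open>At least \<open>2 / \<delta>\<close> levels, so that
    \<open>(n powr a) ^ T\<close> reaches \<open>n\<close>.\<close>
  define T where "T = Suc (nat \<lceil>2 / \<delta>\<rceil>)"
  define B where "B n = Suc (nat \<lceil>real n powr a\<rceil>)" for n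
  \<comment> \<open>The successor keeps \<open>k\<close> positive at \<open>n = 1\<close>, where the
    logarithm vanishes.\<close>
  define k where "k n = Suc (nat \<lceil>15000 * ln (real n)\<rceil>)" for n
  define W where "W = (\<lambda>n. 100 * num_machines T n)"
  define A where "A = clustering_algorithm T B k W"
  \<comment> \<open>The factors come from \<open>1 + B n \<le> 4 * n powr a\<close> and
    \<open>2 * k n + 7 \<le> (30000 / a + 11) * n powr a\<close>.\<close>
  define K where "K = 4 * (30000 / a + 11)"
  define L where "L = 2 + 30011 * (4 * real (Suc T))"
  have a: "a > 0" using assms by (simp add: a_def)
  have B_ge: "real n powr a \<le> real (B n)" and B_le: "real (B n) \<le> real n powr a + 2" for n
    unfolding B_def using powr_ge_zero[of "real n" a] by linarith+
  have k_ge: "15000 * ln (real n) \<le> real (k n)" for n unfolding k_def by linarith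
  have k_le: "real (k n) \<le> 15000 * ln (real n) + 2" if "n \<ge> 1" for n
  proof -
    have "0 \<le> ln (real n)" using that by simp
    then show ?thesis unfolding k_def by linarith
  qed
  have n_le: "n \<le> B n ^ T" if n: "n \<ge> 1" for n
  proof -
    have "2 / \<delta> \<le> real T" unfolding T_def by linarith
    then have "1 \<le> a * real T" using assms by (simp add: a_def field_simps)
    then have "real n powr 1 \<le> real n powr (a * real T)" using n by (intro powr_mono) auto
    also have "\<dots> = (real n powr a) ^ T" using n by (simp add: powr_powr[symmetric] powr_realpow)
    also have "\<dots> \<le> real (B n) ^ T" using B_ge by (intro power_mono) auto
    finally have "real n \<le> real (B n ^ T)" using n by simp
    then show ?thesis by (simp only: of_nat_le_iff)
  qed
  have mem: "real (machine_memory A n) \<le> K * real n powr \<delta>" if n: "n \<ge> 1" for n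
  proof -
    let ?p = "real n powr a"
    have p: "1 \<le> ?p" using n a by (intro ge_one_powr_ge_zero) auto
    have "ln (real n) \<le> ?p / a" using n a by (intro ln_powr_bound) auto
    then have "2 * real (k n) + 7 \<le> 30000 / a * ?p + 11" using k_le[OF n] by simp
    also have "\<dots> \<le> 30000 / a * ?p + 11 * ?p" using p by simp
    also have "\<dots> = (30000 / a + 11) * ?p" by (simp add: algebra_simps)
    finally have 1: "2 * real (k n) + 7 \<le> (30000 / a + 11) * ?p" .
    have 2: "1 + real (B n) \<le> 4 * ?p" using B_le[of n] p by simp
    have "real (machine_memory A n) = (1 + real (B n)) * (2 * real (k n) + 7)"
      by (simp add: A_def clustering_algorithm_def algebra_simps)
    also have "\<dots> \<le> (4 * ?p) * ((30000 / a + 11) * ?p)" using 1 2 by (intro mult_mono) auto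
    also have "\<dots> = K * (?p * ?p)" by (simp add: K_def)
    also have "?p * ?p = real n powr \<delta>" by (simp add: powr_add[symmetric] a_def)
    finally show ?thesis .
  qed
  have tot: "real (2 * card Ep + (2 * k n + 7) * (4 * Suc T * card Ep)) \<le> L * real (card Ep) * log 2 (real n)"
    if n: "n \<ge> 2" for n and Ep :: "nat set set"
  proof -
    let ?l = "log 2 (real n)"
    \<comment> \<open>As the logarithm is at least 1, it absorbs the additive 11 in
      \<open>30000 * ln n + 11\<close>, which gives 30011.\<close>
    have l: "1 \<le> ?l" using n by (simp add: le_log_iff)
    have "ln (real n) \<le> ?l"
    proof -
      have "ln (2::real) \<le> 1" using ln_2_less_1 by simp
      moreover have "ln (real n) \<ge> 0" using n by simp
      moreover have "ln (2::real) > 0" by simp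
      ultimately show ?thesis unfolding log_def by (simp add: le_divide_eq mult_left_le)
    qed
    then have "2 * real (k n) + 7 \<le> 30011 * ?l" using k_le[of n] n l by linarith
    then have "(2 * real (k n) + 7) * (4 * real (Suc T) * real (card Ep))
        \<le> (30011 * ?l) * (4 * real (Suc T) * real (card Ep))"
      by (intro mult_right_mono) auto
    moreover have "2 * real (card Ep) \<le> 2 * real (card Ep) * ?l"
      using mult_left_mono[OF l, of "2 * real (card Ep)"] by simp
    ultimately have "2 * real (card Ep) + (2 * real (k n) + 7) * (4 * real (Suc T) * real (card Ep))
        \<le> 2 * real (card Ep) * ?l + (30011 * ?l) * (4 * real (Suc T) * real (card Ep))" by linarith
    also have "\<dots> = L * real (card Ep) * ?l" unfolding L_def by (simp only: ring_distribs mult_ac)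
    finally show ?thesis by (simp only: of_nat_add of_nat_mult of_nat_numeral)
  qed
  have pos: "T > 0" "B n > 0" "k n > 0" for n by (simp_all add: T_def B_def k_def)
  show ?thesis
  proof (rule exI[of _ A], rule exI[of _ "T + 9"], rule exI[of _ "Suc (5 * (2 * T + 1))"],
      rule exI[of _ 4254], rule exI[of _ K], rule exI[of _ L], intro allI impI conjI ballI)
    fix n and Ep :: "nat set set"
    assume n: "1 \<le> n" and G: "signed_graph {..<n} Ep"
    then have n0: "n > 0" by simp
    show "rounds A n \<le> Suc (5 * (2 * T + 1))" by (simp add: A_def clustering_algorithm_def)
    show "real (machine_memory A n) \<le> K * real n powr \<delta>" by (rule mem[OF n])
    show "\<exists>inp. input_distribution A n Ep inp"
      unfolding A_def by (rule input_distribution_exists[OF G n0])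
    fix inp assume inp: "input_distribution A n Ep inp"
    note correct = clustering_algorithm_correct[OF G n0 pos(1) pos(2) n_le[OF n] k_ge pos(3) W_def
        inp[unfolded A_def], folded A_def]
    show "1 - 1 / real n \<le> measure_pmf.prob (execution A n inp) {h. succeeds 4254 A n Ep h}"
      by (rule correct(3))
    fix h assume h: "h \<in> set_pmf (execution A n inp)"
    show "respects_mpc_model (T + 9) A n h" by (rule correct(1)[OF h])
    assume n2: "2 \<le> n"
    have "real (total_memory (machines A n) h) \<le> real (2 * card Ep + (2 * k n + 7) * (4 * Suc T * card Ep))"
      using correct(2)[OF h] by (rule of_nat_mono)
    also have "\<dots> \<le> L * real (card Ep) * log 2 (real n)" by (rule tot[OF n2])
    finally show "real (total_memory (machines A n) h) \<le> L * real (card Ep) * log 2 (real n)" .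
  qed
qed

end
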